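(* Let $3\le n\le 250$ be an integer and let $g$ be a probability density on $[0,1]$. The Gerow--Robson density on $M(n)$ corresponding to $g$ defines a random balanced sample distribution in exactly two cases: $n=3$ with $g(s)=3s^2$, and $n=4$ with $g(s)=4s^3$ (densities being identified when they agree almost everywhere).
   Context: A random balanced sample (RBS) of size $n$ is a system of random variables $\vec X=(X_1,\dots,X_n)$ such that $\sum_{k=1}^n X_k=0$ and each $X_k$ is uniformly distributed on $[-1,1]$. An RBS distribution is the distribution of such a vector. $M(n)=\{\vec x\in[-1,1]^n:\sum_{k=1}^n x_k=0\}$. Let $v_{n-1}$ be the $(n-1)$-dimensional Lebesgue measure on the hyperplane $\{\vec x\in\mathbb{R}^n:\sum_k x_k=0\}$, regarded as an isometric copy of $\mathbb{R}^{n-1}$, and $V_{n-1}=v_{n-1}(M(n))$. Let $\|\vec x\|_\infty=\max_{1\le k\le n}|x_k|$. A Gerow--Robson (G--R) density on $M(n)$ is a probability density $h$ with respect to $v_{n-1}$ of the form $h(\vec x)=f(\|\vec x\|_\infty)$ for $\vec x\in M(n)$, for some $f:[0,1]\to[0,\infty)$. For a probability density $g$ on $[0,1]$, the G--R density corresponding to $g$ is $$h(\vec x)=\frac{g(\|\vec x\|_\infty)}{(n-1)\,V_{n-1}\,\|\vec x\|_\infty^{\,n-2}}\qquad(\vec x\in M(n),\ \vec x\neq 0);$$ equivalently, it is the G--R density for which $\|\vec X\|_\infty$ has density $g$ on $[0,1]$. It "defines an RBS distribution" if a random vector $\vec X$ in $M(n)$ with density $h$ with respect to $v_{n-1}$ is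 an RBS. *)

theory Defs
  imports "HOL-Probability.Probability"
begin

text \<open>
  Vectors in $R^n$ are functions on the index set \<open>{..<n}\<close>, extended by \<open>undefined\<close>, i.e. elements
  of \<open>{..<n} \<rightarrow>\<^sub>E UNIV\<close>, the space of the product measures \<open>Pi\<^sub>M {..<n} _\<close>.  Coordinates are
  numbered from 0.
\<close>

definition sum_zero_hyperplane :: "nat \<Rightarrow> (nat \<Rightarrow> real) set" where
  "sum_zero_hyperplane n = {x \<in> {..<n} \<rightarrow>\<^sub>E UNIV. (\<Sum>k<n. x k) = 0}"

definition balanced_cube :: "nat \<Rightarrow> (nat \<Rightarrow> real) set" where
  "balanced_cube n = {x \<in> {..<n} \<rightarrow>\<^sub>E {-1..1}. (\<Sum>k<n. x k) = 0}"

definition sup_norm :: "nat \<Rightarrow> (nat \<Rightarrow> real) \<Rightarrow> real" where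
  "sup_norm n x = Max ((\<lambda>k. \<bar>x k\<bar>) ` {..<n})"

text \<open>
  The Helmert vectors $(1, \dots, 1, -(j+1), 0, \dots, 0) / \sqrt{(j+1)(j+2)}$ (with $j+1$ leading
  ones), for $j < n - 1$, form an orthonormal basis of the hyperplane of vectors with coordinate
  sum 0.  The resulting isometry with $R^{n-1}$ transports Lebesgue measure to the hyperplane;
  since Lebesgue measure is invariant under isometries, any other isometry would yield the same
  measure.
\<close>

definition helmert :: "nat \<Rightarrow> nat \<Rightarrow> real" where
  "helmert j i = (if i \<le> j then 1 else if i = Suc j then - real (Suc j) else 0)
                   / sqrt (real (Suc j) * real (Suc (Suc j)))"

definition hyperplane_isometry :: "nat \<Rightarrow> (nat \<Rightarrow> real) \<Rightarrow> (nat \<Rightarrow> real)" where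
  "hyperplane_isometry n y = (\<lambda>i\<in>{..<n}. \<Sum>j<n - 1. y j * helmert j i)"

text \<open>
  This is a measure on all of $R^n$, concentrated on the hyperplane.
\<close>

definition hyperplane_lebesgue :: "nat \<Rightarrow> (nat \<Rightarrow> real) measure" where
  "hyperplane_lebesgue n =
     distr (Pi\<^sub>M {..<n - 1} (\<lambda>_. lborel)) (Pi\<^sub>M {..<n} (\<lambda>_. borel)) (hyperplane_isometry n)"

definition balanced_cube_volume :: "nat \<Rightarrow> real" where
  "balanced_cube_volume n = measure (hyperplane_lebesgue n) (balanced_cube n)"

definition unit_interval_density :: "(real \<Rightarrow> real) \<Rightarrow> bool" where
  "unit_interval_density g \<longleftrightarrow>
     set_borel_measurable lborel {0..1} g \<and> (\<forall>s\<in>{0..1}. 0 \<le> g s) \<and>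
     (\<integral>\<^sup>+s\<in>{0..1}. ennreal (g s) \<partial>lborel) = 1"

text \<open>
  At the origin, a null set, this is 0 for $n \ge 3$ by the convention on division by 0.
\<close>

definition gr_density :: "nat \<Rightarrow> (real \<Rightarrow> real) \<Rightarrow> (nat \<Rightarrow> real) \<Rightarrow> real" where
  "gr_density n g x =
     g (sup_norm n x) / (real (n - 1) * balanced_cube_volume n * sup_norm n x ^ (n - 2))"

definition gr_distribution :: "nat \<Rightarrow> (real \<Rightarrow> real) \<Rightarrow> (nat \<Rightarrow> real) measure" where
  "gr_distribution n g =
     density (restrict_space (hyperplane_lebesgue n) (balanced_cube n)) (\<lambda>x. ennreal (gr_density n g x))"

definition random_balanced_sample :: "'a measure \<Rightarrow> nat \<Rightarrow> (nat \<Rightarrow> 'a \<Rightarrow> real) \<Rightarrow> bool" where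
  "random_balanced_sample P n X \<longleftrightarrow>
     prob_space P \<and>
     (\<forall>k<n. X k \<in> borel_measurable P \<and> distr P borel (X k) = uniform_measure lborel {-1..1}) \<and>
     (AE \<omega> in P. (\<Sum>k<n. X k \<omega>) = 0)"

text \<open>
  The random vector is realised canonically, by the coordinate functions on the space \<open>balanced_cube n\<close>.
  Being a random balanced sample depends only on the joint distribution: see
  \<open>random_balanced_sample_distr\<close> below.
\<close>

definition gr_defines_rbs :: "nat \<Rightarrow> (real \<Rightarrow> real) \<Rightarrow> bool" where
  "gr_defines_rbs n g \<longleftrightarrow> random_balanced_sample (gr_distribution n g) n (\<lambda>k x. x k)"


subsection \<open>Sanity checks\<close>

lemma sum_helmert:
  assumes "Suc j < n"
  shows "(\<Sum>i<n. helmert j i) = 0"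
    and "(\<Sum>i<n. (helmert j i)\<^sup>2) = 1"
proof -
  define c where "c = sqrt (real (Suc j) * real (Suc (Suc j)))"
  have c: "c > 0" "c\<^sup>2 = real (Suc j) * real (Suc (Suc j))"
    by (auto simp: c_def)
  have split: "(\<Sum>i<n. f i) = (\<Sum>i<Suc j. f i) + f (Suc j)"
    if "\<And>i. i > Suc j \<Longrightarrow> f i = 0" for f :: "nat \<Rightarrow> real"
  proof -
    have "(\<Sum>i<n. f i) = (\<Sum>i<Suc (Suc j). f i)"
      using assms that by (intro sum.mono_neutral_right) auto
    then show ?thesis by simp
  qed
  have e1: "helmert j i = 1 / c" if "i < Suc j" for i
    using that by (simp add: helmert_def c_def)
  have e2: "helmert j (Suc j) = - real (Suc j) / c"
    by (simp add: helmert_def c_def)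
  have e3: "helmert j i = 0" if "i > Suc j" for i
    using that by (simp add: helmert_def)
  show "(\<Sum>i<n. helmert j i) = 0"
    using split[of "helmert j"] e1 e2 e3 by (simp add: add_divide_distrib[symmetric])
  have "(\<Sum>i<n. (helmert j i)\<^sup>2) = (\<Sum>i<Suc j. (helmert j i)\<^sup>2) + (helmert j (Suc j))\<^sup>2"
    by (rule split) (simp add: e3)
  also have "\<dots> = (\<Sum>i<Suc j. (1 / c)\<^sup>2) + (- real (Suc j) / c)\<^sup>2"
    unfolding e2 by (intro arg_cong2[where f = "(+)"] sum.cong refl) (simp add: e1)
  also have "\<dots> = (real (Suc j) + (real (Suc j))\<^sup>2) / c\<^sup>2"
    by (simp add: power_divide add_divide_distrib) (simp add: power2_eq_square algebra_simps)
  also have "\<dots> = 1"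
    unfolding c(2) by (simp add: power2_eq_square divide_simps) (simp add: algebra_simps)
  finally show "(\<Sum>i<n. (helmert j i)\<^sup>2) = 1" .
qed

lemma helmert_orthogonal:
  assumes "j < k" "Suc k < n"
  shows "(\<Sum>i<n. helmert j i * helmert k i) = 0"
proof -
  have "helmert j i * helmert k i = helmert k 0 * helmert j i" for i
    using assms by (auto simp: helmert_def)
  then have "(\<Sum>i<n. helmert j i * helmert k i) = helmert k 0 * (\<Sum>i<n. helmert j i)"
    by (simp only: sum_distrib_left)
  then show ?thesis using assms sum_helmert(1)[of j n] by simp
qed

lemma helmert_orthonormal:
  assumes "j < n - 1" "k < n - 1"
  shows "(\<Sum>i<n. helmert j i * helmert k i) = (if j = k then 1 else 0)"
proof (cases j k rule: linorder_cases)
  case less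
  then show ?thesis using assms helmert_orthogonal[of j k n] by simp
next
  case equal
  then show ?thesis using assms sum_helmert(2)[of j n] by (simp add: power2_eq_square)
next
  case greater
  then show ?thesis using assms helmert_orthogonal[of k j n] by (simp add: mult.commute)
qed

lemma helmert_spans:
  "(\<Sum>i<Suc m. x i) = 0 \<Longrightarrow> \<exists>y. \<forall>i<Suc m. x i = (\<Sum>j<m. y j * helmert j i)"
proof (induction m arbitrary: x)
  case 0
  then show ?case by simp
next
  case (Suc m)
  have nz: "helmert m (Suc m) \<noteq> 0" by (simp add: helmert_def)
  define t where "t = x (Suc m) / helmert m (Suc m)"
  define x' where "x' = (\<lambda>i. x i - t * helmert m i)"
  have x'0: "x' (Suc m) = 0" using nz by (simp add: x'_def t_def)
  have "(\<Sum>i<Suc (Suc m). x' i) = 0"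
    using Suc.prems sum_helmert(1)[of m "Suc (Suc m)"]
    by (simp only: x'_def sum_subtractf sum_distrib_left[symmetric])
  then have "(\<Sum>i<Suc m. x' i) = 0" using x'0 by simp
  from Suc.IH[OF this] obtain y where y: "\<forall>i<Suc m. x' i = (\<Sum>j<m. y j * helmert j i)" by blast
  have last: "(\<Sum>j<m. y j * helmert j (Suc m)) = 0"
    by (intro sum.neutral) (auto simp: helmert_def)
  have "x' i = (\<Sum>j<m. y j * helmert j i)" if "i < Suc (Suc m)" for i
    using that y last x'0 by (cases "i = Suc m") auto
  moreover have "(\<Sum>j<m. (y(m := t)) j * helmert j i) = (\<Sum>j<m. y j * helmert j i)" for i
    by (intro sum.cong) auto
  ultimately have "\<forall>i<Suc (Suc m). x i = (\<Sum>j<Suc m. (y(m := t)) j * helmert j i)"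
    by (auto simp: x'_def algebra_simps)
  then show ?case by blast
qed

lemma hyperplane_isometry_dist:
  "(\<Sum>i<n. (hyperplane_isometry n y i - hyperplane_isometry n z i)\<^sup>2) = (\<Sum>j<n - 1. (y j - z j)\<^sup>2)"
proof -
  define d where "d j = y j - z j" for j
  have "(\<Sum>i<n. (hyperplane_isometry n y i - hyperplane_isometry n z i)\<^sup>2)
        = (\<Sum>i<n. (\<Sum>j<n - 1. d j * helmert j i)\<^sup>2)"
    by (intro sum.cong) (auto simp: hyperplane_isometry_def d_def left_diff_distrib sum_subtractf)
  also have "\<dots> = (\<Sum>i<n. \<Sum>j<n - 1. \<Sum>k<n - 1. d j * d k * (helmert j i * helmert k i))"
    by (simp add: power2_eq_square sum_product mult_ac)
  also have "\<dots> = (\<Sum>j<n - 1. \<Sum>i<n. \<Sum>k<n - 1. d j * d k * (helmert j i * helmert k i))"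
    by (rule sum.swap)
  also have "\<dots> = (\<Sum>j<n - 1. \<Sum>k<n - 1. \<Sum>i<n. d j * d k * (helmert j i * helmert k i))"
    by (intro sum.cong refl sum.swap)
  also have "\<dots> = (\<Sum>j<n - 1. \<Sum>k<n - 1. d j * d k * (if j = k then 1 else 0))"
    by (intro sum.cong refl) (simp only: sum_distrib_left[symmetric] helmert_orthonormal lessThan_iff)
  also have "\<dots> = (\<Sum>j<n - 1. (d j)\<^sup>2)"
    by (intro sum.cong refl) (simp add: if_distrib power2_eq_square sum.delta' cong: if_cong)
  finally show ?thesis by (simp add: d_def)
qed

lemma hyperplane_isometry_bij:
  assumes "n \<ge> 1"
  shows "bij_betw (hyperplane_isometry n) ({..<n - 1} \<rightarrow>\<^sub>E UNIV) (sum_zero_hyperplane n)"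
  unfolding bij_betw_def
proof (intro conjI inj_onI subset_antisym subsetI)
  fix y z :: "nat \<Rightarrow> real"
  assume yz: "y \<in> {..<n - 1} \<rightarrow>\<^sub>E UNIV" "z \<in> {..<n - 1} \<rightarrow>\<^sub>E UNIV"
    and eq: "hyperplane_isometry n y = hyperplane_isometry n z"
  have "(\<Sum>j<n - 1. (y j - z j)\<^sup>2) = 0"
    using hyperplane_isometry_dist[of n y z] eq by simp
  then have "\<forall>j<n - 1. y j = z j"
    by (subst (asm) sum_nonneg_eq_0_iff) auto
  then show "y = z" using yz by (intro PiE_ext[OF yz]) auto
next
  fix x assume "x \<in> hyperplane_isometry n ` ({..<n - 1} \<rightarrow>\<^sub>E UNIV)"
  then obtain y where x: "x = hyperplane_isometry n y" by auto
  have "(\<Sum>i<n. x i) = (\<Sum>i<n. \<Sum>j<n - 1. y j * helmert j i)"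
    by (intro sum.cong) (auto simp: x hyperplane_isometry_def)
  also have "\<dots> = (\<Sum>j<n - 1. \<Sum>i<n. y j * helmert j i)"
    by (rule sum.swap)
  also have "\<dots> = 0"
    by (intro sum.neutral) (auto simp: sum_distrib_left[symmetric] sum_helmert(1))
  finally show "x \<in> sum_zero_hyperplane n"
    by (auto simp: sum_zero_hyperplane_def x hyperplane_isometry_def)
next
  fix x assume "x \<in> sum_zero_hyperplane n"
  then have x: "x \<in> {..<n} \<rightarrow>\<^sub>E UNIV" "(\<Sum>i<Suc (n - 1). x i) = 0"
    using assms by (auto simp: sum_zero_hyperplane_def)
  from helmert_spans[OF x(2)] obtain y
    where y: "\<forall>i<n. x i = (\<Sum>j<n - 1. y j * helmert j i)" using assms by auto
  have "x = hyperplane_isometry n (restrict y {..<n - 1})"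
  proof (rule ext)
    fix i
    show "x i = hyperplane_isometry n (restrict y {..<n - 1}) i"
      using y x(1) by (cases "i < n") (auto simp: hyperplane_isometry_def PiE_def extensional_def)
  qed
  then show "x \<in> hyperplane_isometry n ` ({..<n - 1} \<rightarrow>\<^sub>E UNIV)" by auto
qed

lemma measurable_hyperplane_isometry:
  "hyperplane_isometry n \<in> measurable (Pi\<^sub>M {..<n - 1} (\<lambda>_. lborel)) (Pi\<^sub>M {..<n} (\<lambda>_. borel))"
proof -
  have "(\<lambda>y. y j) \<in> borel_measurable (Pi\<^sub>M {..<n - 1} (\<lambda>_. lborel :: real measure))" if "j < n - 1" for j
    using measurable_component_singleton[of j "{..<n - 1}" "\<lambda>_. lborel :: real measure"] that by simp
  then show ?thesis
    unfolding hyperplane_isometry_def[abs_def]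
    by (intro measurable_restrict borel_measurable_sum borel_measurable_times) auto
qed

lemma sets_hyperplane_lebesgue [simp]: "sets (hyperplane_lebesgue n) = sets (Pi\<^sub>M {..<n} (\<lambda>_. borel))"
  by (simp add: hyperplane_lebesgue_def)

lemma balanced_cube_measurable: "balanced_cube n \<in> sets (hyperplane_lebesgue n)"
proof -
  let ?N = "Pi\<^sub>M {..<n} (\<lambda>_. borel :: real measure)"
  have S: "(\<lambda>x. \<Sum>k<n. x k) \<in> borel_measurable ?N"
    by (intro borel_measurable_sum measurable_component_singleton) auto
  have "{x \<in> space ?N. (\<Sum>k<n. x k) = 0} \<in> sets ?N"
    using measurable_sets[OF S, of "{0}"] by (simp add: vimage_def Int_def conj_commute)
  moreover have "({..<n} \<rightarrow>\<^sub>E {-1..1::real}) \<in> sets ?N"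
    by (intro sets_PiM_I_finite) auto
  ultimately have "({..<n} \<rightarrow>\<^sub>E {-1..1}) \<inter> {x \<in> space ?N. (\<Sum>k<n. x k) = 0} \<in> sets ?N"
    by auto
  also have "({..<n} \<rightarrow>\<^sub>E {-1..1}) \<inter> {x \<in> space ?N. (\<Sum>k<n. x k) = 0} = balanced_cube n"
    by (auto simp: balanced_cube_def space_PiM PiE_def)
  finally show ?thesis by simp
qed

lemma gr_density_measurable:
  assumes "n \<ge> 1" "unit_interval_density g"
  shows "gr_density n g \<in> borel_measurable (restrict_space (hyperplane_lebesgue n) (balanced_cube n))"
proof -
  let ?R = "restrict_space (hyperplane_lebesgue n) (balanced_cube n)"
  have comp: "(\<lambda>x. x k) \<in> borel_measurable (hyperplane_lebesgue n)" if "k < n" for k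
    using measurable_component_singleton[of k "{..<n}" "\<lambda>_. borel :: real measure"] that
    by (simp add: hyperplane_lebesgue_def)
  have "(\<lambda>x. Max ((\<lambda>k. \<bar>x k\<bar>) ` {..<n})) \<in> borel_measurable (hyperplane_lebesgue n)"
    by (intro borel_measurable_Max borel_measurable_abs comp) auto
  then have norm: "sup_norm n \<in> borel_measurable ?R"
    by (intro measurable_restrict_space1) (simp add: sup_norm_def[abs_def])
  have unit: "sup_norm n x \<in> {0..1}" if x: "x \<in> balanced_cube n" for x
  proof -
    have "sup_norm n x \<in> (\<lambda>k. \<bar>x k\<bar>) ` {..<n}"
      unfolding sup_norm_def using assms by (intro Max_in) (auto simp: lessThan_empty_iff)
    then obtain k where k: "k < n" "sup_norm n x = \<bar>x k\<bar>" by auto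
    moreover have "x k \<in> {-1..1}" using x k(1) by (auto simp: balanced_cube_def PiE_def Pi_def)
    ultimately show ?thesis by auto
  qed
  have g: "(\<lambda>s. indicator {0..1} s * g s) \<in> borel_measurable borel"
    using assms(2) by (simp add: unit_interval_density_def set_borel_measurable_def)
  have "(\<lambda>x. indicator {0..1} (sup_norm n x) * g (sup_norm n x)) \<in> borel_measurable ?R"
    using measurable_compose[OF norm g] .
  moreover have "indicator {0..1} (sup_norm n x) * g (sup_norm n x) = g (sup_norm n x)"
    if "x \<in> space ?R" for x
    using that unit[of x] by (auto simp: space_restrict_space)
  ultimately have "(\<lambda>x. g (sup_norm n x)) \<in> borel_measurable ?R"
    by (subst (asm) measurable_cong) auto
  then show ?thesis
    unfolding gr_density_def[abs_def] using norm by measurable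
qed

lemma random_balanced_sample_distr:
  assumes "\<And>k. k < n \<Longrightarrow> X k \<in> borel_measurable P"
  shows "random_balanced_sample P n X \<longleftrightarrow>
    random_balanced_sample (distr P (Pi\<^sub>M {..<n} (\<lambda>_. borel)) (\<lambda>\<omega>. \<lambda>k\<in>{..<n}. X k \<omega>)) n (\<lambda>k x. x k)"
proof -
  let ?V = "\<lambda>\<omega>. \<lambda>k\<in>{..<n}. X k \<omega>"
  let ?N = "Pi\<^sub>M {..<n} (\<lambda>_. borel :: real measure)"
  have V[measurable]: "?V \<in> measurable P ?N"
    using assms by (intro measurable_restrict) auto
  have comp: "(\<lambda>x. x k) \<in> borel_measurable ?N" if "k < n" for k
    using that by (intro measurable_component_singleton) auto
  have marg: "distr (distr P ?N ?V) borel (\<lambda>x. x k) = distr P borel (X k)" if "k < n" for k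
    using that by (subst distr_distr[OF comp V]) (auto simp: comp_def intro!: distr_cong)
  have S: "(\<lambda>x. \<Sum>k<n. x k) \<in> borel_measurable ?N"
    by (intro borel_measurable_sum comp) auto
  have "{x \<in> space ?N. (\<Sum>k<n. x k) = 0} \<in> sets ?N"
    using measurable_sets[OF S, of "{0}"] by (simp add: vimage_def Int_def conj_commute)
  from AE_distr_iff[OF V this]
  have "(AE x in distr P ?N ?V. (\<Sum>k<n. x k) = 0) \<longleftrightarrow> (AE \<omega> in P. (\<Sum>k<n. X k \<omega>) = 0)" by simp
  moreover have "prob_space (distr P ?N ?V) \<longleftrightarrow> prob_space P"
    using V prob_space.prob_space_distr prob_space_distrD by blast
  ultimately show ?thesis
    using assms comp by (auto simp: random_balanced_sample_def marg)
qed

end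

theory Submission
  imports Defs
begin

text \<open>
  Condition on \<open>s = sup_norm n x\<close>: a Gerow--Robson vector is then uniform on the boundary of \<open>s M(n)\<close>, so
  \<open>\<bar>X\<^sub>k\<bar> = S R\<close> with \<open>S\<close> of density \<open>g\<close> and \<open>R\<close> independent of \<open>S\<close>, where \<open>R = 1\<close> with
  probability \<open>1/n\<close> and \<open>R\<close> has a density \<open>u\<close> on \<open>[0, 1]\<close> otherwise, \<open>u r\<close> being proportional to
  \<open>f (1 + r) + f (1 - r)\<close> for the cardinal B-spline \<open>f\<close> of order \<open>n - 2\<close>.

  For \<open>n = 3, 4\<close>, \<open>u\<close> is constant, and the equation that makes \<open>S R\<close> uniform can be solved
  explicitly for \<open>S\<close>.  For every \<open>n \<ge> 5\<close>, \<open>u r \<le> u 0 - \<epsilon> r\<^sup>2\<close> with \<open>\<epsilon> > 0\<close> and \<open>u 0 \<ge> 1\<close>.  Suppose that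
  \<open>S R\<close> is uniform.  Letting \<open>t \<rightarrow> 0\<close> in \<open>P (S R \<le> t) = t\<close> gives \<open>(1 - 1/n) (u 0) E (1/S) \<le> 1\<close>.  Inserting this
  into the equation for \<open>P (S R \<le> t)\<close>, the deficit \<open>\<epsilon> r\<^sup>2\<close> shows that
  \<open>F t = E (1/S; S \<le> t)\<close> is at least of order \<open>t\<^sup>2\<close>, while the equation for \<open>P (t < S R \<le> 3t/2)\<close> gives
  \<open>F (3t/2) \<ge> 7/3 F t\<close>, so that \<open>F\<close> decays faster than \<open>t\<^sup>2\<close>: a contradiction.
\<close>

subsection \<open>Lebesgue measure on the hyperplane in coordinates\<close>

text \<open>The exponent that excludes \<open>n \<ge> 5\<close> is visible in differential form. The
  equation for \<open>P (t < S R \<le> t')\<close> with \<open>t'\<close> close to \<open>t\<close>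
  says that \<open>t F'(t)\<close> is at least \<open>(n - 1) u(0) F(t)\<close>, because the atom of
  \<open>R\<close> at 1 has weight \<open>1/n\<close>; hence \<open>F\<close> vanishes at 0 at least
  like the power \<open>(n - 1) u(0)\<close> of \<open>t\<close>, and this power is at least 4 while
  the deficit only tolerates 2. A finite ratio avoids differentiating \<open>F\<close>: multiplying
  \<open>t\<close> by 3/2 multiplies \<open>F\<close> by at least \<open>1 + 4/3 = 7/3\<close>,
  which exceeds \<open>(3/2)\<^sup>2 = 9/4\<close>. Facets are integrated in coordinates rather than
  in the Helmert basis. One coordinate is omitted, and it can always be chosen different from both
  the observed coordinate and the one of largest modulus, since \<open>n \<ge> 3\<close>. The price
  is an unknown constant between the two measures; the same constant enters the volume of the cube,
  so it cancels in the density and never has to be computed.\<close>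

interpretation lborel_prod: product_sigma_finite "\<lambda>_ :: nat. lborel :: real measure"
  by standard

abbreviation Leb :: "nat set \<Rightarrow> (nat \<Rightarrow> real) measure" where
  "Leb I \<equiv> Pi\<^sub>M I (\<lambda>_. lborel)"

lemma measurable_Leb_eq: "measurable (Leb I) N = measurable (Pi\<^sub>M I (\<lambda>_. borel)) N"
  by (intro measurable_cong_sets sets_PiM_cong) auto

lemma Leb_component [measurable (raw)]: "k \<in> I \<Longrightarrow> (\<lambda>z. z k) \<in> borel_measurable (Leb I)"
  using measurable_component_singleton[of k I "\<lambda>_. lborel :: real measure"] by simp

text \<open>Both measures agree on boxes, where the claim splits into one-dimensional translations.
  The shift arises from adding a multiple of a Helmert vector, whose leading entries are all
  equal.\<close>

lemma Leb_translate:
  assumes I: "finite I" and F[measurable]: "F \<in> borel_measurable (Leb I)"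
  shows "(\<integral>\<^sup>+z. F (\<lambda>i\<in>I. z i + a i) \<partial>Leb I) = (\<integral>\<^sup>+z. F z \<partial>Leb I)"
proof -
  have [measurable]: "(\<lambda>z. \<lambda>i\<in>I. z i + a i) \<in> measurable (Leb I) (Leb I)"
    by (intro measurable_restrict) auto
  have "distr (Leb I) (Leb I) (\<lambda>z. \<lambda>i\<in>I. z i + a i) = Leb I"
  proof (rule lborel_prod.PiM_eqI[OF I])
    fix A :: "nat \<Rightarrow> real set" assume A: "\<And>i. i \<in> I \<Longrightarrow> A i \<in> sets lborel"
    have m: "(\<lambda>x. x + a i) -` A i \<in> sets lborel" if "i \<in> I" for i
      using measurable_sets[of "\<lambda>x. x + a i" lborel lborel "A i"] A[OF that] by simp
    have "(\<lambda>z. \<lambda>i\<in>I. z i + a i) -` (Pi\<^sub>E I A) \<inter> space (Leb I) = Pi\<^sub>E I (\<lambda>i. (\<lambda>x. x + a i) -` A i)"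
      by (auto simp: space_PiM PiE_iff)
    then have "emeasure (distr (Leb I) (Leb I) (\<lambda>z. \<lambda>i\<in>I. z i + a i)) (Pi\<^sub>E I A)
        = emeasure (Leb I) (Pi\<^sub>E I (\<lambda>i. (\<lambda>x. x + a i) -` A i))"
      using A I by (subst emeasure_distr) (auto intro!: sets_PiM_I_finite)
    also have "\<dots> = (\<Prod>i\<in>I. emeasure lborel ((\<lambda>x. x + a i) -` A i))"
      using m I by (intro lborel_prod.emeasure_PiM) auto
    also have "\<dots> = (\<Prod>i\<in>I. emeasure lborel (A i))"
    proof (intro prod.cong refl)
      fix i assume "i \<in> I"
      have "emeasure lborel (A i) = emeasure (distr lborel borel (\<lambda>x. a i + x)) (A i)"
        by (simp add: lborel_distr_plus)
      also have "\<dots> = emeasure lborel ((\<lambda>x. x + a i) -` A i)"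
        using A[OF \<open>i \<in> I\<close>] by (subst emeasure_distr) (auto simp: add.commute[of _ "a i"])
      finally show "emeasure lborel ((\<lambda>x. x + a i) -` A i) = emeasure lborel (A i)" ..
    qed
    finally show "emeasure (distr (Leb I) (Leb I) (\<lambda>z. \<lambda>i\<in>I. z i + a i)) (Pi\<^sub>E I A) = (\<Prod>i\<in>I. emeasure lborel (A i))" .
  qed simp
  then have "(\<integral>\<^sup>+z. F z \<partial>Leb I) = (\<integral>\<^sup>+z. F z \<partial>distr (Leb I) (Leb I) (\<lambda>z. \<lambda>i\<in>I. z i + a i))"
    by simp
  also have "\<dots> = (\<integral>\<^sup>+z. F (\<lambda>i\<in>I. z i + a i) \<partial>Leb I)"
    by (rule nn_integral_distr) auto
  finally show ?thesis ..
qed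

text \<open>The chart of the hyperplane that omits the coordinate \<open>k\<close>. Helmert
  coordinates do not respect the facets on which one coordinate is fixed; these charts do.\<close>

definition zero_sum_ext :: "nat set \<Rightarrow> nat \<Rightarrow> (nat \<Rightarrow> real) \<Rightarrow> nat \<Rightarrow> real" where
  "zero_sum_ext I k z = z(k := - sum z (I - {k}))"

lemma measurable_fun_upd_Leb:
  assumes "k \<in> I" "f \<in> borel_measurable N" "z \<in> measurable N (Leb (I - {k}))"
  shows "(\<lambda>x. (z x)(k := f x)) \<in> measurable N (Leb I)"
  using assms by (intro measurable_fun_upd[where J = "I - {k}"]) auto

lemma measurable_zero_sum_ext [measurable (raw)]:
  assumes "finite I" "k \<in> I"
  shows "zero_sum_ext I k \<in> measurable (Leb (I - {k})) (Leb I)"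
  unfolding zero_sum_ext_def[abs_def] using assms
  by (intro measurable_fun_upd_Leb) auto

lemma sum_zero_sum_ext: "finite I \<Longrightarrow> k \<in> I \<Longrightarrow> sum (zero_sum_ext I k z) I = 0"
  by (subst sum.remove[of I k]) (auto simp: zero_sum_ext_def)

text \<open>With all coordinates other than \<open>k\<close> and \<open>l\<close> fixed, passing
  from one chart to the other is the substitution \<open>y \<mapsto> - y - sum z J\<close>, of slope
  -1. Thus every chart carries the same measure.\<close>

lemma nn_integral_zero_sum_ext_swap:
  assumes I: "finite I" "k \<in> I" "l \<in> I" and F[measurable]: "F \<in> borel_measurable (Leb I)"
  shows "(\<integral>\<^sup>+z. F (zero_sum_ext I k z) \<partial>Leb (I - {k})) = (\<integral>\<^sup>+z. F (zero_sum_ext I l z) \<partial>Leb (I - {l}))"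
proof (cases "k = l")
  case False
  define J where "J = I - {k, l}"
  have J: "finite J" "k \<notin> J" "l \<notin> J" "I - {k} = insert l J" "I - {l} = insert k J"
    using I False by (auto simp: J_def)
  \<comment> \<open>Kept general in the two indices, since it is applied once with each of them
    omitted.\<close>
  have *: "(\<integral>\<^sup>+z. F (zero_sum_ext I k z) \<partial>Leb (I - {k}))
       = (\<integral>\<^sup>+z. (\<integral>\<^sup>+y. F (z(l := y, k := - (y + sum z J))) \<partial>lborel) \<partial>Leb J)"
    if "k \<noteq> l" "finite J" "k \<notin> J" "l \<notin> J" "I - {k} = insert l J" "k \<in> I" "l \<in> I" for k l
  proof -
    have upd: "zero_sum_ext I k (z(l := y)) = z(l := y, k := - (y + sum z J))" for z y
    proof -
      have "sum (z(l := y)) J = sum z J" using that by (intro sum.cong) auto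
      then show ?thesis
        using that unfolding zero_sum_ext_def by (subst that(5)) auto
    qed
    have "(\<lambda>z. F (zero_sum_ext I k z)) \<in> borel_measurable (Leb (insert l J))"
      using measurable_zero_sum_ext[of I k] I(1) that by simp measurable
    then have "(\<integral>\<^sup>+z. F (zero_sum_ext I k z) \<partial>Leb (insert l J))
        = (\<integral>\<^sup>+z. (\<integral>\<^sup>+y. F (zero_sum_ext I k (z(l := y))) \<partial>lborel) \<partial>Leb J)"
      using that by (intro lborel_prod.product_nn_integral_insert) auto
    also have "\<dots> = (\<integral>\<^sup>+z. (\<integral>\<^sup>+y. F (z(l := y, k := - (y + sum z J))) \<partial>lborel) \<partial>Leb J)"
      by (simp only: upd)
    finally show ?thesis using that by simp
  qed
  have "(\<integral>\<^sup>+z. F (zero_sum_ext I k z) \<partial>Leb (I - {k}))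
       = (\<integral>\<^sup>+z. (\<integral>\<^sup>+y. F (z(l := y, k := - (y + sum z J))) \<partial>lborel) \<partial>Leb J)"
    using * I J False by auto
  also have "\<dots> = (\<integral>\<^sup>+z. (\<integral>\<^sup>+y. F (z(k := y, l := - (y + sum z J))) \<partial>lborel) \<partial>Leb J)"
  proof (rule nn_integral_cong)
    fix z assume z: "z \<in> space (Leb J)"
    have "(\<lambda>y. (z(l := y, k := - (y + sum z J)))) \<in> measurable borel (Leb I)"
      using I J z by (intro measurable_fun_upd_Leb) (auto simp: J_def[symmetric] insert_Diff_if intro!: measurable_fun_upd_Leb)
    then have m: "(\<lambda>y. F (z(l := y, k := - (y + sum z J)))) \<in> borel_measurable borel" by measurable
    show "(\<integral>\<^sup>+y. F (z(l := y, k := - (y + sum z J))) \<partial>lborel)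
        = (\<integral>\<^sup>+y. F (z(k := y, l := - (y + sum z J))) \<partial>lborel)"
      using False
      by (subst nn_integral_real_affine[OF m, of "-1" "- sum z J"]) (auto simp: fun_upd_twist algebra_simps)
  qed
  also have "\<dots> = (\<integral>\<^sup>+z. F (zero_sum_ext I l z) \<partial>Leb (I - {l}))"
    using *[of l k] I J False by auto
  finally show ?thesis .
qed simp

text \<open>Induction along the triangular Helmert basis: the last vector has equal entries
  \<open>e\<close> except for the final entry \<open>h\<close>. Adding it with weight
  \<open>q\<close> translates the earlier coordinates by \<open>q * e\<close>, which costs nothing,
  and sets the new one to \<open>q * h\<close>, which costs a factor
  \<open>1 / \<bar>h\<bar>\<close>. The factors accumulate to the square root of
  \<open>m + 1\<close>, but only positivity is recorded.\<close>

lemma nn_integral_hyperplane_isometry: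
  "\<exists>c>0. \<forall>F \<in> borel_measurable (Leb {..<Suc m}).
     (\<integral>\<^sup>+y. F (hyperplane_isometry (Suc m) y) \<partial>Leb {..<m})
       = ennreal c * (\<integral>\<^sup>+z. F (zero_sum_ext {..<Suc m} 0 z) \<partial>Leb ({..<Suc m} - {0}))"
proof (induction m)
  case 0
  have "hyperplane_isometry (Suc 0) (\<lambda>_. undefined) = zero_sum_ext {..<Suc 0} 0 (\<lambda>_. undefined)"
    by (auto simp: hyperplane_isometry_def zero_sum_ext_def)
  then show ?case
    by (intro exI[of _ 1]) (simp add: PiM_empty nn_integral_count_space_finite lessThan_Suc)
next
  case (Suc m)
  then obtain c where c: "c > 0" and IH: "\<And>F. F \<in> borel_measurable (Leb {..<Suc m}) \<Longrightarrow>
     (\<integral>\<^sup>+y. F (hyperplane_isometry (Suc m) y) \<partial>Leb {..<m})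
       = ennreal c * (\<integral>\<^sup>+z. F (zero_sum_ext {..<Suc m} 0 z) \<partial>Leb ({..<Suc m} - {0}))"
    by blast
  define e where "e = helmert m 0"
  define h where "h = helmert m (Suc m)"
  have e: "helmert m i = e" if "i \<le> m" for i using that by (simp add: e_def helmert_def)
  have h: "h = - (real m + 1) * e" "h \<noteq> 0" by (auto simp: e_def h_def helmert_def)
  let ?I = "{..<Suc m}" and ?J = "{..<Suc (Suc m)}"
  have IJ: "?J - {Suc m} = ?I" "?J - {0} = insert (Suc m) (?I - {0})" by auto
  show ?case
  proof (intro exI[of _ "c / \<bar>h\<bar>"] conjI ballI)
    show "c / \<bar>h\<bar> > 0" using c h by simp
    fix F :: "(nat \<Rightarrow> real) \<Rightarrow> ennreal"
    assume F[measurable]: "F \<in> borel_measurable (Leb ?J)"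
    define G where "G q z = F (zero_sum_ext ?J 0 (z(Suc m := q)))" for q z
    have iso: "hyperplane_isometry (Suc (Suc m)) (y(m := q))
        = (\<lambda>i\<in>?I. hyperplane_isometry (Suc m) y i + q * e)(Suc m := q * h)" for y q
    proof (rule ext)
      fix i
      have "(\<Sum>j<m. (y(m := q)) j * helmert j i) = (\<Sum>j<m. y j * helmert j i)" for i
        by (intro sum.cong) auto
      moreover have "(\<Sum>j<m. y j * helmert j (Suc m)) = 0"
        by (intro sum.neutral) (auto simp: helmert_def)
      ultimately show "hyperplane_isometry (Suc (Suc m)) (y(m := q)) i
        = ((\<lambda>i\<in>?I. hyperplane_isometry (Suc m) y i + q * e)(Suc m := q * h)) i"
        using e[of i] by (auto simp: hyperplane_isometry_def h_def)
    qed
    have mz: "zero_sum_ext ?J 0 \<in> measurable (Leb (insert (Suc m) (?I - {0}))) (Leb ?J)"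
      using measurable_zero_sum_ext[of ?J 0] by (simp add: IJ)
    have mG: "(\<lambda>z. F (zero_sum_ext ?J 0 z)) \<in> borel_measurable (Leb (insert (Suc m) (?I - {0})))"
      using mz by measurable
    have inner: "(\<integral>\<^sup>+y. F (hyperplane_isometry (Suc (Suc m)) (y(m := q))) \<partial>Leb {..<m})
        = ennreal c * (\<integral>\<^sup>+z. G (q * h) z \<partial>Leb (?I - {0}))" for q
    proof -
      have mF': "(\<lambda>x. F ((\<lambda>i\<in>?I. x i + q * e)(Suc m := q * h))) \<in> borel_measurable (Leb ?I)"
        by (rule measurable_compose[OF _ F], intro measurable_fun_upd_Leb)
           (auto simp: IJ intro!: measurable_restrict)
      have "(\<lambda>i\<in>?I. zero_sum_ext ?I 0 z i + q * e)(Suc m := q * h)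
           = zero_sum_ext ?J 0 ((\<lambda>i\<in>?I - {0}. z i + q * e)(Suc m := q * h))" for z
      proof -
        have "sum ((\<lambda>i\<in>?I - {0}. z i + q * e)(Suc m := q * h)) (?J - {0})
           = q * h + (\<Sum>i\<in>?I - {0}. z i + q * e)"
          by (subst IJ) (auto intro!: sum.cong)
        also have "\<dots> = q * h + sum z (?I - {0}) + real m * q * e"
          by (simp add: sum.distrib card_Diff_subset)
        \<comment> \<open>The entries of a Helmert vector sum to 0, so \<open>q * h\<close> and the
          \<open>m\<close> shifts leave \<open>- q * e\<close>: after negation this is exactly the
          shift of the omitted coordinate 0.\<close>
        also have "\<dots> = sum z (?I - {0}) - q * e"
          by (simp add: h algebra_simps)
        finally show ?thesis
          by (intro ext) (auto simp: zero_sum_ext_def)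
      qed
      then have "(\<integral>\<^sup>+y. F (hyperplane_isometry (Suc (Suc m)) (y(m := q))) \<partial>Leb {..<m})
        = ennreal c * (\<integral>\<^sup>+z. G (q * h) (\<lambda>i\<in>?I - {0}. z i + q * e) \<partial>Leb (?I - {0}))"
        unfolding iso G_def using IH[OF mF'] by simp
      also have "(\<integral>\<^sup>+z. G (q * h) (\<lambda>i\<in>?I - {0}. z i + q * e) \<partial>Leb (?I - {0}))
         = (\<integral>\<^sup>+z. G (q * h) z \<partial>Leb (?I - {0}))"
        unfolding G_def using mG
        by (intro Leb_translate) (auto intro!: measurable_compose[OF _ mG] measurable_fun_upd_Leb simp: IJ)
      finally show ?thesis .
    qed
    have mFi: "(\<lambda>y. F (hyperplane_isometry (Suc (Suc m)) y)) \<in> borel_measurable (Leb (insert m {..<m}))"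
      using measurable_hyperplane_isometry[of "Suc (Suc m)"] F
      by (auto simp: measurable_Leb_eq lessThan_Suc)
    have mGq: "(\<lambda>q. \<integral>\<^sup>+z. G q z \<partial>Leb (?I - {0})) \<in> borel_measurable borel"
    proof -
      have "(\<lambda>x. (snd x)(Suc m := fst x)) \<in> measurable (lborel \<Otimes>\<^sub>M Leb (?I - {0})) (Leb (insert (Suc m) (?I - {0})))"
        by (intro measurable_fun_upd_Leb) (auto simp: insert_Diff_if)
      then have [measurable]: "(\<lambda>(q, z). G q z) \<in> borel_measurable (lborel \<Otimes>\<^sub>M Leb (?I - {0}))"
        unfolding G_def case_prod_beta using mG by (rule measurable_compose)
      interpret sigma_finite_measure "Leb (?I - {0})"
        by (intro lborel_prod.sigma_finite) simp
      show ?thesis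
        using borel_measurable_nn_integral[of G lborel] by simp
    qed
    have "(\<integral>\<^sup>+y. F (hyperplane_isometry (Suc (Suc m)) y) \<partial>Leb {..<Suc m})
        = (\<integral>\<^sup>+q. (\<integral>\<^sup>+y. F (hyperplane_isometry (Suc (Suc m)) (y(m := q))) \<partial>Leb {..<m}) \<partial>lborel)"
      unfolding lessThan_Suc by (intro lborel_prod.product_nn_integral_insert_rev mFi) auto
    also have "\<dots> = (\<integral>\<^sup>+q. ennreal c * (\<integral>\<^sup>+z. G (0 + h * q) z \<partial>Leb (?I - {0})) \<partial>lborel)"
      by (simp add: inner mult.commute)
    also have "\<dots> = ennreal c * (\<integral>\<^sup>+q. (\<integral>\<^sup>+z. G (0 + h * q) z \<partial>Leb (?I - {0})) \<partial>lborel)"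
      using mGq by (intro nn_integral_cmult) (auto intro!: measurable_compose[OF _ mGq])
    also have "(\<integral>\<^sup>+q. (\<integral>\<^sup>+z. G (0 + h * q) z \<partial>Leb (?I - {0})) \<partial>lborel)
       = ennreal (1 / \<bar>h\<bar>) * (ennreal \<bar>h\<bar> * (\<integral>\<^sup>+q. (\<integral>\<^sup>+z. G (0 + h * q) z \<partial>Leb (?I - {0})) \<partial>lborel))"
      using h by (simp flip: mult.assoc ennreal_mult)
    also have "ennreal \<bar>h\<bar> * (\<integral>\<^sup>+q. (\<integral>\<^sup>+z. G (0 + h * q) z \<partial>Leb (?I - {0})) \<partial>lborel)
       = (\<integral>\<^sup>+q. (\<integral>\<^sup>+z. G q z \<partial>Leb (?I - {0})) \<partial>lborel)"
      using h mGq by (intro nn_integral_real_affine[symmetric]) auto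
    also have "\<dots> = (\<integral>\<^sup>+z. F (zero_sum_ext ?J 0 z) \<partial>Leb (?J - {0}))"
      unfolding IJ(2) G_def using mG
      by (intro lborel_prod.product_nn_integral_insert_rev[symmetric]) auto
    finally show "(\<integral>\<^sup>+y. F (hyperplane_isometry (Suc (Suc m)) y) \<partial>Leb {..<Suc m})
       = ennreal (c / \<bar>h\<bar>) * (\<integral>\<^sup>+z. F (zero_sum_ext ?J 0 z) \<partial>Leb (?J - {0}))"
      using c h by (simp add: ennreal_mult[symmetric] mult.assoc[symmetric])
  qed
qed

text \<open>The constant is chosen before \<open>F\<close> and \<open>k\<close>: the facets are
  computed in different charts, and the volume of the cube with another integrand, yet all must
  share it.\<close>

lemma nn_integral_hyperplane_lebesgue:
  assumes "n \<ge> 1"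
  shows "\<exists>c>0. \<forall>F \<in> borel_measurable (Leb {..<n}). \<forall>k<n.
     (\<integral>\<^sup>+x. F x \<partial>hyperplane_lebesgue n) = ennreal c * (\<integral>\<^sup>+z. F (zero_sum_ext {..<n} k z) \<partial>Leb ({..<n} - {k}))"
proof -
  obtain m where n: "n = Suc m" using assms by (cases n) auto
  from nn_integral_hyperplane_isometry[of m] obtain c where c: "c > 0"
    and *: "\<And>F. F \<in> borel_measurable (Leb {..<n}) \<Longrightarrow>
     (\<integral>\<^sup>+y. F (hyperplane_isometry n y) \<partial>Leb {..<n - 1})
       = ennreal c * (\<integral>\<^sup>+z. F (zero_sum_ext {..<n} 0 z) \<partial>Leb ({..<n} - {0}))"
    unfolding n by auto
  show ?thesis
  proof (intro exI[of _ c] conjI ballI allI impI c)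
    fix F :: "(nat \<Rightarrow> real) \<Rightarrow> ennreal" and k assume F: "F \<in> borel_measurable (Leb {..<n})" and k: "k < n"
    have "(\<integral>\<^sup>+x. F x \<partial>hyperplane_lebesgue n) = (\<integral>\<^sup>+y. F (hyperplane_isometry n y) \<partial>Leb {..<n - 1})"
      unfolding hyperplane_lebesgue_def using F measurable_hyperplane_isometry[of n]
      by (intro nn_integral_distr) (auto simp: measurable_Leb_eq)
    also note *[OF F]
    also have "(\<integral>\<^sup>+z. F (zero_sum_ext {..<n} 0 z) \<partial>Leb ({..<n} - {0})) = (\<integral>\<^sup>+z. F (zero_sum_ext {..<n} k z) \<partial>Leb ({..<n} - {k}))"
      using F k by (intro nn_integral_zero_sum_ext_swap) auto
    finally show "(\<integral>\<^sup>+x. F x \<partial>hyperplane_lebesgue n) = ennreal c * (\<integral>\<^sup>+z. F (zero_sum_ext {..<n} k z) \<partial>Leb ({..<n} - {k}))" .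
  qed
qed

subsection \<open>Cardinal B-splines\<close>

text \<open>\<open>slab m a\<close> is the volume of the set of all \<open>y \<in> [-1, 1]\<^sup>m\<close> with \<open>\<bar>a + \<Sum> y\<bar> \<le> 1\<close>, see
  \<open>nn_integral_slab_volume\<close> below: up to the factor \<open>2\<^sup>m\<^sup>+\<^sup>1\<close>, the density of a sum of \<open>m + 1\<close> uniform variables.\<close>

primrec slab :: "nat \<Rightarrow> real \<Rightarrow> real" where
  "slab 0 a = indicator {-1..1} a"
| "slab (Suc m) a = integral {a - 1..a + 1} (slab m)"

lemma slab_nonneg: "0 \<le> slab m a"
proof (induction m arbitrary: a)
  case (Suc m)
  then show ?case
    by (cases "slab m integrable_on {a - 1..a + 1}")
       (auto intro: Henstock_Kurzweil_Integration.integral_nonneg simp: not_integrable_integral)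
qed simp

lemma slab_minus: "slab m (- a) = slab m a"
proof (induction m arbitrary: a)
  case (Suc m)
  have "integral {- a - 1..- a + 1} (slab m) = integral {- (a + 1)..- (a - 1)} (\<lambda>x. slab m (- x))"
    unfolding Suc by (rule arg_cong[where f = "\<lambda>S. integral S (slab m)"]) auto
  then show ?case by (simp only: slab.simps Henstock_Kurzweil_Integration.integral_reflect_real)
qed (auto simp: indicator_def)

text \<open>The two claims support each other: integrability of \<open>slab m\<close> makes its
  window integral \<open>slab (Suc m)\<close> continuous, and continuity gives integrability at the
  next stage. \<open>slab 0\<close> has jumps, hence the shifted index in the first claim.\<close>

lemma slab_continuous_and_integrable:
  "continuous_on UNIV (slab (Suc m)) \<and> slab m integrable_on {a..b}"
proof (induction m arbitrary: a b)
  have cont: "continuous_on UNIV (slab (Suc m))" if int: "\<And>a b. slab m integrable_on {a..b}" for m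
  proof -
    have "isCont (slab (Suc m)) x" for x
    proof -
      \<comment> \<open>A base point to the left of every window \<open>{y - 1..y + 1}\<close> with
        \<open>y\<close> within distance 1 of \<open>x\<close>, so that one primitive serves them
        all.\<close>
      define c where "c = x - 3"
      define G where "G y = integral {c..y} (slab m)" for y
      have G: "continuous_on {c..x + 3} G"
        unfolding G_def by (intro indefinite_integral_continuous_1 int)
      have "continuous_on {x - 1..x + 1} (\<lambda>y. G (y + 1) - G (y - 1))"
        by (intro continuous_on_diff continuous_on_compose2[OF G] continuous_intros) (auto simp: c_def)
      moreover have "slab (Suc m) y = G (y + 1) - G (y - 1)" if "y \<in> {x - 1..x + 1}" for y
        using Henstock_Kurzweil_Integration.integral_combine[of c "y - 1" "y + 1" "slab m"] int that
        by (auto simp: G_def c_def)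
      ultimately have "continuous_on {x - 1..x + 1} (slab (Suc m))"
        by (metis (no_types, lifting) continuous_on_cong)
      then have "continuous_on {x - 1<..<x + 1} (slab (Suc m))"
        by (rule continuous_on_subset) auto
      then show ?thesis
        by (subst (asm) continuous_on_eq_continuous_at) auto
    qed
    then show ?thesis by (simp add: continuous_on_eq_continuous_at del: slab.simps)
  qed
  { case 0
    have i: "slab 0 integrable_on {a..b}" for a b
    proof -
      have "indicat_real {-1..1} integrable_on {a..b}"
        by (simp add: integrable_on_indicator)
      then show ?thesis by (simp add: fun_eq_iff cong: integrable_cong)
    qed
    show ?case by (intro conjI cont i)
  next
    case (Suc m)
    then have "slab (Suc m) integrable_on {a..b}" for a b
      by (intro integrable_continuous_interval) (auto intro: continuous_on_subset)
    then show ?case using cont by blast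
  }
qed

lemma slab_integrable: "slab m integrable_on {a..b}"
  and slab_continuous: "continuous_on UNIV (slab (Suc m))"
  using slab_continuous_and_integrable by auto

lemma borel_measurable_slab [measurable]: "slab m \<in> borel_measurable borel"
proof (cases m)
  case 0
  have "slab 0 = indicator {-1..1}" by (auto simp: fun_eq_iff)
  then show ?thesis using 0 by simp
next
  case (Suc k)
  then show ?thesis by (auto intro: borel_measurable_continuous_onI slab_continuous)
qed

lemma nn_integral_slab:
  "(\<integral>\<^sup>+x. ennreal (slab m x) * indicator {a..b} x \<partial>lborel) = ennreal (integral {a..b} (slab m))"
  by (intro nn_integral_has_integral_lebesgue' slab_nonneg integrable_integral slab_integrable)

lemma slab_shift_integrable: "(\<lambda>x. slab m (x + c)) integrable_on {a..b}"
  and integral_slab_shift: "integral {a..b} (\<lambda>x. slab m (x + c)) = integral {a + c..b + c} (slab m)"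
proof -
  have *: "(\<lambda>x. slab m (x + c)) = slab m \<circ> (+) c" by (auto simp: add.commute)
  show "(\<lambda>x. slab m (x + c)) integrable_on {a..b}"
    unfolding * integrable_on_shift_Icc_real by (rule slab_integrable)
  show "integral {a..b} (\<lambda>x. slab m (x + c)) = integral {a + c..b + c} (slab m)"
    unfolding * by (rule integral_shift_Icc_real)
qed

section \<open>Monotonicity of the splines under a shift by 2\<close>

lemma slab_integral_diff:
  "integral {a..b} (slab m) - integral {a + 2..b + 2} (slab m) = integral {a..b} (\<lambda>x. slab m x - slab m (x + 2))"
  by (subst Henstock_Kurzweil_Integration.integral_diff)
     (auto intro: slab_integrable slab_shift_integrable simp: integral_slab_shift)

lemma slab_diff_integrable: "(\<lambda>x. slab m x - slab m (x + 2)) integrable_on {a..b}"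
  by (intro Henstock_Kurzweil_Integration.integrable_diff slab_integrable slab_shift_integrable)

text \<open>For \<open>y \<ge> -1\<close> the point \<open>y + 2\<close> is at least as far from 0
  as \<open>y\<close>, so this is unimodality in the form that survives the recursion: shifting by
  2, the length of a window, reduces a comparison of two windows to the pointwise comparison one
  stage lower.\<close>

lemma slab_diff_nonneg: "-1 \<le> y \<Longrightarrow> slab m (y + 2) \<le> slab m y"
proof (induction m arbitrary: y)
  case 0
  then show ?case by (auto simp: indicator_def)
next
  case (Suc m)
  have nonneg: "0 \<le> integral {a..b} (\<lambda>x. slab m x - slab m (x + 2))" if "-1 \<le> a" for a b
    using Suc.IH that by (intro Henstock_Kurzweil_Integration.integral_nonneg slab_diff_integrable) auto
  show ?case
  proof (cases "0 \<le> y")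
    case True
    then show ?thesis
      using nonneg[of "y - 1" "y + 1"] slab_integral_diff[of "y - 1" "y + 1" m] by (simp add: algebra_simps)
  next
    case False
    \<comment> \<open>For \<open>y < 0\<close> the window itself would leave the range of the
      induction hypothesis. The reflected window overlaps \<open>{y + 1..y + 3}\<close>; the common
      part cancels, and the remaining pieces start at \<open>- y - 1 \<ge> -1\<close> and differ by
      a shift of 2.\<close>
    have "slab (Suc m) y = integral {- y - 1..- y + 1} (slab m)"
      using slab_minus[of "Suc m" y] by simp
    also have "\<dots> = integral {- y - 1..y + 1} (slab m) + integral {y + 1..- y + 1} (slab m)"
      using False Suc.prems
      by (intro Henstock_Kurzweil_Integration.integral_combine[symmetric] slab_integrable) auto
    also have "\<dots> \<ge> integral {1 - y..y + 3} (slab m) + integral {y + 1..- y + 1} (slab m)"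
      using nonneg[of "- y - 1" "y + 1"] slab_integral_diff[of "- y - 1" "y + 1" m] False Suc.prems
      by (simp add: algebra_simps)
    also have "integral {1 - y..y + 3} (slab m) + integral {y + 1..- y + 1} (slab m) = slab (Suc m) (y + 2)"
      using False Suc.prems
        Henstock_Kurzweil_Integration.integral_combine[of "y + 1" "1 - y" "y + 3" "slab m"] slab_integrable
      by (auto simp: algebra_simps)
    finally show ?thesis .
  qed
qed

text \<open>The value of \<open>\<delta>\<close> passes unchanged through the induction: for
  \<open>y\<close> in \<open>{0..1}\<close> the window contains \<open>{0..1}\<close>, where the
  bound holds, and elsewhere on it the difference is nonnegative.\<close>

lemma slab_diff_ge:
  "\<exists>\<delta>>0. \<forall>y\<in>{0..1}. \<delta> \<le> slab m y - slab m (y + 2)"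
proof (induction m)
  case 0
  show ?case by (intro exI[of _ 1]) (auto simp: indicator_def)
next
  case (Suc m)
  then obtain \<delta> where \<delta>: "\<delta> > 0" "\<And>y. y \<in> {0..1} \<Longrightarrow> \<delta> \<le> slab m y - slab m (y + 2)" by blast
  show ?case
  proof (intro exI[of _ \<delta>] conjI ballI \<delta>)
    fix y :: real assume y: "y \<in> {0..1}"
    have "\<delta> = integral {0..1} (\<lambda>_::real. \<delta>)" by simp
    also have "\<dots> \<le> integral {0..1} (\<lambda>x. slab m x - slab m (x + 2))"
      using \<delta> by (intro integral_le slab_diff_integrable) auto
    also have "\<dots> \<le> integral {y - 1..y + 1} (\<lambda>x. slab m x - slab m (x + 2))"
      using y by (intro integral_subset_le slab_diff_integrable) (auto simp: slab_diff_nonneg)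
    also have "\<dots> = slab (Suc m) y - slab (Suc m) (y + 2)"
      using slab_integral_diff[of "y - 1" "y + 1" m] by (simp add: algebra_simps)
    finally show "\<delta> \<le> slab (Suc m) y - slab (Suc m) (y + 2)" .
  qed
qed

text \<open>The right-hand side is minus the derivative of \<open>slab_sum (Suc (Suc m))\<close> at
  \<open>q\<close>, the other two terms cancelling by symmetry. The two windows overlap in
  \<open>{1 + q..3 - q}\<close>; what remains are two intervals that differ by a shift of 2, and on
  the part \<open>{1 - q..1}\<close> of length \<open>q\<close> the uniform gap applies.\<close>

lemma slab_reflect_diff_ge:
  "\<exists>\<delta>>0. \<forall>q\<in>{0..1}. \<delta> * q \<le> slab (Suc m) (2 - q) - slab (Suc m) (2 + q)"
proof -
  obtain \<delta> where \<delta>: "\<delta> > 0" "\<And>y. y \<in> {0..1} \<Longrightarrow> \<delta> \<le> slab m y - slab m (y + 2)"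
    using slab_diff_ge by blast
  show ?thesis
  proof (intro exI[of _ \<delta>] conjI ballI \<delta>)
    fix q :: real assume q: "q \<in> {0..1}"
    have "\<delta> * q = integral {1 - q..1} (\<lambda>_. \<delta>)" using q by simp
    also have "\<dots> \<le> integral {1 - q..1} (\<lambda>x. slab m x - slab m (x + 2))"
      using \<delta> q by (intro integral_le slab_diff_integrable) auto
    also have "\<dots> \<le> integral {1 - q..1 + q} (\<lambda>x. slab m x - slab m (x + 2))"
      using q by (intro integral_subset_le slab_diff_integrable) (auto simp: slab_diff_nonneg)
    also have "\<dots> = integral {1 - q..1 + q} (slab m) - integral {3 - q..3 + q} (slab m)"
      by (subst slab_integral_diff[symmetric]) (simp add: algebra_simps)
    also have "\<dots> = slab (Suc m) (2 - q) - slab (Suc m) (2 + q)"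
      using q Henstock_Kurzweil_Integration.integral_combine[of "1 - q" "1 + q" "3 - q" "slab m"]
        Henstock_Kurzweil_Integration.integral_combine[of "1 + q" "3 - q" "3 + q" "slab m"] slab_integrable
      by (auto simp: algebra_simps)
    finally show "\<delta> * q \<le> slab (Suc m) (2 - q) - slab (Suc m) (2 + q)" .
  qed
qed

text \<open>The two terms belong to the opposite facets on which the coordinate of largest modulus
  is 1 and -1.\<close>

definition slab_sum :: "nat \<Rightarrow> real \<Rightarrow> real" where
  "slab_sum m r = slab m (1 + r) + slab m (1 - r)"

lemma slab_sum_nonneg: "0 \<le> slab_sum m r"
  by (simp add: slab_sum_def slab_nonneg)

lemma slab_sum_minus: "slab_sum m (- r) = slab_sum m r"
  by (simp add: slab_sum_def)

lemma borel_measurable_slab_sum [measurable]: "slab_sum m \<in> borel_measurable borel"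
  unfolding slab_sum_def[abs_def] by measurable

lemma slab_Suc_1_pos: "0 < slab (Suc m) 1"
proof -
  obtain \<delta> where \<delta>: "\<delta> > 0" "\<And>y. y \<in> {0..1} \<Longrightarrow> \<delta> \<le> slab m y - slab m (y + 2)"
    using slab_diff_ge by blast
  have "\<delta> = integral {0..1} (\<lambda>_::real. \<delta>)" by simp
  also have "\<dots> \<le> integral {0..1} (slab m)"
    using \<delta> slab_nonneg by (intro integral_le slab_integrable) (auto, smt (verit) atLeastAtMost_iff)
  also have "\<dots> \<le> integral {0..2} (slab m)"
    by (intro integral_subset_le slab_integrable) (auto simp: slab_nonneg)
  finally show ?thesis using \<delta> by simp
qed

lemma slab_reflect_integrable: "(\<lambda>x. slab m (c - x)) integrable_on {a..b}"
  and integral_slab_reflect: "integral {a..b} (\<lambda>x. slab m (c - x)) = integral {c - b..c - a} (slab m)"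
proof -
  have *: "(\<lambda>x. slab m (c - x)) = (\<lambda>x. slab m (x + (- c)))"
    using slab_minus by (metis add.commute minus_diff_eq uminus_add_conv_diff diff_conv_add_uminus)
  show "(\<lambda>x. slab m (c - x)) integrable_on {a..b}"
    unfolding * by (rule slab_shift_integrable)
  have "integral {a - c..b - c} (slab m) = integral {- (c - a)..- (c - b)} (\<lambda>x. slab m (- x))"
    by (simp add: slab_minus)
  also have "\<dots> = integral {c - b..c - a} (slab m)"
    by (rule Henstock_Kurzweil_Integration.integral_reflect_real)
  finally show "integral {a..b} (\<lambda>x. slab m (c - x)) = integral {c - b..c - a} (slab m)"
    unfolding * by (subst integral_slab_shift) simp
qed

lemma integrable_slab_sum: "slab_sum m integrable_on {a..b}"
  using Henstock_Kurzweil_Integration.integrable_add[OF slab_shift_integrable[of m 1] slab_reflect_integrable[of m 1]]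
  by (simp add: slab_sum_def[abs_def] add.commute)

text \<open>As \<open>r\<close> runs through \<open>{0..1}\<close>, the arguments
  \<open>1 - r\<close> and \<open>1 + r\<close> together sweep the window \<open>{0..2}\<close> of
  \<open>slab (Suc m) 1\<close>, which therefore is the normalising constant.\<close>

lemma integral_slab_sum: "integral {0..1} (slab_sum m) = slab (Suc m) 1"
proof -
  have "integral {0..1} (slab_sum m) = integral {0..1} (\<lambda>x. slab m (x + 1)) + integral {0..1} (\<lambda>x. slab m (1 - x))"
    unfolding slab_sum_def[abs_def]
    by (subst Henstock_Kurzweil_Integration.integral_add[symmetric])
       (auto intro: slab_shift_integrable slab_reflect_integrable simp: add.commute)
  also have "\<dots> = integral {1..2} (slab m) + integral {0..1} (slab m)"
    by (simp add: integral_slab_shift integral_slab_reflect)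
  also have "\<dots> = slab (Suc m) 1"
    using Henstock_Kurzweil_Integration.integral_combine[of 0 1 2 "slab m"] slab_integrable by auto
  finally show ?thesis .
qed

text \<open>Integrates the linear lower bound on the slope from 0 to \<open>r\<close>. Two smoothing
  steps are essential: \<open>slab_sum 0\<close> and \<open>slab_sum (Suc 0)\<close> are constant on
  \<open>{0<..1}\<close>.\<close>

lemma slab_sum_quadratic_bound:
  "\<exists>\<epsilon>>0. \<forall>r\<in>{0..1}. slab_sum (Suc (Suc m)) r \<le> slab_sum (Suc (Suc m)) 0 - \<epsilon> * r\<^sup>2"
proof -
  obtain \<delta> where \<delta>: "\<delta> > 0" "\<And>q. q \<in> {0..1} \<Longrightarrow> \<delta> * q \<le> slab (Suc m) (2 - q) - slab (Suc m) (2 + q)"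
    using slab_reflect_diff_ge by blast
  let ?f = "slab (Suc m)"
  note [simp del] = slab.simps(2)
  note combine = Henstock_Kurzweil_Integration.integral_combine[OF _ _ slab_integrable, of _ _ _ "Suc m"]
  show ?thesis
  proof (intro exI[of _ "\<delta> / 2"] conjI ballI)
    fix r :: real assume r: "r \<in> {0..1}"
    have int: "((\<lambda>q. \<delta> * q) has_integral \<delta> * r\<^sup>2 / 2) {0..r}"
      using r by (intro has_integral_eq_rhs[OF has_integral_mult_right[OF ident_has_integral]]) auto
    have "\<delta> * r\<^sup>2 / 2 = integral {0..r} (\<lambda>q. \<delta> * q)"
      by (rule integral_unique[OF int, symmetric])
    also have "\<dots> \<le> integral {0..r} (\<lambda>q. ?f (2 - q) - ?f (q + 2))"
      using r \<delta> int by (intro integral_le Henstock_Kurzweil_Integration.integrable_diff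
        slab_shift_integrable slab_reflect_integrable has_integral_integrable[OF int]) (auto simp: add.commute)
    also have "\<dots> = integral {2 - r..2} ?f - integral {2..2 + r} ?f"
      by (subst Henstock_Kurzweil_Integration.integral_diff)
         (auto intro: slab_shift_integrable slab_reflect_integrable
           simp: integral_slab_shift integral_slab_reflect add.commute)
    also have "\<dots> = slab_sum (Suc (Suc m)) 0 - slab_sum (Suc (Suc m)) r"
    proof -
      \<comment> \<open>The window \<open>{- r..2 - r}\<close> that defines
        \<open>slab (Suc (Suc m)) (1 - r)\<close> reaches below 0; once that piece is reflected, all
        windows are unions of pieces of \<open>{0..2 + r}\<close> and the difference is
        bookkeeping.\<close>
      have "integral {- r..0} ?f = integral {- r..- 0} (\<lambda>x. ?f (- x))" by (simp add: slab_minus)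
      also have "\<dots> = integral {0..r} ?f"
        by (rule Henstock_Kurzweil_Integration.integral_reflect_real)
      finally have "integral {- r..0} ?f = integral {0..r} ?f" .
      moreover have "integral {0..r} ?f + integral {r..2} ?f = integral {0..2} ?f"
        "integral {- r..0} ?f + integral {0..2 - r} ?f = integral {- r..2 - r} ?f"
        "integral {r..2} ?f + integral {2..2 + r} ?f = integral {r..2 + r} ?f"
        "integral {0..2 - r} ?f + integral {2 - r..2} ?f = integral {0..2} ?f"
        using r by (auto intro!: combine)
      ultimately show ?thesis
        by (simp add: slab_sum_def slab.simps(2)[of "Suc m"] add.commute)
    qed
    finally show "slab_sum (Suc (Suc m)) r \<le> slab_sum (Suc (Suc m)) 0 - \<delta> / 2 * r\<^sup>2" by simp
  qed (use \<delta> in auto)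
qed

subsection \<open>Decomposition by the coordinate of largest modulus\<close>

lemma borel_measurable_indicator_symmetric_interval [measurable (raw)]:
  fixes f g :: "'a \<Rightarrow> real"
  assumes [measurable]: "f \<in> borel_measurable M" "g \<in> borel_measurable M"
  shows "(\<lambda>x. indicator {- f x..f x} (g x) :: ennreal) \<in> borel_measurable M"
  unfolding indicator_def atLeastAtMost_iff by measurable

text \<open>Integrating out one coordinate \<open>y\<close> and substituting
  \<open>- a + s * y\<close> for it turns the constraint \<open>{-s..s}\<close> into the unit window
  around \<open>a / s\<close>, which is the recursion of \<open>slab\<close>; each substitution
  contributes a factor \<open>s\<close>.\<close>

lemma nn_integral_slab_volume:
  assumes "finite J" "0 < s"
  shows "(\<integral>\<^sup>+z. (\<Prod>j\<in>J. indicator {-s..s} (z j)) * indicator {-s..s} (a + sum z J) \<partial>Leb J)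
       = ennreal (s ^ card J * slab (card J) (a / s))"
  using assms(1)
proof (induction J arbitrary: a rule: finite_induct)
  case empty
  show ?case
    using assms(2) by (auto simp: PiM_empty nn_integral_count_space_finite indicator_def field_simps)
next
  case (insert k J)
  let ?P = "\<lambda>J z. \<Prod>j\<in>J. indicator {-s..s} (z j) :: ennreal"
  have upd: "?P (insert k J) (z(k := y)) * indicator {-s..s} (a + sum (z(k := y)) (insert k J))
      = indicator {-s..s} y * (?P J z * indicator {-s..s} (a + y + sum z J))" for z y
  proof -
    have "?P J (z(k := y)) = ?P J z" "sum (z(k := y)) J = sum z J"
      using insert by (auto intro!: prod.cong sum.cong)
    then show ?thesis using insert by (simp add: mult.assoc add.assoc)
  qed
  have [measurable]: "(\<lambda>z. ?P J z * indicator {-s..s} (b + sum z J)) \<in> borel_measurable (Leb J)" for b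
    by measurable
  have "(\<integral>\<^sup>+z. ?P (insert k J) z * indicator {-s..s} (a + sum z (insert k J)) \<partial>Leb (insert k J))
      = (\<integral>\<^sup>+y. (\<integral>\<^sup>+z. indicator {-s..s} y * (?P J z * indicator {-s..s} (a + y + sum z J)) \<partial>Leb J) \<partial>lborel)"
    unfolding upd[symmetric] using insert
    by (intro lborel_prod.product_nn_integral_insert_rev) (auto, measurable)
  also have "\<dots> = (\<integral>\<^sup>+y. indicator {-s..s} y * ennreal (s ^ card J * slab (card J) ((a + y) / s)) \<partial>lborel)"
    by (simp add: nn_integral_cmult insert.IH)
  also have "\<dots> = ennreal \<bar>s\<bar> * (\<integral>\<^sup>+y. indicator {-s..s} (-a + s * y) * ennreal (s ^ card J * slab (card J) ((a + (-a + s * y)) / s)) \<partial>lborel)"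
    using assms(2) by (intro nn_integral_real_affine) measurable
  also have "\<dots> = ennreal s * (\<integral>\<^sup>+y. ennreal (s ^ card J) * (ennreal (slab (card J) y) * indicator {a / s - 1..a / s + 1} y) \<partial>lborel)"
  proof -
    have "indicator {-s..s} (-a + s * y) = (indicator {a / s - 1..a / s + 1} y :: ennreal)"
      and "(a + (-a + s * y)) / s = y" for y
      using assms(2) by (auto simp: indicator_def field_simps)
    then show ?thesis
      using assms(2) slab_nonneg by (simp add: ennreal_mult mult_ac)
  qed
  also have "\<dots> = ennreal (s ^ card (insert k J) * slab (card (insert k J)) (a / s))"
    using assms(2) insert slab_nonneg[of "Suc (card J)" "a / s"]
    by (subst nn_integral_cmult) (auto simp: nn_integral_slab ennreal_mult' simp flip: mult.assoc)
  finally show ?case .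
qed

lemma nn_integral_lborel_fold:
  fixes f :: "real \<Rightarrow> ennreal"
  assumes [measurable]: "f \<in> borel_measurable borel"
  shows "(\<integral>\<^sup>+s. f s \<partial>lborel) = (\<integral>\<^sup>+s. (f s + f (- s)) * indicator {0<..} s \<partial>lborel)"
proof -
  have "(\<integral>\<^sup>+s. f s \<partial>lborel) = (\<integral>\<^sup>+s. f s * indicator {0<..} s + f s * indicator {..<0} s \<partial>lborel)"
    using AE_lborel_singleton[of "0::real"]
    by (intro nn_integral_cong_AE) (auto simp: indicator_def)
  also have "\<dots> = (\<integral>\<^sup>+s. f s * indicator {0<..} s \<partial>lborel) + (\<integral>\<^sup>+s. f s * indicator {..<0} s \<partial>lborel)"
    by (intro nn_integral_add) measurable
  also have "(\<integral>\<^sup>+s. f s * indicator {..<0} s \<partial>lborel) = (\<integral>\<^sup>+s. f (- s) * indicator {0<..} s \<partial>lborel)"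
    by (subst nn_integral_real_affine[of _ "-1" 0]) (auto simp: indicator_def intro!: nn_integral_cong)
  also have "(\<integral>\<^sup>+s. f s * indicator {0<..} s \<partial>lborel) + \<dots> = (\<integral>\<^sup>+s. (f s + f (- s)) * indicator {0<..} s \<partial>lborel)"
    by (subst nn_integral_add[symmetric]) (auto simp: distrib_right)
  finally show ?thesis .
qed

lemma space_hyperplane_lebesgue: "space (hyperplane_lebesgue n) = space (Leb {..<n})"
  by (simp add: hyperplane_lebesgue_def space_PiM)

lemma measurable_hyperplane_lebesgue: "measurable (hyperplane_lebesgue n) N = measurable (Leb {..<n}) N"
  by (simp add: measurable_Leb_eq hyperplane_lebesgue_def)

text \<open>Omit a third coordinate \<open>l\<close>. Then \<open>x j\<close> and \<open>x k\<close>
  are independent variables of the chart, and for fixed \<open>x k\<close> a tie leaves at most two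
  values of \<open>x j\<close>. With only two coordinates every point of the hyperplane would be a
  tie.\<close>

lemma AE_hyperplane_lebesgue_no_ties:
  assumes n: "3 \<le> n"
  shows "AE x in hyperplane_lebesgue n. \<forall>j<n. \<forall>k<n. j \<noteq> k \<longrightarrow> \<bar>x j\<bar> \<noteq> \<bar>x k\<bar>"
proof -
  let ?I = "{..<n}"
  have n1: "1 \<le> n" using n by simp
  have "AE x in hyperplane_lebesgue n. \<bar>x j\<bar> \<noteq> \<bar>x k\<bar>" if jk: "j < n" "k < n" "j \<noteq> k" for j k
  proof -
    let ?F = "\<lambda>x. indicator {0} (\<bar>x j\<bar> - \<bar>x k\<bar>) :: ennreal"
    have F: "?F \<in> borel_measurable (Leb S)" if "j \<in> S" "k \<in> S" for S
      using that by measurable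
    obtain l where l: "l < n" "l \<noteq> j" "l \<noteq> k"
    proof -
      have "\<not> {..<n} \<subseteq> {j, k}"
        using card_mono[of "{j, k}" "{..<n}"] n card_insert_le_m1[of 2 "{k}" j] by auto
      then show ?thesis using that by auto
    qed
    obtain c where c: "(\<integral>\<^sup>+x. ?F x \<partial>hyperplane_lebesgue n) = ennreal c * (\<integral>\<^sup>+z. ?F (zero_sum_ext ?I l z) \<partial>Leb (?I - {l}))"
      using nn_integral_hyperplane_lebesgue[OF n1] F[of ?I] jk l by blast
    define J where "J = ?I - {l, j}"
    have J: "?I - {l} = insert j J" "finite J" "j \<notin> J" "k \<in> J" using jk l by (auto simp: J_def)
    have "(\<integral>\<^sup>+z. ?F (zero_sum_ext ?I l z) \<partial>Leb (?I - {l})) = (\<integral>\<^sup>+z. ?F z \<partial>Leb (insert j J))"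
      unfolding J(1) using l by (intro nn_integral_cong) (auto simp: zero_sum_ext_def)
    also have "\<dots> = (\<integral>\<^sup>+z. (\<integral>\<^sup>+y. ?F (z(j := y)) \<partial>lborel) \<partial>Leb J)"
      using J by (intro lborel_prod.product_nn_integral_insert F) auto
    also have "\<dots> = 0"
    proof -
      have "(\<integral>\<^sup>+y. ?F (z(j := y)) \<partial>lborel) = (\<integral>\<^sup>+(y :: real). 0 \<partial>lborel)" for z :: "nat \<Rightarrow> real"
      proof (rule nn_integral_cong_AE)
        show "AE y in lborel. ?F (z(j := y)) = 0"
          using AE_lborel_singleton[of "\<bar>z k\<bar>"] AE_lborel_singleton[of "- \<bar>z k\<bar>"]
          by eventually_elim (use jk in \<open>auto simp: indicator_def\<close>)
      qed
      then show ?thesis by simp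
    qed
    finally have "(\<integral>\<^sup>+x. ?F x \<partial>hyperplane_lebesgue n) = 0" using c by simp
    then have "AE x in hyperplane_lebesgue n. ?F x = 0"
      using F[of ?I] jk by (subst (asm) nn_integral_0_iff_AE) (auto simp: measurable_hyperplane_lebesgue)
    then show ?thesis by eventually_elim (auto simp: indicator_def)
  qed
  then have "AE x in hyperplane_lebesgue n. \<forall>j\<in>?I. \<forall>k\<in>?I. j \<noteq> k \<longrightarrow> \<bar>x j\<bar> \<noteq> \<bar>x k\<bar>"
    by (intro AE_finite_allI) auto
  then show ?thesis by eventually_elim auto
qed

lemma sup_norm_attained:
  assumes "0 < n" obtains k where "k < n" "sup_norm n x = \<bar>x k\<bar>"
proof -
  have "sup_norm n x \<in> (\<lambda>k. \<bar>x k\<bar>) ` {..<n}"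
    unfolding sup_norm_def using assms by (intro Max_in) (auto simp: lessThan_empty_iff)
  then show ?thesis using that by auto
qed

lemma sup_norm_ge: "k < n \<Longrightarrow> \<bar>x k\<bar> \<le> sup_norm n x"
  unfolding sup_norm_def by (intro Max_ge) auto

text \<open>Without ties exactly one coordinate dominates all others in modulus, so exactly one of
  the products is 1. This cuts the hyperplane into the cones over the facets.\<close>

lemma sup_norm_decomposition:
  assumes n: "0 < n" and x: "\<forall>j<n. \<forall>k<n. j \<noteq> k \<longrightarrow> \<bar>x j\<bar> \<noteq> \<bar>x k\<bar>"
  shows "(\<Phi> (sup_norm n x) :: ennreal)
    = (\<Sum>k<n. \<Phi> \<bar>x k\<bar> * (\<Prod>j\<in>{..<n} - {k}. indicator {-\<bar>x k\<bar>..\<bar>x k\<bar>} (x j)))"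
proof -
  obtain m where m: "m < n" "sup_norm n x = \<bar>x m\<bar>" using sup_norm_attained[OF n] .
  have le: "\<bar>x j\<bar> \<le> \<bar>x m\<bar>" if "j < n" for j using sup_norm_ge[OF that, of x] m by simp
  have "(\<Prod>j\<in>{..<n} - {k}. indicator {-\<bar>x k\<bar>..\<bar>x k\<bar>} (x j)) = (if k = m then 1 else 0 :: ennreal)" if k: "k < n" for k
  proof (cases "k = m")
    case True
    have "x j \<in> {-\<bar>x m\<bar>..\<bar>x m\<bar>}" if "j < n" for j
      using le[OF that] abs_ge_self[of "x j"] abs_ge_minus_self[of "x j"] by simp
    then show ?thesis using True by (auto intro!: prod.neutral)
  next
    case False
    then have "\<bar>x k\<bar> < \<bar>x m\<bar>" using x le[OF k] k m by (metis order_le_less)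
    then have "indicator {-\<bar>x k\<bar>..\<bar>x k\<bar>} (x m) = (0::ennreal)" by (auto simp: indicator_def)
    then show ?thesis using False m by (auto intro!: prod_zero bexI[of _ m])
  qed
  then have "(\<Sum>k<n. \<Phi> \<bar>x k\<bar> * (\<Prod>j\<in>{..<n} - {k}. indicator {-\<bar>x k\<bar>..\<bar>x k\<bar>} (x j))) = (\<Sum>k<n. if k = m then \<Phi> \<bar>x k\<bar> else 0)"
    by (intro sum.cong) auto
  also have "\<dots> = \<Phi> (sup_norm n x)" using m by simp
  finally show ?thesis ..
qed

lemma indicator_symmetric_interval_minus:
  "indicator {- s..s :: real} (- t) = (indicator {- s..s} t :: ennreal)"
  by (auto simp: indicator_def)

text \<open>The observed coordinate is itself the largest. The \<open>m\<close> coordinates other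
  than \<open>i\<close> and \<open>l\<close> contribute the cross-section
  \<open>s ^ m * slab m 1\<close>, in which the constraint on the omitted coordinate
  \<open>l\<close> becomes the slab condition.\<close>

lemma nn_integral_diagonal_facet:
  assumes I: "finite I" "i \<in> I" "l \<in> I" "i \<noteq> l" and m: "card I = Suc (Suc m)"
    and [measurable]: "\<Phi> \<in> borel_measurable borel"
  shows "(\<integral>\<^sup>+z. (\<lambda>x. \<Phi> (x i) * (\<Prod>j\<in>I - {i}. indicator {-\<bar>x i\<bar>..\<bar>x i\<bar>} (x j))) (zero_sum_ext I l z) \<partial>Leb (I - {l}))
     = (\<integral>\<^sup>+s. (\<Phi> s + \<Phi> (- s)) * ennreal (s ^ m * slab m 1) * indicator {0<..} s \<partial>lborel)" (is "?lhs = _")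
proof -
  define J where "J = I - {i, l}"
  have J: "I - {l} = insert i J" "I - {i} = insert l J" "finite J" "i \<notin> J" "l \<notin> J" "card J = m"
    using I m by (auto simp: J_def card_Diff_subset)
  let ?P = "\<lambda>s z. \<Prod>j\<in>J. indicator {-\<bar>s\<bar>..\<bar>s\<bar>} (z j) :: ennreal"
  let ?G = "\<lambda>x. \<Phi> (x i) * (\<Prod>j\<in>I - {i}. indicator {-\<bar>x i\<bar>..\<bar>x i\<bar>} (x j))"
  have ext: "?G (zero_sum_ext I l (z(i := s)))
    = \<Phi> s * (?P s z * indicator {-\<bar>s\<bar>..\<bar>s\<bar>} (s + sum z J))" for z s
  proof -
    have "sum (z(i := s)) J = sum z J" using J by (intro sum.cong) auto
    then have x: "zero_sum_ext I l (z(i := s)) = z(i := s, l := - (s + sum z J))"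
      unfolding zero_sum_ext_def J using J by simp
    have P: "(\<Prod>j\<in>J. indicator {-\<bar>s\<bar>..\<bar>s\<bar>} ((z(i := s, l := t)) j)) = ?P s z" for t
      using J by (intro prod.cong) auto
    show ?thesis
      unfolding x J(2) using J I not_sym[OF I(4)]
      by (simp add: P indicator_symmetric_interval_minus mult_ac fun_upd_same fun_upd_other
            del: minus_add_distrib fun_upd_apply)
  qed
  have "(\<lambda>z. ?G (zero_sum_ext I l z)) \<in> borel_measurable (Leb (insert i J))"
    unfolding J(1)[symmetric] using I
    by (intro measurable_compose[OF measurable_zero_sum_ext]) (auto, measurable)
  then have "?lhs = (\<integral>\<^sup>+s. (\<integral>\<^sup>+z. \<Phi> s * (?P s z * indicator {-\<bar>s\<bar>..\<bar>s\<bar>} (s + sum z J)) \<partial>Leb J) \<partial>lborel)"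
    unfolding J(1) ext[symmetric] using J by (intro lborel_prod.product_nn_integral_insert_rev) auto
  also have "\<dots> = (\<integral>\<^sup>+s. \<Phi> s * (\<integral>\<^sup>+z. ?P s z * indicator {-\<bar>s\<bar>..\<bar>s\<bar>} (s + sum z J) \<partial>Leb J) \<partial>lborel)"
    by (intro nn_integral_cong nn_integral_cmult) measurable
  also have "\<dots> = (\<integral>\<^sup>+s. \<Phi> s * ennreal (\<bar>s\<bar> ^ m * slab m 1) \<partial>lborel)"
  proof (intro nn_integral_cong_AE)
    show "AE s in lborel. \<Phi> s * (\<integral>\<^sup>+z. ?P s z * indicator {-\<bar>s\<bar>..\<bar>s\<bar>} (s + sum z J) \<partial>Leb J)
        = \<Phi> s * ennreal (\<bar>s\<bar> ^ m * slab m 1)"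
      using AE_lborel_singleton[of "0::real"]
    proof eventually_elim
      case (elim s)
      \<comment> \<open>The quotient is 1 or -1; evenness makes the two signs of \<open>s\<close>
        alike.\<close>
      have "slab m (s / \<bar>s\<bar>) = slab m 1"
        using elim slab_minus[of m 1] by (cases "s > 0") auto
      then show ?case
        using nn_integral_slab_volume[of J "\<bar>s\<bar>" s] elim J by simp
    qed
  qed
  also have "\<dots> = (\<integral>\<^sup>+s. (\<Phi> s + \<Phi> (- s)) * ennreal (s ^ m * slab m 1) * indicator {0<..} s \<partial>lborel)"
    by (subst nn_integral_lborel_fold, measurable)
       (auto intro!: nn_integral_cong split: split_indicator simp: distrib_right)
  finally show ?thesis .
qed

text \<open>Here \<open>k\<close> is the largest coordinate, \<open>i\<close> the observed and
  \<open>l\<close> the omitted one. Compared with the previous case one coordinate fewer is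
  integrated out, but measuring the observed one in units of \<open>s\<close> restores the lost
  factor \<open>s\<close>.\<close>

lemma nn_integral_other_facet:
  assumes I: "finite I" "i \<in> I" "k \<in> I" "l \<in> I" "i \<noteq> l" "k \<noteq> l" "i \<noteq> k" and m: "card I = m + 3"
    and [measurable]: "case_prod \<Phi> \<in> borel_measurable (borel \<Otimes>\<^sub>M borel)"
  shows "(\<integral>\<^sup>+z. (\<lambda>x. \<Phi> \<bar>x k\<bar> (x i) * (\<Prod>j\<in>I - {k}. indicator {-\<bar>x k\<bar>..\<bar>x k\<bar>} (x j))) (zero_sum_ext I l z) \<partial>Leb (I - {l}))
     = (\<integral>\<^sup>+s. ennreal (s ^ Suc m) * (\<integral>\<^sup>+r. \<Phi> s (s * r) * ennreal (slab_sum m r) * indicator {-1..1} r \<partial>lborel) * indicator {0<..} s \<partial>lborel)" (is "?lhs = _")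
proof -
  define J where "J = I - {i, k, l}"
  have J: "I - {l} = insert k (insert i J)" "I - {k} = insert l (insert i J)" "finite J" "i \<notin> J" "k \<notin> J" "l \<notin> J" "card J = m"
    using I m by (auto simp: J_def card_Diff_subset)
  let ?P = "\<lambda>s z. \<Prod>j\<in>J. indicator {-\<bar>s\<bar>..\<bar>s\<bar>} (z j) :: ennreal"
  let ?G = "\<lambda>x. \<Phi> \<bar>x k\<bar> (x i) * (\<Prod>j\<in>I - {k}. indicator {-\<bar>x k\<bar>..\<bar>x k\<bar>} (x j))"
  let ?R = "\<lambda>s y. \<Phi> \<bar>s\<bar> y * indicator {-\<bar>s\<bar>..\<bar>s\<bar>} y"
  have ext: "?G (zero_sum_ext I l (z(i := y, k := s)))
    = ?R s y * (?P s z * indicator {-\<bar>s\<bar>..\<bar>s\<bar>} (s + y + sum z J))" for z s y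
  proof -
    have "sum (z(i := y, k := s)) J = sum z J" using J by (intro sum.cong) auto
    then have x: "zero_sum_ext I l (z(i := y, k := s)) = z(i := y, k := s, l := - (s + y + sum z J))"
      unfolding zero_sum_ext_def J using J I by (simp add: algebra_simps)
    have P: "(\<Prod>j\<in>J. indicator {-\<bar>s\<bar>..\<bar>s\<bar>} ((z(i := y, k := s, l := t)) j)) = ?P s z" for t
      using J by (intro prod.cong) auto
    show ?thesis
      unfolding x J(2) using J I not_sym[OF I(5)] not_sym[OF I(6)] not_sym[OF I(7)]
      by (simp add: P indicator_symmetric_interval_minus mult_ac fun_upd_same fun_upd_other
            del: minus_add_distrib fun_upd_apply)
  qed
  have mG: "(\<lambda>z. ?G (zero_sum_ext I l z)) \<in> borel_measurable (Leb (insert k (insert i J)))"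
    unfolding J(1)[symmetric] using I
    by (intro measurable_compose[OF measurable_zero_sum_ext]) (auto, measurable)
  have "?lhs = (\<integral>\<^sup>+s. (\<integral>\<^sup>+z. ?G (zero_sum_ext I l (z(k := s))) \<partial>Leb (insert i J)) \<partial>lborel)"
    unfolding J(1) using J I by (intro lborel_prod.product_nn_integral_insert_rev[OF _ _ mG]) simp_all
  also have "\<dots> = (\<integral>\<^sup>+s. (\<integral>\<^sup>+y. (\<integral>\<^sup>+z. ?G (zero_sum_ext I l (z(i := y, k := s))) \<partial>Leb J) \<partial>lborel) \<partial>lborel)"
  proof (rule nn_integral_cong)
    fix s :: real
    have "(\<lambda>z. z(k := s)) \<in> measurable (Leb (insert i J)) (Leb (insert k (insert i J)))"
      using J I by (intro measurable_fun_upd_Leb) (simp_all add: insert_Diff_if)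
    from measurable_compose[OF this mG] show "(\<integral>\<^sup>+z. ?G (zero_sum_ext I l (z(k := s))) \<partial>Leb (insert i J))
      = (\<integral>\<^sup>+y. (\<integral>\<^sup>+z. ?G (zero_sum_ext I l (z(i := y, k := s))) \<partial>Leb J) \<partial>lborel)"
      using J by (intro lborel_prod.product_nn_integral_insert_rev) simp_all
  qed
  also have "\<dots> = (\<integral>\<^sup>+s. (\<integral>\<^sup>+y. ?R s y * (\<integral>\<^sup>+z. ?P s z * indicator {-\<bar>s\<bar>..\<bar>s\<bar>} (s + y + sum z J) \<partial>Leb J) \<partial>lborel) \<partial>lborel)"
    unfolding ext by (intro nn_integral_cong nn_integral_cmult) measurable
  also have "\<dots> = (\<integral>\<^sup>+s. (\<integral>\<^sup>+y. ?R s y * ennreal (\<bar>s\<bar> ^ m * slab m ((s + y) / \<bar>s\<bar>)) \<partial>lborel) \<partial>lborel)"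
  proof (intro nn_integral_cong_AE)
    show "AE s in lborel. (\<integral>\<^sup>+y. ?R s y * (\<integral>\<^sup>+z. ?P s z * indicator {-\<bar>s\<bar>..\<bar>s\<bar>} (s + y + sum z J) \<partial>Leb J) \<partial>lborel)
        = (\<integral>\<^sup>+y. ?R s y * ennreal (\<bar>s\<bar> ^ m * slab m ((s + y) / \<bar>s\<bar>)) \<partial>lborel)"
      using AE_lborel_singleton[of "0::real"]
      by eventually_elim (use J in \<open>simp add: nn_integral_slab_volume\<close>)
  qed
  \<comment> \<open>Folding at 0 pairs the facets \<open>x k = s\<close> and
    \<open>x k = - s\<close>; their cross-sections will add up to \<open>slab_sum\<close>.\<close>
  also have "\<dots> = (\<integral>\<^sup>+s. ((\<integral>\<^sup>+y. ?R s y * ennreal (\<bar>s\<bar> ^ m * slab m ((s + y) / \<bar>s\<bar>)) \<partial>lborel)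
      + (\<integral>\<^sup>+y. ?R s y * ennreal (\<bar>s\<bar> ^ m * slab m ((- s + y) / \<bar>s\<bar>)) \<partial>lborel)) * indicator {0<..} s \<partial>lborel)"
  proof -
    have "(\<lambda>s. \<integral>\<^sup>+y. ?R s y * ennreal (\<bar>s\<bar> ^ m * slab m ((s + y) / \<bar>s\<bar>)) \<partial>lborel) \<in> borel_measurable borel"
      by measurable
    from nn_integral_lborel_fold[OF this] show ?thesis by (simp only: abs_minus_cancel)
  qed
  also have "\<dots> = (\<integral>\<^sup>+s. ennreal (s ^ Suc m) * (\<integral>\<^sup>+r. \<Phi> s (s * r) * ennreal (slab_sum m r) * indicator {-1..1} r \<partial>lborel) * indicator {0<..} s \<partial>lborel)"
  proof (intro nn_integral_cong)
    fix s :: real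
    have "(\<integral>\<^sup>+y. ?R s y * ennreal (\<bar>s\<bar> ^ m * slab m ((s + y) / \<bar>s\<bar>)) \<partial>lborel)
      + (\<integral>\<^sup>+y. ?R s y * ennreal (\<bar>s\<bar> ^ m * slab m ((- s + y) / \<bar>s\<bar>)) \<partial>lborel)
      = ennreal (s ^ Suc m) * (\<integral>\<^sup>+r. \<Phi> s (s * r) * ennreal (slab_sum m r) * indicator {-1..1} r \<partial>lborel)" (is "?A + ?B = _")
      if s: "0 < s"
    proof -
      have "?A + ?B = (\<integral>\<^sup>+y. ?R s y * (ennreal (s ^ m) * ennreal (slab m ((s + y) / s) + slab m ((- s + y) / s))) \<partial>lborel)"
        using s slab_nonneg by (subst nn_integral_add[symmetric], measurable)
          (simp add: ennreal_mult ennreal_plus distrib_left distrib_right del: ennreal_plus[symmetric])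
      also have "\<dots> = ennreal \<bar>s\<bar> * (\<integral>\<^sup>+r. ?R s (0 + s * r) * (ennreal (s ^ m) * ennreal (slab m ((s + (0 + s * r)) / s) + slab m ((- s + (0 + s * r)) / s))) \<partial>lborel)"
        using s by (intro nn_integral_real_affine) measurable
      also have "\<dots> = ennreal s * (\<integral>\<^sup>+r. ennreal (s ^ m) * (\<Phi> s (s * r) * ennreal (slab_sum m r) * indicator {-1..1} r) \<partial>lborel)"
      proof -
        have "indicator {-s..s} (s * r) = (indicator {-1..1} r :: ennreal)" for r
          using s mult_le_cancel_left_pos[of s "-1" r] mult_le_cancel_left_pos[of s r 1]
          by (simp add: indicator_def)
        moreover have "slab m ((s + s * r) / s) + slab m ((- s + s * r) / s) = slab_sum m r" for r
        proof -
          have "(s + s * r) / s = 1 + r" "(- s + s * r) / s = - (1 - r)"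
            using s by (auto simp: field_simps)
          then show ?thesis by (simp only: slab_minus slab_sum_def)
        qed
        ultimately show ?thesis using s by (simp add: mult_ac)
      qed
      also have "\<dots> = ennreal (s ^ Suc m) * (\<integral>\<^sup>+r. \<Phi> s (s * r) * ennreal (slab_sum m r) * indicator {-1..1} r \<partial>lborel)"
        using s by (subst nn_integral_cmult) (auto simp: ennreal_mult mult.assoc)
      finally show ?thesis .
    qed
    then show "(?A + ?B) * indicator {0<..} s = ennreal (s ^ Suc m) * (\<integral>\<^sup>+r. \<Phi> s (s * r) * ennreal (slab_sum m r) * indicator {-1..1} r \<partial>lborel) * indicator {0<..} s"
      by (cases "0 < s") auto
  qed
  finally show ?thesis .
qed

text \<open>Polar coordinates with respect to the sup norm: the facet pair of the coordinate
  \<open>i\<close> itself gives the terms at \<open>s\<close> and \<open>- s\<close>, and each of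
  the \<open>m + 2\<close> other pairs gives the same integral over \<open>r\<close>.\<close>

lemma nn_integral_sup_norm_component:
  "\<exists>c>0. \<forall>i<m + 3. \<forall>\<Phi>. case_prod \<Phi> \<in> borel_measurable (borel \<Otimes>\<^sub>M borel) \<longrightarrow>
    (\<integral>\<^sup>+x. \<Phi> (sup_norm (m + 3) x) (x i) \<partial>hyperplane_lebesgue (m + 3)) =
    ennreal c * (\<integral>\<^sup>+s. ennreal (s ^ Suc m) * (ennreal (slab (Suc m) 1) * (\<Phi> s s + \<Phi> s (- s))
      + of_nat (m + 2) * (\<integral>\<^sup>+r. \<Phi> s (s * r) * ennreal (slab_sum m r) * indicator {-1..1} r \<partial>lborel))
      * indicator {0<..} s \<partial>lborel)"
proof -
  let ?n = "m + 3" and ?I = "{..<m + 3}"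
  have "1 \<le> ?n" by simp
  from nn_integral_hyperplane_lebesgue[OF this] obtain c where c: "0 < c"
    and hyp: "\<And>F k. F \<in> borel_measurable (Leb ?I) \<Longrightarrow> k < ?n \<Longrightarrow>
     (\<integral>\<^sup>+x. F x \<partial>hyperplane_lebesgue ?n) = ennreal c * (\<integral>\<^sup>+z. F (zero_sum_ext ?I k z) \<partial>Leb (?I - {k}))"
    by blast
  show ?thesis
  proof (intro exI[of _ c] conjI allI impI c)
    fix i and \<Phi> :: "real \<Rightarrow> real \<Rightarrow> ennreal"
    assume i: "i < ?n" and [measurable]: "case_prod \<Phi> \<in> borel_measurable (borel \<Otimes>\<^sub>M borel)"
    define G where "G k x = \<Phi> \<bar>x k\<bar> (x i) * (\<Prod>j\<in>?I - {k}. indicator {-\<bar>x k\<bar>..\<bar>x k\<bar>} (x j))" for k x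
    define D where "D = (\<integral>\<^sup>+s. (\<Phi> s s + \<Phi> s (- s)) * ennreal (s ^ Suc m * slab (Suc m) 1) * indicator {0<..} s \<partial>lborel)"
    define E where "E = (\<integral>\<^sup>+s. ennreal (s ^ Suc m) * (\<integral>\<^sup>+r. \<Phi> s (s * r) * ennreal (slab_sum m r) * indicator {-1..1} r \<partial>lborel) * indicator {0<..} s \<partial>lborel)"
    have G[measurable]: "G k \<in> borel_measurable (Leb ?I)" if "k < ?n" for k
      unfolding G_def[abs_def] using that i by (auto, measurable)
    have diag: "(\<integral>\<^sup>+x. G i x \<partial>hyperplane_lebesgue ?n) = ennreal c * D"
    proof -
      obtain l where l: "l < ?n" "l \<noteq> i"
        using that[of 0] that[of 1] by (cases "i = 0") auto
      have "(\<integral>\<^sup>+z. G i (zero_sum_ext ?I l z) \<partial>Leb (?I - {l})) = D"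
        unfolding G_def D_def using l i
        \<comment> \<open>Only \<open>i\<close> and \<open>l\<close> leave the index set here, so
          \<open>m + 1\<close> coordinates are integrated out, against \<open>m\<close> on the other
          facets.\<close>
        by (subst nn_integral_diagonal_facet[where m = "Suc m" and \<Phi> = "\<lambda>s. \<Phi> \<bar>s\<bar> s"])
           (auto intro!: nn_integral_cong split: split_indicator)
      then show ?thesis using hyp[OF G[OF i] l(1)] by simp
    qed
    have other: "(\<integral>\<^sup>+x. G k x \<partial>hyperplane_lebesgue ?n) = ennreal c * E" if k: "k < ?n" "k \<noteq> i" for k
    proof -
      have "card {i, k} < card ?I" using k by auto
      then have "\<not> ?I \<subseteq> {i, k}"
        using card_mono[of "{i, k}" ?I] by auto
      then obtain l where l: "l < ?n" "l \<noteq> i" "l \<noteq> k" by auto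
      have "(\<integral>\<^sup>+z. G k (zero_sum_ext ?I l z) \<partial>Leb (?I - {l})) = E"
        unfolding G_def E_def using l i k by (intro nn_integral_other_facet) auto
      then show ?thesis using hyp[OF G[OF k(1)] l(1)] by simp
    qed
    have "(\<integral>\<^sup>+x. \<Phi> (sup_norm ?n x) (x i) \<partial>hyperplane_lebesgue ?n) = (\<integral>\<^sup>+x. (\<Sum>k<?n. G k x) \<partial>hyperplane_lebesgue ?n)"
    proof (rule nn_integral_cong_AE)
      have "3 \<le> ?n" by simp
      from AE_hyperplane_lebesgue_no_ties[OF this]
      show "AE x in hyperplane_lebesgue ?n. \<Phi> (sup_norm ?n x) (x i) = (\<Sum>k<?n. G k x)"
      proof eventually_elim
        case (elim x)
        then show ?case
          using sup_norm_decomposition[of ?n x "\<lambda>t. \<Phi> t (x i)"] by (simp add: G_def)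
      qed
    qed
    also have "\<dots> = (\<Sum>k<?n. \<integral>\<^sup>+x. G k x \<partial>hyperplane_lebesgue ?n)"
      by (intro nn_integral_sum) (auto simp: measurable_hyperplane_lebesgue)
    also have "\<dots> = (\<integral>\<^sup>+x. G i x \<partial>hyperplane_lebesgue ?n) + (\<Sum>k\<in>?I - {i}. \<integral>\<^sup>+x. G k x \<partial>hyperplane_lebesgue ?n)"
      using i by (intro sum.remove) auto
    also have "(\<Sum>k\<in>?I - {i}. \<integral>\<^sup>+x. G k x \<partial>hyperplane_lebesgue ?n) = (\<Sum>k\<in>?I - {i}. ennreal c * E)"
      by (intro sum.cong other) auto
    also have "\<dots> = of_nat (m + 2) * (ennreal c * E)"
      using i by (simp add: card_Diff_subset)
    also have "(\<integral>\<^sup>+x. G i x \<partial>hyperplane_lebesgue ?n) + of_nat (m + 2) * (ennreal c * E) = ennreal c * (D + of_nat (m + 2) * E)"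
      unfolding diag by (simp only: distrib_left mult.left_commute)
    also have "D + of_nat (m + 2) * E = (\<integral>\<^sup>+s. (\<Phi> s s + \<Phi> s (- s)) * ennreal (s ^ Suc m * slab (Suc m) 1) * indicator {0<..} s
       + of_nat (m + 2) * (ennreal (s ^ Suc m) * (\<integral>\<^sup>+r. \<Phi> s (s * r) * ennreal (slab_sum m r) * indicator {-1..1} r \<partial>lborel) * indicator {0<..} s) \<partial>lborel)"
      unfolding D_def E_def by (subst nn_integral_add) (auto simp: nn_integral_cmult)
    also have "\<dots> = (\<integral>\<^sup>+s. ennreal (s ^ Suc m) * (ennreal (slab (Suc m) 1) * (\<Phi> s s + \<Phi> s (- s))
      + of_nat (m + 2) * (\<integral>\<^sup>+r. \<Phi> s (s * r) * ennreal (slab_sum m r) * indicator {-1..1} r \<partial>lborel))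
      * indicator {0<..} s \<partial>lborel)"
    proof (rule nn_integral_cong)
      fix s :: real
      have "ennreal (s ^ Suc m * slab (Suc m) 1) = ennreal (s ^ Suc m) * ennreal (slab (Suc m) 1)" if "0 < s"
        using that slab_nonneg[of "Suc m" 1] by (intro ennreal_mult zero_le_power) simp_all
      then show "(\<Phi> s s + \<Phi> s (- s)) * ennreal (s ^ Suc m * slab (Suc m) 1) * indicator {0<..} s
       + of_nat (m + 2) * (ennreal (s ^ Suc m) * (\<integral>\<^sup>+r. \<Phi> s (s * r) * ennreal (slab_sum m r) * indicator {-1..1} r \<partial>lborel) * indicator {0<..} s)
       = ennreal (s ^ Suc m) * (ennreal (slab (Suc m) 1) * (\<Phi> s s + \<Phi> s (- s))
      + of_nat (m + 2) * (\<integral>\<^sup>+r. \<Phi> s (s * r) * ennreal (slab_sum m r) * indicator {-1..1} r \<partial>lborel))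
      * indicator {0<..} s"
        by (cases "0 < s") (simp_all del: slab.simps of_nat_add add: distrib_left mult_ac)
    qed
    finally show "(\<integral>\<^sup>+x. \<Phi> (sup_norm ?n x) (x i) \<partial>hyperplane_lebesgue ?n) =
      ennreal c * (\<integral>\<^sup>+s. ennreal (s ^ Suc m) * (ennreal (slab (Suc m) 1) * (\<Phi> s s + \<Phi> s (- s))
      + of_nat (m + 2) * (\<integral>\<^sup>+r. \<Phi> s (s * r) * ennreal (slab_sum m r) * indicator {-1..1} r \<partial>lborel))
      * indicator {0<..} s \<partial>lborel)" .
  qed
qed

subsection \<open>Marginals of Gerow--Robson distributions\<close>

text \<open>The conditional density of \<open>\<bar>x i\<bar>\<close> when \<open>sup_norm (m + 3) x = 1\<close> is attained at another coordinate;
  the dimension is \<open>n = m + 3\<close>.\<close>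

definition facet_density :: "nat \<Rightarrow> real \<Rightarrow> real" where
  "facet_density m r = slab_sum m r / slab (Suc m) 1"

lemma facet_density_nonneg: "0 \<le> facet_density m r"
  using slab_Suc_1_pos[of m] slab_sum_nonneg[of m r] by (simp add: facet_density_def del: slab.simps)

lemma facet_density_minus: "facet_density m (- r) = facet_density m r"
  by (simp add: facet_density_def slab_sum_minus)

lemma borel_measurable_facet_density [measurable]: "facet_density m \<in> borel_measurable borel"
  unfolding facet_density_def[abs_def] by measurable

lemma nn_integral_facet_density:
  "(\<integral>\<^sup>+r. ennreal (facet_density m r) * indicator {0..1} r \<partial>lborel) = 1"
proof -
  have "(slab_sum m has_integral slab (Suc m) 1) {0..1}"
    using integrable_integral[OF integrable_slab_sum[of m 0 1]] by (simp only: integral_slab_sum)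
  then have "(facet_density m has_integral slab (Suc m) 1 / slab (Suc m) 1) {0..1}"
    unfolding facet_density_def[abs_def] by (rule has_integral_divide)
  then show ?thesis
    using slab_Suc_1_pos[of m] nn_integral_has_integral_lebesgue'[of "{0..1}" "facet_density m" 1]
    by (simp add: facet_density_nonneg del: slab.simps)
qed

lemma nn_integral_fold_interval:
  fixes f :: "real \<Rightarrow> ennreal"
  assumes [measurable]: "f \<in> borel_measurable borel"
  shows "(\<integral>\<^sup>+r. f r * indicator {-1..1} r \<partial>lborel) = (\<integral>\<^sup>+r. (f r + f (- r)) * indicator {0..1} r \<partial>lborel)"
proof -
  have "(\<integral>\<^sup>+r. f r * indicator {-1..1} r \<partial>lborel)
      = (\<integral>\<^sup>+r. (f r * indicator {-1..1} r + f (- r) * indicator {-1..1} (- r)) * indicator {0<..} r \<partial>lborel)"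
    by (intro nn_integral_lborel_fold) measurable
  also have "\<dots> = (\<integral>\<^sup>+r. (f r + f (- r)) * indicator {0..1} r \<partial>lborel)"
    using AE_lborel_singleton[of "0::real"]
    by (intro nn_integral_cong_AE) (auto split: split_indicator)
  finally show ?thesis .
qed

text \<open>The mean of \<open>h (x i)\<close> conditional on sup norm \<open>s\<close>. All
  \<open>2 n\<close> facets are equally likely; in the second weight the 2 in the denominator is
  there because \<open>facet_density\<close> has mass 2 on \<open>{-1..1}\<close>.\<close>

definition radial_kernel :: "nat \<Rightarrow> (real \<Rightarrow> ennreal) \<Rightarrow> real \<Rightarrow> ennreal" where
  "radial_kernel m h s = ennreal (1 / (2 * real (m + 3))) * (h s + h (- s))
     + ennreal (real (m + 2) / (2 * real (m + 3)))
       * (\<integral>\<^sup>+r. h (s * r) * ennreal (facet_density m r) * indicator {-1..1} r \<partial>lborel)"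

lemma borel_measurable_radial_kernel [measurable]:
  assumes [measurable]: "h \<in> borel_measurable borel"
  shows "radial_kernel m h \<in> borel_measurable borel"
  unfolding radial_kernel_def[abs_def] by measurable

lemma radial_kernel_one: "radial_kernel m (\<lambda>_. 1) s = 1"
proof -
  have "(\<integral>\<^sup>+r. ennreal (facet_density m r) * indicator {-1..1} r \<partial>lborel)
      = (\<integral>\<^sup>+r. 2 * (ennreal (facet_density m r) * indicator {0..1} r) \<partial>lborel)"
    by (subst nn_integral_fold_interval) (auto simp: facet_density_minus distrib_right mult_2)
  also have "\<dots> = 2"
    by (subst nn_integral_cmult) (auto simp: nn_integral_facet_density)
  finally have "radial_kernel m (\<lambda>_. 1) s = ennreal (1 / (2 * real (m + 3))) * 2 + ennreal (real (m + 2) / (2 * real (m + 3))) * 2"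
    by (simp add: radial_kernel_def)
  also have "\<dots> = ennreal ((1 / (2 * real (m + 3))) * 2 + (real (m + 2) / (2 * real (m + 3))) * 2)"
  proof -
    have "ennreal a * 2 + ennreal b * 2 = ennreal (a * 2 + b * 2)" if "0 \<le> a" "0 \<le> b" for a b
      using that by (simp add: ennreal_mult)
    then show ?thesis by simp
  qed
  also have "(1 / (2 * real (m + 3))) * 2 + (real (m + 2) / (2 * real (m + 3))) * 2 = 1"
  proof -
    have "1 / (2 * N) * 2 + (N - 1) / (2 * N) * 2 = 1" if "N > 0" for N :: real
      using that by (simp add: field_simps)
    from this[of "real (m + 3)"] show ?thesis by simp
  qed
  finally show ?thesis by simp
qed

lemma AE_hyperplane_lebesgue_sum_zero:
  assumes n: "1 \<le> n"
  shows "AE x in hyperplane_lebesgue n. sum x {..<n} = 0"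
proof -
  let ?F = "\<lambda>x. indicator (- {0}) (sum x {..<n}) :: ennreal"
  have F: "?F \<in> borel_measurable (Leb {..<n})" by measurable
  have "0 < n" using n by simp
  then obtain c where "(\<integral>\<^sup>+x. ?F x \<partial>hyperplane_lebesgue n) = ennreal c * (\<integral>\<^sup>+z. ?F (zero_sum_ext {..<n} 0 z) \<partial>Leb ({..<n} - {0}))"
    using nn_integral_hyperplane_lebesgue[OF n] F by blast
  also have "\<dots> = 0" using n by (simp add: sum_zero_sum_ext)
  finally have "AE x in hyperplane_lebesgue n. ?F x = 0"
    using F by (subst (asm) nn_integral_0_iff_AE) (auto simp: measurable_hyperplane_lebesgue)
  then show ?thesis by eventually_elim (auto simp: indicator_def split: if_splits)
qed

lemma balanced_cube_iff_sup_norm: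
  assumes "0 < n" "x \<in> space (hyperplane_lebesgue n)" "sum x {..<n} = 0"
  shows "x \<in> balanced_cube n \<longleftrightarrow> sup_norm n x \<le> 1"
proof -
  have "sup_norm n x \<le> 1 \<longleftrightarrow> (\<forall>k<n. \<bar>x k\<bar> \<le> 1)"
    unfolding sup_norm_def using assms(1) by (subst Max_le_iff) (auto simp: lessThan_empty_iff)
  moreover have "x \<in> {..<n} \<rightarrow>\<^sub>E UNIV"
    using assms(2) by (simp add: space_hyperplane_lebesgue space_PiM)
  ultimately show ?thesis
    using assms(3) by (auto simp: balanced_cube_def PiE_iff abs_le_iff)
qed

lemma sup_norm_nonneg: "0 < n \<Longrightarrow> 0 \<le> sup_norm n x"
  using sup_norm_ge[of 0 n x] by linarith

text \<open>Conditionally on \<open>sup_norm n x = s\<close>, a point of a Gerow--Robson distribution is uniform on the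
  boundary of \<open>s\<close> times the balanced cube, each of whose facets fixes one coordinate to be \<open>\<plusminus>s\<close>.\<close>

lemma nn_integral_gr_distribution:
  assumes g: "unit_interval_density g" and i: "i < m + 3" and h[measurable]: "h \<in> borel_measurable borel"
  shows "(\<integral>\<^sup>+x. h (x i) \<partial>gr_distribution (m + 3) g)
    = (\<integral>\<^sup>+s. ennreal (g s) * radial_kernel m h s * indicator {0..1} s \<partial>lborel)"
proof -
  let ?n = "m + 3" and ?v = "hyperplane_lebesgue (m + 3)" and ?B = "balanced_cube (m + 3)"
  define w where "w = slab (Suc m) 1"
  have w: "w > 0" unfolding w_def by (rule slab_Suc_1_pos)
  obtain c where c: "c > 0"
    and main: "\<And>\<Phi> i. i < ?n \<Longrightarrow> case_prod \<Phi> \<in> borel_measurable (borel \<Otimes>\<^sub>M borel) \<Longrightarrow>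
      (\<integral>\<^sup>+x. \<Phi> (sup_norm ?n x) (x i) \<partial>?v) =
      ennreal c * (\<integral>\<^sup>+s. ennreal (s ^ Suc m) * (ennreal w * (\<Phi> s s + \<Phi> s (- s))
        + of_nat (m + 2) * (\<integral>\<^sup>+r. \<Phi> s (s * r) * ennreal (slab_sum m r) * indicator {-1..1} r \<partial>lborel))
        * indicator {0<..} s \<partial>lborel)"
    using nn_integral_sup_norm_component[of m] unfolding w_def by blast
  \<comment> \<open>The total area of the \<open>2 n\<close> facets in the units of the previous
    formula; dividing by it makes \<open>radial_kernel\<close> a probability kernel.\<close>
  define C where "C = 2 * real ?n * w"
  have C: "C > 0" using w by (simp add: C_def)
  have kernel: "(\<integral>\<^sup>+x. \<phi> (sup_norm ?n x) * f (x i) \<partial>?v)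
      = ennreal (c * C) * (\<integral>\<^sup>+s. ennreal (s ^ Suc m) * (\<phi> s * radial_kernel m f s) * indicator {0<..} s \<partial>lborel)"
    if [measurable]: "\<phi> \<in> borel_measurable borel" "f \<in> borel_measurable borel" and i: "i < ?n" for \<phi> f i
  proof -
    have eq: "ennreal w * (\<phi> s * f s + \<phi> s * f (- s))
        + of_nat (m + 2) * (\<integral>\<^sup>+r. \<phi> s * f (s * r) * ennreal (slab_sum m r) * indicator {-1..1} r \<partial>lborel)
        = ennreal C * (\<phi> s * radial_kernel m f s)" for s
    proof -
      have "(\<integral>\<^sup>+r. \<phi> s * f (s * r) * ennreal (slab_sum m r) * indicator {-1..1} r \<partial>lborel)
          = (\<integral>\<^sup>+r. ennreal w * \<phi> s * (f (s * r) * ennreal (facet_density m r) * indicator {-1..1} r) \<partial>lborel)"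
      proof (rule nn_integral_cong)
        fix r
        have "ennreal (slab_sum m r) = ennreal w * ennreal (facet_density m r)"
          using w facet_density_nonneg[of m r]
          by (subst ennreal_mult[symmetric]) (auto simp: facet_density_def w_def simp del: slab.simps)
        then show "\<phi> s * f (s * r) * ennreal (slab_sum m r) * indicator {-1..1} r
            = ennreal w * \<phi> s * (f (s * r) * ennreal (facet_density m r) * indicator {-1..1} r)"
          by (simp add: mult_ac)
      qed
      also have "\<dots> = ennreal w * \<phi> s * (\<integral>\<^sup>+r. f (s * r) * ennreal (facet_density m r) * indicator {-1..1} r \<partial>lborel)"
        (is "_ = _ * ?I") by (intro nn_integral_cmult) measurable
      finally have int: "(\<integral>\<^sup>+r. \<phi> s * f (s * r) * ennreal (slab_sum m r) * indicator {-1..1} r \<partial>lborel) = ennreal w * \<phi> s * ?I" .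
      have "ennreal w * (\<phi> s * f s + \<phi> s * f (- s))
        + of_nat (m + 2) * (\<integral>\<^sup>+r. \<phi> s * f (s * r) * ennreal (slab_sum m r) * indicator {-1..1} r \<partial>lborel)
        = \<phi> s * (ennreal w * (f s + f (- s)) + ennreal (real (m + 2) * w) * ?I)"
      proof -
        have "ennreal (real (m + 2) * w) = of_nat (m + 2) * ennreal w"
          using w by (simp only: ennreal_of_nat_eq_real_of_nat) (simp only: ennreal_mult' of_nat_0_le_iff)
        then show ?thesis
          unfolding int by (simp only: distrib_left mult_ac)
      qed
      also have "\<phi> s * (ennreal w * (f s + f (- s)) + ennreal (real (m + 2) * w) * ?I) = ennreal C * (\<phi> s * radial_kernel m f s)"
      proof -
        have e1: "ennreal w = ennreal C * ennreal (1 / (2 * real ?n))"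
          using w C by (subst ennreal_mult[symmetric]) (auto simp: C_def)
        have e2: "ennreal (real (m + 2) * w) = ennreal C * ennreal (real (m + 2) / (2 * real ?n))"
        proof -
          have "C * (b / (2 * real ?n)) = b * w" for b by (simp add: C_def del: of_nat_add)
          from this[of "real (m + 2)"] show ?thesis
            using C by (simp only: ennreal_mult'[symmetric] less_imp_le)
        qed
        show ?thesis
          unfolding e1 e2 radial_kernel_def by (simp only: distrib_left mult_ac)
      qed
      finally show ?thesis .
    qed
    have "(\<integral>\<^sup>+x. \<phi> (sup_norm ?n x) * f (x i) \<partial>?v)
      = ennreal c * (\<integral>\<^sup>+s. ennreal (s ^ Suc m) * (ennreal C * (\<phi> s * radial_kernel m f s)) * indicator {0<..} s \<partial>lborel)"
      unfolding eq[symmetric] using main[OF i, of "\<lambda>s y. \<phi> s * f y"] by simp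
    also have "(\<integral>\<^sup>+s. ennreal (s ^ Suc m) * (ennreal C * (\<phi> s * radial_kernel m f s)) * indicator {0<..} s \<partial>lborel)
      = (\<integral>\<^sup>+s. ennreal C * (ennreal (s ^ Suc m) * (\<phi> s * radial_kernel m f s) * indicator {0<..} s) \<partial>lborel)"
      by (simp only: mult_ac)
    also have "\<dots> = ennreal C * (\<integral>\<^sup>+s. ennreal (s ^ Suc m) * (\<phi> s * radial_kernel m f s) * indicator {0<..} s \<partial>lborel)"
      by (intro nn_integral_cmult) measurable
    finally show ?thesis
      using c C by (simp add: ennreal_mult mult.assoc)
  qed
  have n1: "1 \<le> ?n" by simp
  have cube: "AE x in ?v. x \<in> ?B \<longleftrightarrow> sup_norm ?n x \<in> {0..1}"
    using AE_hyperplane_lebesgue_sum_zero[OF n1] AE_space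
    by eventually_elim (auto simp: balanced_cube_iff_sup_norm sup_norm_nonneg)
  define V where "V = balanced_cube_volume ?n"
  \<comment> \<open>The volume is evaluated by the same formula with test function 1. It therefore
    carries the factor \<open>c\<close>, which cancels in the normalised density.\<close>
  have "V = c * C / real (m + 2)"
  proof -
    have "emeasure ?v ?B = (\<integral>\<^sup>+x. indicator ?B x \<partial>?v)"
      using balanced_cube_measurable by simp
    also have "\<dots> = (\<integral>\<^sup>+x. indicator {0..1} (sup_norm ?n x) * 1 \<partial>?v)"
      using cube by (intro nn_integral_cong_AE) (auto elim!: eventually_mono split: split_indicator)
    also have "\<dots> = ennreal (c * C) * (\<integral>\<^sup>+s. ennreal (s ^ Suc m) * (indicator {0..1} s * radial_kernel m (\<lambda>_. 1) s) * indicator {0<..} s \<partial>lborel)"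
      by (rule kernel[of _ _ 0]) auto
    also have "(\<integral>\<^sup>+s. ennreal (s ^ Suc m) * (indicator {0..1} s * radial_kernel m (\<lambda>_. 1) s) * indicator {0<..} s \<partial>lborel)
        = (\<integral>\<^sup>+s. ennreal (s ^ Suc m) * indicator {0..1} s \<partial>lborel)"
      using AE_lborel_singleton[of "0::real"]
      by (intro nn_integral_cong_AE) (auto elim!: eventually_mono split: split_indicator simp: radial_kernel_one)
    also have "\<dots> = ennreal (1 / real (m + 2))"
    proof -
      have "((\<lambda>s. s ^ Suc m) has_integral (1 ^ Suc (Suc m) / real (Suc (Suc m)) - 0 ^ Suc (Suc m) / real (Suc (Suc m)))) {0..1::real}"
      proof (intro fundamental_theorem_of_calculus)
        fix s :: real
        have "((\<lambda>s. s ^ Suc (Suc m) / real (Suc (Suc m))) has_real_derivative s ^ Suc m) (at s within {0..1})"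
          using DERIV_cdivide[OF DERIV_pow[of "Suc (Suc m)" s "{0..1}"], of "real (Suc (Suc m))"]
          by (simp del: of_nat_Suc power_Suc)
        then show "((\<lambda>s. s ^ Suc (Suc m) / real (Suc (Suc m))) has_vector_derivative s ^ Suc m) (at s within {0..1})"
          by (simp only: has_real_derivative_iff_has_vector_derivative)
      qed simp
      then show ?thesis
        by (intro nn_integral_has_integral_lebesgue') (auto simp: add.commute)
    qed
    finally have "emeasure ?v ?B = ennreal (c * C / real (m + 2))"
      using c C by (simp add: ennreal_mult[symmetric] del: of_nat_add)
    then show ?thesis
      using c C by (simp add: V_def balanced_cube_volume_def measure_def)
  qed
  then have V: "real (m + 2) * V = c * C" by simp
  define g' where "g' s = indicator {0..1} s * g s" for s
  have [measurable]: "g' \<in> borel_measurable borel"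
    using g by (simp add: unit_interval_density_def set_borel_measurable_def g'_def[abs_def])
  define d where "d s = ennreal (g' s / (c * C * s ^ Suc m))" for s
  have [measurable]: "d \<in> borel_measurable borel" unfolding d_def[abs_def] by measurable
  have comp: "(\<lambda>x. h (x i)) \<in> borel_measurable ?v"
    using i by (intro measurable_compose[OF _ h]) (simp add: measurable_hyperplane_lebesgue Leb_component)
  have "(\<integral>\<^sup>+x. h (x i) \<partial>gr_distribution ?n g)
      = (\<integral>\<^sup>+x. ennreal (gr_density ?n g x) * h (x i) \<partial>restrict_space ?v ?B)"
    unfolding gr_distribution_def using gr_density_measurable[of ?n g] g comp
    by (intro nn_integral_density) (auto intro: measurable_restrict_space1)
  also have "\<dots> = (\<integral>\<^sup>+x. ennreal (gr_density ?n g x) * h (x i) * indicator ?B x \<partial>?v)"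
    using balanced_cube_measurable[of ?n] by (intro nn_integral_restrict_space) auto
  also have "\<dots> = (\<integral>\<^sup>+x. d (sup_norm ?n x) * h (x i) \<partial>?v)"
  proof (rule nn_integral_cong_AE)
    have dens: "ennreal (gr_density ?n g x) = d (sup_norm ?n x)" if "sup_norm ?n x \<in> {0..1}" for x
    proof -
      have "?n - 1 = m + 2" "?n - 2 = Suc m" by auto
      then have "gr_density ?n g x = g (sup_norm ?n x) / (c * C * sup_norm ?n x ^ Suc m)"
        unfolding gr_density_def V_def[symmetric] V[symmetric] by (simp only:)
      then show ?thesis using that by (simp add: d_def g'_def)
    qed
    show "AE x in ?v. ennreal (gr_density ?n g x) * h (x i) * indicator ?B x = d (sup_norm ?n x) * h (x i)"
      using cube
    proof eventually_elim
      case (elim x)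
      show ?case
      proof (cases "x \<in> ?B")
        case True
        then show ?thesis using elim dens by simp
      next
        case False
        then have "d (sup_norm ?n x) = 0" using elim by (simp add: d_def g'_def)
        then show ?thesis using False by simp
      qed
    qed
  qed
  also have "\<dots> = ennreal (c * C) * (\<integral>\<^sup>+s. ennreal (s ^ Suc m) * (d s * radial_kernel m h s) * indicator {0<..} s \<partial>lborel)"
    using i by (intro kernel) auto
  also have "\<dots> = (\<integral>\<^sup>+s. ennreal (c * C) * (ennreal (s ^ Suc m) * (d s * radial_kernel m h s) * indicator {0<..} s) \<partial>lborel)"
    by (intro nn_integral_cmult[symmetric]) measurable
  also have "\<dots> = (\<integral>\<^sup>+s. ennreal (g s) * radial_kernel m h s * indicator {0..1} s \<partial>lborel)"
  proof (rule nn_integral_cong_AE)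
    show "AE s in lborel. ennreal (c * C) * (ennreal (s ^ Suc m) * (d s * radial_kernel m h s) * indicator {0<..} s)
       = ennreal (g s) * radial_kernel m h s * indicator {0..1} s"
      using AE_lborel_singleton[of "0::real"]
    proof eventually_elim
      case (elim s)
      show ?case
      proof (cases "s \<in> {0..1}")
        case True
        then have gs: "0 < s" "0 \<le> g s" using elim g by (auto simp: unit_interval_density_def)
        have "d s = ennreal (g s / (c * C * s ^ Suc m))" using True by (simp add: d_def g'_def)
        moreover have "ennreal q * (ennreal p * ennreal (g s / (q * p))) = ennreal (g s)" if "0 < q" "0 < p" for p q
          using that by (simp add: ennreal_mult'[symmetric] less_imp_le)
        ultimately have "ennreal (c * C) * (ennreal (s ^ Suc m) * d s) = ennreal (g s)"
          using gs c C by simp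
        then show ?thesis using True gs by (simp add: mult.assoc[symmetric] del: power_Suc)
      next
        case False
        then show ?thesis by (auto simp: d_def g'_def)
      qed
    qed
  qed
  finally show ?thesis .
qed

lemma prob_space_gr_distribution:
  assumes g: "unit_interval_density g"
  shows "prob_space (gr_distribution (m + 3) g)"
proof
  have "emeasure (gr_distribution (m + 3) g) (space (gr_distribution (m + 3) g))
      = (\<integral>\<^sup>+x. (\<lambda>_. 1) (x (0::nat)) \<partial>gr_distribution (m + 3) g)"
    by simp
  also have "\<dots> = (\<integral>\<^sup>+s. ennreal (g s) * radial_kernel m (\<lambda>_. 1) s * indicator {0..1} s \<partial>lborel)"
    using g by (intro nn_integral_gr_distribution) auto
  also have "\<dots> = 1" using g by (simp add: radial_kernel_one unit_interval_density_def)
  finally show "emeasure (gr_distribution (m + 3) g) (space (gr_distribution (m + 3) g)) = 1" .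
qed

lemma gr_distribution_component_measurable:
  "k < n \<Longrightarrow> (\<lambda>x. x k) \<in> borel_measurable (gr_distribution n g)"
  by (subst measurable_cong_sets[of _ "restrict_space (hyperplane_lebesgue n) (balanced_cube n)" borel borel])
     (auto simp: gr_distribution_def measurable_hyperplane_lebesgue Leb_component intro: measurable_restrict_space1)

section \<open>Uniform marginals as one integral equation\<close>

lemma nn_integral_uniform_interval:
  assumes [measurable]: "h \<in> borel_measurable borel"
  shows "(\<integral>\<^sup>+y. h y \<partial>uniform_measure lborel {-1..1::real}) = ennreal (1 / 2) * (\<integral>\<^sup>+y. h y * indicator {-1..1} y \<partial>lborel)"
proof -
  have "(\<integral>\<^sup>+y. h y \<partial>uniform_measure lborel {-1..1::real}) = (\<integral>\<^sup>+y. h y * indicator {-1..1} y \<partial>lborel) / emeasure lborel {-1..1::real}"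
    by (intro nn_integral_uniform_measure) auto
  also have "\<dots> = ennreal (1 / 2) * (\<integral>\<^sup>+y. h y * indicator {-1..1} y \<partial>lborel)"
    by (simp add: divide_ennreal_def mult.commute)
  finally show ?thesis .
qed

text \<open>The zero-sum condition is built into the space, and the law of a coordinate does not
  depend on its index, so all requirements collapse to a single identity between laws on the line,
  tested on nonnegative Borel functions.\<close>

lemma gr_defines_rbs_iff:
  assumes g: "unit_interval_density g"
  shows "gr_defines_rbs (m + 3) g \<longleftrightarrow>
    (\<forall>h \<in> borel_measurable borel. (\<integral>\<^sup>+s. ennreal (g s) * radial_kernel m h s * indicator {0..1} s \<partial>lborel)
       = ennreal (1 / 2) * (\<integral>\<^sup>+y. h y * indicator {-1..1} y \<partial>lborel))" (is "_ \<longleftrightarrow> ?rhs")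
proof -
  let ?P = "gr_distribution (m + 3) g"
  let ?U = "uniform_measure lborel {-1..1::real}"
  have sum0: "AE x in ?P. (\<Sum>k<m + 3. x k) = 0"
    by (rule AE_I2) (auto simp: gr_distribution_def space_restrict_space balanced_cube_def)
  have marg: "distr ?P borel (\<lambda>x. x k) = ?U \<longleftrightarrow> ?rhs" if k: "k < m + 3" for k
  proof -
    have int: "(\<integral>\<^sup>+y. h y \<partial>distr ?P borel (\<lambda>x. x k)) = (\<integral>\<^sup>+s. ennreal (g s) * radial_kernel m h s * indicator {0..1} s \<partial>lborel)"
      if "h \<in> borel_measurable borel" for h
      using that g k by (subst nn_integral_distr)
        (auto simp: gr_distribution_component_measurable intro: nn_integral_gr_distribution)
    show ?thesis
    proof
      assume "distr ?P borel (\<lambda>x. x k) = ?U"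
      then show ?rhs using int nn_integral_uniform_interval by simp
    next
      assume rhs: ?rhs
      show "distr ?P borel (\<lambda>x. x k) = ?U"
      proof (rule measure_eqI)
        fix A assume "A \<in> sets (distr ?P borel (\<lambda>x. x k))"
        then have A: "A \<in> sets borel" by simp
        have "emeasure (distr ?P borel (\<lambda>x. x k)) A = (\<integral>\<^sup>+y. indicator A y \<partial>distr ?P borel (\<lambda>x. x k))"
          using A by simp
        also have "\<dots> = (\<integral>\<^sup>+y. indicator A y \<partial>?U)"
        proof -
          have h: "(indicator A :: real \<Rightarrow> ennreal) \<in> borel_measurable borel" using A by simp
          show ?thesis
            by (simp only: int[OF h] bspec[OF rhs h] nn_integral_uniform_interval[OF h])
        qed
        finally show "emeasure (distr ?P borel (\<lambda>x. x k)) A = emeasure ?U A"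
          using A by simp
      qed simp
    qed
  qed
  have "0 < m + 3" by simp
  then have "(\<forall>k<m + 3. distr ?P borel (\<lambda>x. x k) = ?U) \<longleftrightarrow> ?rhs"
    using marg by blast
  then show ?thesis
    unfolding gr_defines_rbs_def random_balanced_sample_def
    using prob_space_gr_distribution[OF g, of m] sum0 gr_distribution_component_measurable by blast
qed

text \<open>The mean of \<open>k (s * R)\<close>, where \<open>R\<close> has an atom of weight
  \<open>1/n\<close> at 1 and otherwise the density \<open>facet_density m\<close>: the folded form
  of \<open>radial_kernel\<close> for functions of the modulus.\<close>

definition scale_kernel :: "nat \<Rightarrow> (real \<Rightarrow> ennreal) \<Rightarrow> real \<Rightarrow> ennreal" where
  "scale_kernel m k s = ennreal (1 / real (m + 3)) * k s
     + ennreal (real (m + 2) / real (m + 3))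
       * (\<integral>\<^sup>+r. k (s * r) * ennreal (facet_density m r) * indicator {0..1} r \<partial>lborel)"

lemma gr_defines_rbs_scale_kernel:
  assumes g: "unit_interval_density g" and rbs: "gr_defines_rbs (m + 3) g"
    and k[measurable]: "k \<in> borel_measurable borel"
  shows "(\<integral>\<^sup>+s. ennreal (g s) * scale_kernel m k s * indicator {0..1} s \<partial>lborel) = (\<integral>\<^sup>+y. k y * indicator {0..1} y \<partial>lborel)"
proof -
  let ?h = "\<lambda>y. k \<bar>y\<bar>"
  have half: "ennreal (a / (2 * b)) * (2 * x) = ennreal (a / b) * x" if "0 \<le> a" "0 < b" for a b x
  proof -
    have "ennreal (a / b) = ennreal (a / (2 * b)) * 2"
      using that ennreal_mult[of "a / (2 * b)" 2] by simp
    then show ?thesis by (simp add: mult.assoc)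
  qed
  have K: "radial_kernel m ?h s = scale_kernel m k s" if s: "0 \<le> s" for s
  proof -
    have "(\<integral>\<^sup>+r. ?h (s * r) * ennreal (facet_density m r) * indicator {-1..1} r \<partial>lborel)
        = (\<integral>\<^sup>+r. 2 * (k (s * r) * ennreal (facet_density m r) * indicator {0..1} r) \<partial>lborel)"
      using s by (subst nn_integral_fold_interval)
        (auto simp: facet_density_minus distrib_right mult_2 abs_mult intro!: nn_integral_cong split: split_indicator)
    also have "\<dots> = 2 * (\<integral>\<^sup>+r. k (s * r) * ennreal (facet_density m r) * indicator {0..1} r \<partial>lborel)"
      by (intro nn_integral_cmult) measurable
    finally show ?thesis
      using s half[of 1 "real (m + 3)" "k s"] half[of "real (m + 2)" "real (m + 3)"]
      by (simp only: radial_kernel_def scale_kernel_def) (simp add: mult_2[symmetric])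
  qed
  have "(\<integral>\<^sup>+s. ennreal (g s) * scale_kernel m k s * indicator {0..1} s \<partial>lborel)
      = (\<integral>\<^sup>+s. ennreal (g s) * radial_kernel m ?h s * indicator {0..1} s \<partial>lborel)"
    by (intro nn_integral_cong) (auto split: split_indicator simp: K)
  also have "\<dots> = ennreal (1 / 2) * (\<integral>\<^sup>+y. ?h y * indicator {-1..1} y \<partial>lborel)"
    using rbs unfolding gr_defines_rbs_iff[OF g] by auto
  also have "(\<integral>\<^sup>+y. ?h y * indicator {-1..1} y \<partial>lborel) = (\<integral>\<^sup>+y. 2 * (k y * indicator {0..1} y) \<partial>lborel)"
    by (subst nn_integral_fold_interval) (auto simp: mult_2 distrib_right intro!: nn_integral_cong split: split_indicator)
  also have "\<dots> = 2 * (\<integral>\<^sup>+y. k y * indicator {0..1} y \<partial>lborel)"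
    by (intro nn_integral_cmult) measurable
  finally show ?thesis using half[of 1 1] by simp
qed

subsection \<open>At least five coordinates\<close>

text \<open>Stated for an arbitrary \<open>u\<close>, because only its behaviour near 0, its
  quadratic deficit and its total mass enter, and \<open>N\<close> only through
  \<open>N \<ge> 5\<close>.\<close>

lemma scale_mixture_uniform_impossible:
  fixes g u :: "real \<Rightarrow> real" and N a \<epsilon> :: real
  assumes g: "unit_interval_density g"
    and u[measurable]: "u \<in> borel_measurable borel"
    and u0: "\<And>r. 0 \<le> u r"
    and u1: "(\<integral>\<^sup>+r. ennreal (u r) * indicator {0..1} r \<partial>lborel) = 1"
    and u_le: "\<And>r. r \<in> {0..1} \<Longrightarrow> u r \<le> a - \<epsilon> * r\<^sup>2" and \<epsilon>: "0 < \<epsilon>"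
    and u_ge: "\<And>b. b < a \<Longrightarrow> \<exists>\<delta>>0. \<forall>r\<in>{0..\<delta>}. b \<le> u r"
    and N: "5 \<le> N"
    and mix: "\<And>k. k \<in> borel_measurable borel \<Longrightarrow>
      (\<integral>\<^sup>+s. ennreal (g s) * (ennreal (1 / N) * k s + ennreal ((N - 1) / N) *
         (\<integral>\<^sup>+r. k (s * r) * ennreal (u r) * indicator {0..1} r \<partial>lborel)) * indicator {0..1} s \<partial>lborel)
       = (\<integral>\<^sup>+y. k y * indicator {0..1} y \<partial>lborel)"
  shows False
proof -
  define \<kappa> where "\<kappa> = (N - 1) / N"
  have \<kappa>: "0 < \<kappa>" "N * \<kappa> = N - 1" using N by (auto simp: \<kappa>_def)
  define g' where "g' s = indicator {0..1} s * g s" for s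
  have [measurable]: "g' \<in> borel_measurable borel"
    using g by (simp add: unit_interval_density_def set_borel_measurable_def g'_def[abs_def])
  define M where "M = density lborel (\<lambda>s. ennreal (g' s))"
  have sets_M [measurable_cong, simp]: "sets M = sets borel" by (simp add: M_def)
  have int_M: "(\<integral>\<^sup>+s. f s \<partial>M) = (\<integral>\<^sup>+s. ennreal (g s) * f s * indicator {0..1} s \<partial>lborel)"
    if [measurable]: "f \<in> borel_measurable borel" for f
  proof -
    have "(\<integral>\<^sup>+s. f s \<partial>M) = (\<integral>\<^sup>+s. ennreal (g' s) * f s \<partial>lborel)"
      unfolding M_def by (intro nn_integral_density) auto
    also have "\<dots> = (\<integral>\<^sup>+s. ennreal (g s) * f s * indicator {0..1} s \<partial>lborel)"
      by (intro nn_integral_cong) (auto simp: g'_def split: split_indicator)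
    finally show ?thesis .
  qed
  have AE_M: "AE s in M. 0 < s \<and> s \<le> 1"
  proof -
    have "AE s in lborel. 0 < ennreal (g' s) \<longrightarrow> 0 < s \<and> s \<le> 1"
      using AE_lborel_singleton[of "0::real"]
      by eventually_elim (auto simp: g'_def split: split_indicator)
    then show ?thesis unfolding M_def by (subst AE_density) auto
  qed
  have M1: "(\<integral>\<^sup>+s. 1 \<partial>M) = 1"
    using g by (subst int_M) (auto simp: unit_interval_density_def)
  define K where "K k s = (\<integral>\<^sup>+r. k (s * r) * ennreal (u r) * indicator {0..1} r \<partial>lborel)" for k :: "real \<Rightarrow> ennreal" and s
  have K[measurable]: "K k \<in> borel_measurable borel" if [measurable]: "k \<in> borel_measurable borel" for k
    unfolding K_def by measurable
  have mix_M: "(\<integral>\<^sup>+s. ennreal (1 / N) * k s + ennreal \<kappa> * K k s \<partial>M) = (\<integral>\<^sup>+y. k y * indicator {0..1} y \<partial>lborel)"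
    if [measurable]: "k \<in> borel_measurable borel" for k
    using mix[OF that] by (subst int_M) (auto simp: K_def \<kappa>_def)
  have a1: "1 \<le> a"
  proof -
    have "1 = (\<integral>\<^sup>+r. ennreal (u r) * indicator {0..1} r \<partial>lborel)" by (rule u1[symmetric])
    also have "\<dots> \<le> (\<integral>\<^sup>+r. ennreal a * indicator {0..1::real} r \<partial>lborel)"
    proof (rule nn_integral_mono)
      fix r :: real
      show "ennreal (u r) * indicator {0..1} r \<le> ennreal a * indicator {0..1} r"
      proof (cases "r \<in> {0..1}")
        case True
        have "0 \<le> \<epsilon> * r\<^sup>2" using \<epsilon> by simp
        then have "u r \<le> a" using u_le[OF True] by simp
        then show ?thesis using True by (simp add: ennreal_leI)
      qed simp
    qed
    also have "\<dots> = ennreal a" by (simp add: nn_integral_cmult_indicator)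
    finally show ?thesis by simp
  qed
  define F where "F A = (\<integral>\<^sup>+s. ennreal (1 / s) * indicator A s \<partial>M)" for A :: "real set"
  define Q where "Q A = (\<integral>\<^sup>+s. indicator A s \<partial>M)" for A :: "real set"
  have E_b: "ennreal (\<kappa> * b) * F UNIV \<le> 1" if b: "0 < b" "b < a" for b
  proof -
    obtain \<delta> where \<delta>: "\<delta> > 0" "\<And>r. r \<in> {0..\<delta>} \<Longrightarrow> b \<le> u r" using u_ge[OF b(2)] by blast
    \<comment> \<open>Averages over shrinking intervals at 0. Each has integral at most 1 against
      the uniform law, while for fixed \<open>s > 0\<close> its value under \<open>K\<close> is
      eventually at least \<open>b / s\<close>; Fatou's lemma then bounds the inverse moment. The
      detour through \<open>b < a\<close> is needed since \<open>u\<close> only approaches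
      \<open>a\<close> near 0.\<close>
    define k where "k j y = ennreal (real (Suc j)) * indicator {0..1 / real (Suc j)} y" for j and y :: real
    have [measurable]: "k j \<in> borel_measurable borel" for j unfolding k_def[abs_def] by measurable
    have lim: "ennreal (\<kappa> * b) * ennreal (1 / s) \<le> liminf (\<lambda>j. ennreal \<kappa> * K (k j) s)" if s: "0 < s" for s
    proof (rule Liminf_bounded)
      have "eventually (\<lambda>j. 1 / (s * min \<delta> 1) < real (Suc j)) sequentially"
      proof -
        obtain J :: nat where J: "1 / (s * min \<delta> 1) < real J" using reals_Archimedean2 by blast
        show ?thesis
          by (rule eventually_sequentiallyI[of J]) (use J in simp)
      qed
      then show "\<forall>\<^sub>F j in sequentially. ennreal (\<kappa> * b) * ennreal (1 / s) \<le> ennreal \<kappa> * K (k j) s"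
      proof eventually_elim
        case (elim j)
        define x where "x = 1 / (real (Suc j) * s)"
        have x: "0 < x" "x < \<delta>" "x < 1"
        proof -
          define D where "D = min \<delta> 1"
          have D: "0 < D" "D \<le> \<delta>" "D \<le> 1" using \<delta>(1) by (auto simp: D_def)
          have P: "0 < real (Suc j) * s" "0 < s * D" using s D(1) by auto
          then have "1 < real (Suc j) * s * D"
            using elim unfolding D_def[symmetric] by (simp add: divide_less_eq mult_ac del: of_nat_Suc)
          then have "x < D"
            using P by (simp add: x_def divide_less_eq mult_ac del: of_nat_Suc)
          then show "x < \<delta>" "x < 1" using D by auto
          show "0 < x" using P by (simp add: x_def del: of_nat_Suc)
        qed
        have "ennreal b * ennreal (1 / s) = (\<integral>\<^sup>+r. ennreal (real (Suc j) * b) * indicator {0..x} r \<partial>lborel)"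
          using x s b by (subst nn_integral_cmult_indicator) (auto simp: ennreal_mult[symmetric] x_def simp del: of_nat_Suc)
        also have "\<dots> \<le> K (k j) s"
          unfolding K_def
        proof (rule nn_integral_mono)
          fix r :: real
          show "ennreal (real (Suc j) * b) * indicator {0..x} r \<le> k j (s * r) * ennreal (u r) * indicator {0..1} r"
          proof (cases "r \<in> {0..x}")
            case True
            then have "s * r \<le> s * x" using s by (intro mult_left_mono) auto
            then have "s * r \<in> {0..1 / real (Suc j)}"
              using True s by (auto simp: x_def simp del: of_nat_Suc)
            moreover have "b \<le> u r" using True x by (intro \<delta>) auto
            ultimately show ?thesis
              using True x b by (simp add: k_def ennreal_mult ennreal_leI mult_left_mono del: of_nat_Suc)
          qed simp
        qed
        finally show ?case
          using \<kappa> b by (simp add: ennreal_mult mult.assoc mult_left_mono)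
      qed
    qed
    have "ennreal (\<kappa> * b) * F UNIV = (\<integral>\<^sup>+s. ennreal (\<kappa> * b) * ennreal (1 / s) \<partial>M)"
      unfolding F_def by (subst nn_integral_cmult) auto
    also have "\<dots> \<le> (\<integral>\<^sup>+s. liminf (\<lambda>j. ennreal \<kappa> * K (k j) s) \<partial>M)"
      using AE_M by (intro nn_integral_mono_AE) (auto elim!: eventually_mono intro: lim)
    also have "\<dots> \<le> liminf (\<lambda>j. \<integral>\<^sup>+s. ennreal \<kappa> * K (k j) s \<partial>M)"
      by (intro nn_integral_liminf) measurable
    also have "\<dots> \<le> liminf (\<lambda>j::nat. 1)"
    proof (intro Liminf_mono always_eventually allI)
      fix j
      have "(\<integral>\<^sup>+s. ennreal \<kappa> * K (k j) s \<partial>M) \<le> (\<integral>\<^sup>+s. ennreal (1 / N) * k j s + ennreal \<kappa> * K (k j) s \<partial>M)"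
        by (intro nn_integral_mono) auto
      also have "\<dots> = (\<integral>\<^sup>+y. k j y * indicator {0..1} y \<partial>lborel)" by (rule mix_M) measurable
      also have "\<dots> \<le> (\<integral>\<^sup>+y. ennreal (real (Suc j)) * indicator {0..1 / real (Suc j)} y \<partial>lborel)"
        by (intro nn_integral_mono) (auto simp: k_def split: split_indicator)
      also have "\<dots> = 1"
        by (subst nn_integral_cmult_indicator) (auto simp: ennreal_mult[symmetric] simp del: of_nat_Suc)
      finally show "(\<integral>\<^sup>+s. ennreal \<kappa> * K (k j) s \<partial>M) \<le> 1" .
    qed
    finally show ?thesis by (simp add: Liminf_const)
  qed
  have F_fin: "F UNIV < \<top>"
  proof (rule ccontr)
    assume "\<not> F UNIV < \<top>"
    then have "F UNIV = \<top>" by (metis less_top)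
    then show False using E_b[of "1/2"] a1 \<kappa> by (simp add: ennreal_mult_top top_unique)
  qed
  define e where "e = enn2real (F UNIV)"
  have e: "F UNIV = ennreal e" "0 \<le> e" using F_fin by (auto simp: e_def)
  have ae: "\<kappa> * a * e \<le> 1"
  proof (rule ccontr)
    assume contra: "\<not> \<kappa> * a * e \<le> 1"
    then have "e \<noteq> 0" by auto
    then have "0 < \<kappa> * e" using e \<kappa> by simp
    \<comment> \<open>The midpoint of \<open>1 / (\<kappa> * e)\<close> and \<open>a\<close>: still
      below \<open>a\<close>, but large enough to violate the bound for \<open>b\<close>.\<close>
    define b where "b = (a + 1 / (\<kappa> * e)) / 2"
    have "1 / (\<kappa> * e) < a" using contra \<open>0 < \<kappa> * e\<close> by (simp add: divide_less_eq mult_ac)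
    then have b: "0 < b" "b < a" using \<open>0 < \<kappa> * e\<close> a1 by (auto simp: b_def add_pos_pos)
    have "ennreal (\<kappa> * b * e) \<le> 1" using E_b[OF b] e \<kappa> b by (simp add: ennreal_mult)
    then have "\<kappa> * b * e \<le> 1" by simp
    moreover have "\<kappa> * b * e = (\<kappa> * a * e + 1) / 2"
      using \<kappa> \<open>e \<noteq> 0\<close> by (simp add: b_def field_simps)
    ultimately show False using contra by simp
  qed
  define f where "f A = enn2real (F A)" for A
  define q where "q A = enn2real (Q A)" for A
  have F_mono: "F A \<le> F B" if "A \<subseteq> B" for A B
    unfolding F_def using that by (intro nn_integral_mono) (auto split: split_indicator)
  have f: "F A = ennreal (f A)" "0 \<le> f A" for A
    using F_fin F_mono[of A UNIV] by (auto simp: f_def)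
  have q: "Q A = ennreal (q A)" "0 \<le> q A" for A
  proof -
    have "Q A \<le> (\<integral>\<^sup>+s. 1 \<partial>M)" unfolding Q_def by (intro nn_integral_mono) (auto split: split_indicator)
    then have "Q A < \<top>" using M1 by (simp add: order_le_less_trans)
    then show "Q A = ennreal (q A)" "0 \<le> q A" by (auto simp: q_def)
  qed
  have f_union: "f (A \<union> B) = f A + f B" if "A \<inter> B = {}" "A \<in> sets borel" "B \<in> sets borel" for A B
  proof -
    have "F (A \<union> B) = (\<integral>\<^sup>+s. ennreal (1 / s) * indicator A s + ennreal (1 / s) * indicator B s \<partial>M)"
      unfolding F_def using that(1) by (intro nn_integral_cong) (auto split: split_indicator)
    also have "\<dots> = F A + F B"
      unfolding F_def using that by (intro nn_integral_add) auto
    finally have "ennreal (f (A \<union> B)) = ennreal (f A + f B)" using f by simp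
    then show ?thesis using f by (simp del: ennreal_plus)
  qed
  have F_ge: "ennreal (1 / t) * Q A \<le> F A" if "0 < t" "A \<subseteq> {..t}" "A \<in> sets borel" for t A
  proof -
    have "ennreal (1 / t) * Q A = (\<integral>\<^sup>+s. ennreal (1 / t) * indicator A s \<partial>M)"
      unfolding Q_def using that by (intro nn_integral_cmult[symmetric]) auto
    also have "\<dots> \<le> F A"
      unfolding F_def using AE_M
    proof (intro nn_integral_mono_AE, eventually_elim)
      case (elim s)
      then show ?case using that by (auto split: split_indicator intro!: ennreal_leI simp: frac_le subset_iff)
    qed
    finally show ?thesis .
  qed
  have f_ge: "q A / t \<le> f A" if "0 < t" "A \<subseteq> {..t}" "A \<in> sets borel" for t A
  proof -
    have "ennreal (1 / t * q A) = ennreal (1 / t) * ennreal (q A)"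
      using that q by (intro ennreal_mult) auto
    also have "\<dots> \<le> ennreal (f A)"
      using F_ge[OF that] by (simp only: f q)
    finally show ?thesis using f by (subst (asm) ennreal_le_iff) auto
  qed
  \<comment> \<open>The density part of \<open>R\<close> hits \<open>{t<..t'}\<close> with
    probability at most \<open>a * (t' - t) / s\<close>, and only if \<open>s > t\<close>, as
    \<open>r \<le> 1\<close>. The full inverse moment would account for at most
    \<open>t' - t\<close>, by \<open>ae\<close>; so the share \<open>f {..t}\<close> lost to
    \<open>s \<le> t\<close> must be made up by the atom at 1, that is, by
    \<open>q {t<..t'} / N\<close>.\<close>
  have interval: "(t' - t) * (\<kappa> * a) * f {..t} \<le> q {t<..t'} / N" if t: "0 < t" "t < t'" "t' \<le> 1" for t t'
  proof -
    have K_le: "K (indicator {t<..t'}) s \<le> ennreal (a * (t' - t)) * (ennreal (1 / s) * indicator {t<..} s)" if s: "0 < s" for s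
    proof -
      have "K (indicator {t<..t'}) s \<le> (\<integral>\<^sup>+r. ennreal a * indicator {t<..} s * indicator {t / s..t' / s} r \<partial>lborel)"
        unfolding K_def
      proof (rule nn_integral_mono)
        fix r :: real
        show "indicator {t<..t'} (s * r) * ennreal (u r) * indicator {0..1} r \<le> ennreal a * indicator {t<..} s * indicator {t / s..t' / s} r"
        proof (cases "r \<in> {0..1} \<and> s * r \<in> {t<..t'}")
          case True
          then have "s * r \<le> s" using s by (simp add: mult_left_le)
          then have "t < s" using True by simp
          moreover have "u r \<le> a" using u_le[of r] \<epsilon> True by (smt (verit) mult_nonneg_nonneg zero_le_power2)
          ultimately show ?thesis
            using True s by (auto simp: field_simps ennreal_leI split: split_indicator)
        qed (auto split: split_indicator)
      qed
      also have "\<dots> = ennreal a * indicator {t<..} s * ennreal (t' / s - t / s)"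
        using s t by (subst nn_integral_cmult_indicator) (auto simp: divide_right_mono)
      also have "t' / s - t / s = (t' - t) * (1 / s)" by (simp add: diff_divide_distrib)
      also have "ennreal \<dots> = ennreal (t' - t) * ennreal (1 / s)"
        using s t by (intro ennreal_mult) auto
      also have "ennreal a * indicator {t<..} s * (ennreal (t' - t) * ennreal (1 / s))
          = ennreal (a * (t' - t)) * (ennreal (1 / s) * indicator {t<..} s)"
        using a1 t by (simp add: ennreal_mult mult_ac)
      finally show ?thesis .
    qed
    have "ennreal (t' - t) = (\<integral>\<^sup>+y. indicator {t<..t'} y * indicator {0..1} y \<partial>lborel)"
    proof -
      have "(\<integral>\<^sup>+y. indicator {t<..t'} y * indicator {0..1} y \<partial>lborel) = (\<integral>\<^sup>+y. indicator {t<..t'} y \<partial>lborel)"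
        using t by (intro nn_integral_cong) (auto split: split_indicator)
      then show ?thesis using t by simp
    qed
    also have "\<dots> = (\<integral>\<^sup>+s. ennreal (1 / N) * indicator {t<..t'} s + ennreal \<kappa> * K (indicator {t<..t'}) s \<partial>M)"
      by (rule mix_M[symmetric]) simp
    also have "\<dots> \<le> (\<integral>\<^sup>+s. ennreal (1 / N) * indicator {t<..t'} s + ennreal \<kappa> * (ennreal (a * (t' - t)) * (ennreal (1 / s) * indicator {t<..} s)) \<partial>M)"
      using AE_M by (intro nn_integral_mono_AE) (auto elim!: eventually_mono intro!: add_left_mono mult_left_mono K_le)
    also have "\<dots> = ennreal (1 / N) * Q {t<..t'} + ennreal \<kappa> * (ennreal (a * (t' - t)) * F {t<..})"
      unfolding Q_def F_def by (subst nn_integral_add) (auto simp: nn_integral_cmult)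
    also have "\<dots> = ennreal (q {t<..t'} / N + \<kappa> * (a * (t' - t) * f {t<..}))"
      using q f N \<kappa> a1 t by (simp add: ennreal_mult[symmetric] ennreal_plus[symmetric] del: ennreal_plus)
    finally have "t' - t \<le> q {t<..t'} / N + \<kappa> * (a * (t' - t) * f {t<..})"
      using q f N \<kappa> a1 t by (subst (asm) ennreal_le_iff) auto
    moreover have "f {..t} + f {t<..} = e"
    proof -
      have "{..t} \<union> {t<..} = UNIV" by auto
      moreover have "{..t} \<inter> {t<..} = {}" by auto
      ultimately have "f UNIV = f {..t} + f {t<..}" using f_union[of "{..t}" "{t<..}"] by simp
      then show ?thesis by (simp add: f_def e_def)
    qed
    then have "(t' - t) * (\<kappa> * a * e) = (t' - t) * (\<kappa> * a) * f {..t} + \<kappa> * (a * (t' - t) * f {t<..})"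
      by (simp add: algebra_simps flip: \<open>f {..t} + f {t<..} = e\<close>)
    moreover have "(t' - t) * (\<kappa> * a * e) \<le> (t' - t) * 1"
      using t ae by (intro mult_left_mono) auto
    ultimately show ?thesis by simp
  qed
  have growth: "7 / 3 * f {..t} \<le> f {..3 / 2 * t}" if t: "0 < t" "3 / 2 * t \<le> 1" for t
  proof -
    let ?t' = "3 / 2 * t"
    have "{..t} \<union> {t<..?t'} = {..?t'}" using t by auto
    moreover have "{..t} \<inter> {t<..?t'} = {}" by auto
    ultimately have "f {..?t'} = f {..t} + f {t<..?t'}" using f_union[of "{..t}" "{t<..?t'}"] by simp
    moreover have "q {t<..?t'} / ?t' \<le> f {t<..?t'}" using t by (intro f_ge) auto
    moreover have "4 / 3 * f {..t} \<le> q {t<..?t'} / ?t'"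
    proof -
      \<comment> \<open>This is where \<open>N \<ge> 5\<close> enters; the length
        \<open>t / 2\<close> over the right end \<open>3 t / 2\<close> then turns 4 into
        4/3.\<close>
      have "4 * 1 \<le> (N - 1) * a" using N a1 by (intro mult_mono) auto
      then have "4 * f {..t} \<le> (N * \<kappa> * a) * f {..t}" using f \<kappa> by (intro mult_right_mono) auto
      also have "(t / 2) * ((N * \<kappa> * a) * f {..t}) \<le> q {t<..?t'}"
        using interval[of t ?t'] t N by (simp add: field_simps)
      then have "(N * \<kappa> * a) * f {..t} \<le> q {t<..?t'} * (2 / t)"
        using t by (simp add: field_simps)
      finally show ?thesis using t by (simp add: field_simps)
    qed
    ultimately show ?thesis by linarith
  qed
  have lower: "N * \<kappa> * \<epsilon> / 3 * t\<^sup>2 \<le> f {..t}" if t: "0 < t" "t \<le> 1" for t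
  proof -
    \<comment> \<open>The deficit is collected on \<open>{0..t}\<close> only. This lies inside both
      \<open>{0..1}\<close> and \<open>{0..t / s}\<close> because \<open>s\<close> and
      \<open>t\<close> are at most 1, so the gain \<open>\<epsilon> * t ^ 3 / 3\<close> is
      independent of \<open>s\<close>.\<close>
    have K_le: "K (indicator {0..t}) s + ennreal (\<epsilon> * t ^ 3 / 3) \<le> ennreal (a * t) * ennreal (1 / s)" if s: "0 < s" "s \<le> 1" for s
    proof -
      have "((\<lambda>r. \<epsilon> * r\<^sup>2) has_integral \<epsilon> * t ^ 3 / 3 - \<epsilon> * 0 ^ 3 / 3) {0..t}"
        using t by (intro fundamental_theorem_of_calculus)
          (auto intro!: derivative_eq_intros simp flip: has_real_derivative_iff_has_vector_derivative)
      then have "(\<integral>\<^sup>+r. ennreal (\<epsilon> * r\<^sup>2) * indicator {0..t} r \<partial>lborel) = ennreal (\<epsilon> * t ^ 3 / 3)"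
        using \<epsilon> by (intro nn_integral_has_integral_lebesgue') auto
      then have "K (indicator {0..t}) s + ennreal (\<epsilon> * t ^ 3 / 3)
          = (\<integral>\<^sup>+r. indicator {0..t} (s * r) * ennreal (u r) * indicator {0..1} r + ennreal (\<epsilon> * r\<^sup>2) * indicator {0..t} r \<partial>lborel)"
        unfolding K_def by (subst nn_integral_add) auto
      also have "\<dots> \<le> (\<integral>\<^sup>+r. ennreal a * indicator {0..t / s} r \<partial>lborel)"
      proof (rule nn_integral_mono)
        fix r :: real
        show "indicator {0..t} (s * r) * ennreal (u r) * indicator {0..1} r + ennreal (\<epsilon> * r\<^sup>2) * indicator {0..t} r
            \<le> ennreal a * indicator {0..t / s} r"
        proof (cases "r \<in> {0..t / s}")
          case True
          show ?thesis
          proof (cases "r \<le> 1")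
            case r1: True
            then have "u r + \<epsilon> * r\<^sup>2 \<le> a" using u_le[of r] True by simp
            then have "ennreal (u r) + ennreal (\<epsilon> * r\<^sup>2) \<le> ennreal a"
              using u0[of r] \<epsilon> ennreal_leI[of "u r + \<epsilon> * r\<^sup>2" a] by simp
            moreover have "indicator {0..t} (s * r) * ennreal (u r) * indicator {0..1} r + ennreal (\<epsilon> * r\<^sup>2) * indicator {0..t} r
              \<le> ennreal (u r) + ennreal (\<epsilon> * r\<^sup>2)"
              by (intro add_mono) (auto split: split_indicator)
            ultimately show ?thesis using True by auto
          next
            case False
            then show ?thesis using t by auto
          qed
        next
          case False
          have "t \<le> t / s" using s t by (simp add: field_simps mult_left_le)
          then have "r \<notin> {0..t}" using False by auto
          moreover have "s * r \<notin> {0..t}"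
            using False s by (auto simp: field_simps zero_le_mult_iff)
          ultimately show ?thesis by simp
        qed
      qed
      also have "\<dots> = ennreal a * ennreal (t / s)"
        using s t by (subst nn_integral_cmult_indicator) auto
      also have "\<dots> = ennreal (a * t) * ennreal (1 / s)"
        using s t a1 by (simp add: ennreal_mult[symmetric])
      finally show ?thesis .
    qed
    \<comment> \<open>The deficit is added on the left rather than subtracted on the right, which
      keeps every integral in \<open>ennreal\<close>.\<close>
    have "ennreal (t + \<kappa> * (\<epsilon> * t ^ 3 / 3)) = (\<integral>\<^sup>+y. indicator {0..t} y * indicator {0..1} y \<partial>lborel) + ennreal \<kappa> * ennreal (\<epsilon> * t ^ 3 / 3)"
    proof -
      have "(\<integral>\<^sup>+y. indicator {0..t} y * indicator {0..1} y \<partial>lborel) = (\<integral>\<^sup>+y. indicator {0..t} y \<partial>lborel)"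
        using t by (intro nn_integral_cong) (auto split: split_indicator)
      also have "\<dots> = ennreal t" using t by simp
      moreover have "ennreal (\<kappa> * (\<epsilon> * t ^ 3 / 3)) = ennreal \<kappa> * ennreal (\<epsilon> * t ^ 3 / 3)"
        using t \<epsilon> \<kappa> by (intro ennreal_mult) auto
      moreover have "ennreal (t + \<kappa> * (\<epsilon> * t ^ 3 / 3)) = ennreal t + ennreal (\<kappa> * (\<epsilon> * t ^ 3 / 3))"
        using t \<epsilon> \<kappa> by (intro ennreal_plus) auto
      ultimately show ?thesis by simp
    qed
    also have "\<dots> = (\<integral>\<^sup>+s. ennreal (1 / N) * indicator {0..t} s + ennreal \<kappa> * K (indicator {0..t}) s \<partial>M) + (\<integral>\<^sup>+s. ennreal \<kappa> * ennreal (\<epsilon> * t ^ 3 / 3) * 1 \<partial>M)"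
      by (subst mix_M) (simp, subst nn_integral_cmult, simp, simp only: M1 mult_1_right)
    also have "\<dots> = (\<integral>\<^sup>+s. ennreal (1 / N) * indicator {0..t} s + ennreal \<kappa> * (K (indicator {0..t}) s + ennreal (\<epsilon> * t ^ 3 / 3)) \<partial>M)"
      by (subst nn_integral_add[symmetric]) (auto simp: distrib_left add.assoc)
    also have "\<dots> \<le> (\<integral>\<^sup>+s. ennreal (1 / N) * indicator {..t} s + ennreal \<kappa> * (ennreal (a * t) * (ennreal (1 / s) * indicator UNIV s)) \<partial>M)"
      using AE_M
    proof (intro nn_integral_mono_AE, eventually_elim)
      case (elim s)
      then have "K (indicator {0..t}) s + ennreal (\<epsilon> * t ^ 3 / 3) \<le> ennreal (a * t) * (ennreal (1 / s) * indicator UNIV s)"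
        using K_le[of s] by simp
      then show ?case
        by (intro add_mono mult_left_mono) (auto split: split_indicator)
    qed
    also have "\<dots> = ennreal (1 / N) * Q {..t} + ennreal \<kappa> * (ennreal (a * t) * F UNIV)"
      unfolding Q_def F_def by (subst nn_integral_add) (auto simp: nn_integral_cmult)
    also have "\<dots> = ennreal (q {..t} / N + \<kappa> * (a * t * e))"
      using q e N \<kappa> a1 t by (simp add: ennreal_mult[symmetric] ennreal_plus[symmetric] del: ennreal_plus)
    finally have "t + \<kappa> * (\<epsilon> * t ^ 3 / 3) \<le> q {..t} / N + \<kappa> * (a * t * e)"
      using q e N \<kappa> a1 t by (subst (asm) ennreal_le_iff) auto
    moreover have "t * (\<kappa> * a * e) \<le> t * 1"
      using t ae by (intro mult_left_mono) auto
    ultimately have "\<kappa> * (\<epsilon> * t ^ 3 / 3) \<le> q {..t} / N" by (simp add: algebra_simps)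
    then have "N * (\<kappa> * (\<epsilon> * t ^ 3 / 3)) \<le> q {..t}" using N by (simp add: field_simps)
    then have "N * (\<kappa> * (\<epsilon> * t ^ 3 / 3)) / t \<le> q {..t} / t" using t by (intro divide_right_mono) auto
    also have "\<dots> \<le> f {..t}" using t by (intro f_ge) auto
    also have "N * (\<kappa> * (\<epsilon> * t ^ 3 / 3)) / t = N * \<kappa> * \<epsilon> / 3 * t\<^sup>2"
      using t by (simp add: power2_eq_square power3_eq_cube)
    finally show ?thesis .
  qed
  have decay: "f {..(2 / 3) ^ j} \<le> (3 / 7) ^ j * f {..1}" for j
  proof (induction j)
    case (Suc j)
    have "3 / 2 * (2 / 3) ^ Suc j = (2 / 3 :: real) ^ j" by simp
    then have "7 / 3 * f {..(2 / 3) ^ Suc j} \<le> f {..(2 / 3) ^ j}"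
      using growth[of "(2 / 3) ^ Suc j"] by (simp add: power_le_one del: power_Suc)
    then show ?case using Suc by simp
  qed simp
  define C where "C = N * \<kappa> * \<epsilon> / 3"
  have "C > 0" using N \<kappa> \<epsilon> by (simp add: C_def)
  \<comment> \<open>The number 28/27 is the gain of 7/3 over \<open>(3/2)\<^sup>2\<close>.\<close>
  obtain j where j: "f {..1} / C < (28 / 27) ^ j"
    using real_arch_pow[of "28 / 27" "f {..1} / C"] by auto
  have "C * ((2 / 3) ^ j)\<^sup>2 \<le> (3 / 7) ^ j * f {..1}"
    using lower[of "(2 / 3) ^ j"] decay[of j] by (simp add: C_def power_le_one)
  moreover have "((2 / 3 :: real) ^ j)\<^sup>2 = (3 / 7) ^ j * (28 / 27) ^ j"
    by (simp add: power_mult_distrib[symmetric] power2_eq_square)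
  ultimately have "(3 / 7) ^ j * (C * (28 / 27) ^ j) \<le> (3 / 7) ^ j * f {..1}"
    by (simp add: mult_ac)
  then have "C * (28 / 27) ^ j \<le> f {..1}"
    by (subst (asm) mult_le_cancel_left_pos) auto
  then show False using j \<open>C > 0\<close> by (simp add: field_simps)
qed

text \<open>Continuity of the spline shows that the values of \<open>facet_density\<close> near 0
  approach its value at 0; the quadratic bound, rescaled by the normalising constant, supplies the
  deficit.\<close>

lemma gr_not_rbs_ge_5:
  assumes g: "unit_interval_density g"
  shows "\<not> gr_defines_rbs (Suc (Suc k) + 3) g"
proof
  let ?m = "Suc (Suc k)"
  assume rbs: "gr_defines_rbs (?m + 3) g"
  define w where "w = slab (Suc ?m) 1"
  have w: "0 < w" unfolding w_def by (rule slab_Suc_1_pos)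
  obtain \<epsilon> where \<epsilon>: "0 < \<epsilon>" "\<And>r. r \<in> {0..1} \<Longrightarrow> slab_sum ?m r \<le> slab_sum ?m 0 - \<epsilon> * r\<^sup>2"
    using slab_sum_quadratic_bound[of k] by blast
  have u: "facet_density ?m r = slab_sum ?m r / w" for r
    by (simp add: facet_density_def w_def)
  have "facet_density ?m r \<le> facet_density ?m 0 - \<epsilon> / w * r\<^sup>2" if "r \<in> {0..1}" for r
    using \<epsilon>(2)[OF that] w unfolding u by (simp add: field_simps)
  moreover have "\<exists>\<delta>>0. \<forall>r\<in>{0..\<delta>}. b \<le> facet_density ?m r" if b: "b < facet_density ?m 0" for b
  proof -
    have cont: "continuous_on UNIV (facet_density ?m)"
      unfolding facet_density_def[abs_def] slab_sum_def[abs_def] using w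
      by (intro continuous_on_divide continuous_on_add continuous_on_compose2[OF slab_continuous] continuous_intros)
         (auto simp: w_def simp del: slab.simps)
    have "\<forall>\<^sub>F r in at 0. b < facet_density ?m r"
      using cont b by (intro order_tendstoD(1)[of _ "facet_density ?m 0"]) (auto simp: continuous_on_def)
    then obtain d where d: "d > 0" "\<And>r. r \<noteq> 0 \<Longrightarrow> dist r 0 < d \<Longrightarrow> b < facet_density ?m r"
      unfolding eventually_at by blast
    have "b \<le> facet_density ?m r" if "r \<in> {0..d / 2}" for r
      using d(2)[of r] d(1) b that by (cases "r = 0") auto
    then show ?thesis using d(1) by (intro exI[of _ "d / 2"]) auto
  qed
  moreover have "(\<integral>\<^sup>+s. ennreal (g s) * (ennreal (1 / real (?m + 3)) * h s + ennreal ((real (?m + 3) - 1) / real (?m + 3)) *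
         (\<integral>\<^sup>+r. h (s * r) * ennreal (facet_density ?m r) * indicator {0..1} r \<partial>lborel)) * indicator {0..1} s \<partial>lborel)
       = (\<integral>\<^sup>+y. h y * indicator {0..1} y \<partial>lborel)" if "h \<in> borel_measurable borel" for h
  proof -
    have "real (?m + 3) - 1 = real (?m + 2)" by simp
    then show ?thesis
      using gr_defines_rbs_scale_kernel[OF g rbs that] by (simp only: scale_kernel_def)
  qed
  ultimately show False
    using scale_mixture_uniform_impossible[of g "facet_density ?m" "facet_density ?m 0" "\<epsilon> / w" "real (?m + 3)"]
      g \<epsilon>(1) w facet_density_nonneg nn_integral_facet_density by auto
qed

subsection \<open>Three and four coordinates\<close>

text \<open>The descending side of the tent function, all that the arguments \<open>1 - r\<close>
  and \<open>1 + r\<close> ever meet.\<close>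

lemma slab_1:
  assumes "0 \<le> x" "x \<le> 2"
  shows "slab (Suc 0) x = 2 - x"
proof -
  have "((\<lambda>_. 1 :: real) has_integral (1 - (x - 1))) {x - 1..1}"
    using assms has_integral_const_real[of "1::real" "x - 1" 1] by simp
  then have "((\<lambda>y. if y \<in> {x - 1..1} then 1 else 0) has_integral (2 - x)) {x - 1..x + 1}"
    using assms by (subst has_integral_restrict) auto
  then have "(slab 0 has_integral (2 - x)) {x - 1..x + 1}"
    by (rule has_integral_eq[rotated]) (use assms in auto)
  then show ?thesis by (simp add: integral_unique)
qed

text \<open>For \<open>m = 0\<close> only the term at \<open>1 - r\<close> survives; for
  \<open>m = 1\<close> the tent contributes \<open>(1 - r) + (1 + r)\<close>. The point 0 is
  excluded because for \<open>m = 0\<close> both closed intervals contain their common end point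
  there.\<close>

lemma facet_density_eq_1:
  assumes m: "m < 2" and r: "r \<in> {0<..1}"
  shows "facet_density m r = 1"
proof -
  have const: "slab_sum m r = real (Suc m)" if "r \<in> {0<..1}" for r
  proof (cases m)
    case 0
    then show ?thesis using that by (auto simp: slab_sum_def indicator_def)
  next
    case (Suc j)
    then show ?thesis using that m slab_1[of "1 + r"] slab_1[of "1 - r"] by (simp add: slab_sum_def del: slab.simps)
  qed
  \<comment> \<open>The normalising constant is read off from the total mass 1 instead of being
    computed.\<close>
  have "(\<integral>\<^sup>+r. ennreal (facet_density m r) * indicator {0..1} r \<partial>lborel)
      = (\<integral>\<^sup>+r. ennreal (real (Suc m) / slab (Suc m) 1) * indicator {0..1::real} r \<partial>lborel)"
    using AE_lborel_singleton[of "0::real"]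
    by (intro nn_integral_cong_AE) (auto elim!: eventually_mono simp: facet_density_def const simp del: slab.simps of_nat_Suc split: split_indicator)
  then have "ennreal (real (Suc m) / slab (Suc m) 1) = 1"
    by (simp add: nn_integral_facet_density nn_integral_cmult_indicator del: slab.simps of_nat_Suc)
  then have "real (Suc m) / slab (Suc m) 1 = 1" by (simp del: slab.simps of_nat_Suc)
  then show ?thesis using const[OF r] by (simp add: facet_density_def del: slab.simps of_nat_Suc)
qed

lemma scale_kernel_low_dim:
  assumes m: "m < 2" and s: "0 < s" and [measurable]: "k \<in> borel_measurable borel"
  shows "scale_kernel m k s = ennreal (1 / real (m + 3)) * k s
    + ennreal (real (m + 2) / real (m + 3)) * (ennreal (1 / s) * (\<integral>\<^sup>+y. k y * indicator {0..s} y \<partial>lborel))"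
proof -
  have "(\<integral>\<^sup>+r. k (s * r) * ennreal (facet_density m r) * indicator {0..1} r \<partial>lborel)
      = (\<integral>\<^sup>+r. k (s * r) * indicator {0..1} r \<partial>lborel)"
    using AE_lborel_singleton[of "0::real"]
    by (intro nn_integral_cong_AE) (auto elim!: eventually_mono simp: facet_density_eq_1[OF m] split: split_indicator)
  also have "\<dots> = ennreal (1 / s) * (ennreal \<bar>s\<bar> * (\<integral>\<^sup>+r. k (0 + s * r) * indicator {0..s} (0 + s * r) \<partial>lborel))"
  proof -
    have "indicator {0..s} (0 + s * r) = (indicator {0..1} r :: ennreal)" for r
      using s mult_le_cancel_left_pos[of s r 1] by (simp add: indicator_def zero_le_mult_iff)
    moreover have "ennreal (1 / s) * (ennreal \<bar>s\<bar> * I) = I" for I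
      using s by (simp flip: mult.assoc ennreal_mult)
    ultimately show ?thesis by simp
  qed
  also have "ennreal \<bar>s\<bar> * (\<integral>\<^sup>+r. k (0 + s * r) * indicator {0..s} (0 + s * r) \<partial>lborel) = (\<integral>\<^sup>+y. k y * indicator {0..s} y \<partial>lborel)"
    using s by (intro nn_integral_real_affine[symmetric]) auto
  finally show ?thesis by (simp add: scale_kernel_def)
qed

section \<open>Uniqueness of the density in three and four coordinates\<close>

lemma nn_integral_power_interval:
  assumes "0 \<le> a" "a \<le> b"
  shows "(\<integral>\<^sup>+s. ennreal (real (Suc j) * s ^ j) * indicator {a..b} s \<partial>lborel) = ennreal (b ^ Suc j - a ^ Suc j)"
proof -
  have "((\<lambda>s. real (Suc j) * s ^ j) has_integral (b ^ Suc j - a ^ Suc j)) {a..b}"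
    using assms(2) DERIV_pow[of "Suc j"]
    by (intro fundamental_theorem_of_calculus) (auto simp flip: has_real_derivative_iff_has_vector_derivative simp del: of_nat_Suc power_Suc)
  then show ?thesis
    using assms by (intro nn_integral_has_integral_lebesgue') auto
qed

lemma nn_integral_inverse_power_interval:
  assumes "0 < a" "a \<le> b"
  shows "(\<integral>\<^sup>+s. ennreal (real (Suc j) * inverse s ^ Suc (Suc j)) * indicator {a..b} s \<partial>lborel)
    = ennreal (inverse a ^ Suc j - inverse b ^ Suc j)"
proof -
  have "((\<lambda>s. real (Suc j) * inverse s ^ Suc (Suc j)) has_integral (- (inverse b ^ Suc j) - - (inverse a ^ Suc j))) {a..b}"
  proof (intro fundamental_theorem_of_calculus assms)
    fix s assume s: "s \<in> {a..b}"
    have "((\<lambda>s. - (inverse s ^ Suc j)) has_real_derivative real (Suc j) * inverse s ^ Suc (Suc j)) (at s within {a..b})"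
      using DERIV_minus[OF DERIV_power[OF DERIV_inverse[of s "{a..b}"], of "Suc j"]] s assms
      by (simp add: mult_ac del: of_nat_Suc)
    then show "((\<lambda>s. - (inverse s ^ Suc j)) has_vector_derivative real (Suc j) * inverse s ^ Suc (Suc j)) (at s within {a..b})"
      by (simp only: has_real_derivative_iff_has_vector_derivative)
  qed
  then show ?thesis
    using assms by (intro nn_integral_has_integral_lebesgue') auto
qed

text \<open>The two test functions satisfy \<open>scale_kernel m k1 = indicator {0..t} + scale_kernel m k2\<close>, so that
  their integrals determine the distribution function of the sup norm.\<close>

lemma gr_rbs_low_dim_cdf:
  assumes m: "m < 2" and g: "unit_interval_density g" and rbs: "gr_defines_rbs (m + 3) g"
    and t: "0 < t" "t \<le> 1"
  shows "(\<integral>\<^sup>+s. ennreal (g s) * indicator {0..t} s \<partial>lborel) = ennreal (t ^ (m + 3))"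
proof -
  let ?n = "real (m + 3)"
  define k1 :: "real \<Rightarrow> ennreal" where "k1 = indicator {0..t}"
  \<comment> \<open>Obtained by solving the required identity for \<open>s > t\<close>: if
    \<open>A s\<close> is \<open>t\<close> minus the integral of \<open>k2\<close> over
    \<open>{t..s}\<close>, it reads \<open>k2 s = (n - 1) * A s / s\<close> with
    \<open>A' = - k2\<close>, whence \<open>A s = t ^ n / s ^ (n - 1)\<close>. Two nonnegative
    functions stand in for their signed difference.\<close>
  define k2 where "k2 s = ennreal (t ^ (m + 3)) * (ennreal (real (m + 2) * inverse s ^ (m + 3)) * indicator {t<..} s)" for s
  have [measurable]: "k1 \<in> borel_measurable borel" "k2 \<in> borel_measurable borel"
    unfolding k1_def k2_def[abs_def] by measurable
  have int_k2: "(\<integral>\<^sup>+y. k2 y * indicator {0..s} y \<partial>lborel) = ennreal (t - t ^ (m + 3) * inverse s ^ (m + 2))" if s: "t \<le> s" for s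
  proof -
    have "(\<integral>\<^sup>+y. k2 y * indicator {0..s} y \<partial>lborel)
        = (\<integral>\<^sup>+y. ennreal (t ^ (m + 3)) * (ennreal (real (Suc (Suc m)) * inverse y ^ Suc (Suc (Suc m))) * indicator {t..s} y) \<partial>lborel)"
      using AE_lborel_singleton[of t] t
      by (intro nn_integral_cong_AE) (auto elim!: eventually_mono simp: k2_def eval_nat_numeral split: split_indicator)
    also have "\<dots> = ennreal (t ^ (m + 3)) * ennreal (inverse t ^ Suc (Suc m) - inverse s ^ Suc (Suc m))"
      using s t by (subst nn_integral_cmult) (auto simp: nn_integral_inverse_power_interval simp del: of_nat_Suc power_Suc)
    also have "\<dots> = ennreal (t ^ (m + 3) * (inverse t ^ Suc (Suc m) - inverse s ^ Suc (Suc m)))"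
      using s t by (intro ennreal_mult[symmetric]) (auto intro!: power_mono simp del: power_Suc)
    also have "t ^ (m + 3) * (inverse t ^ Suc (Suc m) - inverse s ^ Suc (Suc m)) = t - t ^ (m + 3) * inverse s ^ (m + 2)"
      using t by (simp add: power_inverse field_simps eval_nat_numeral)
    finally show ?thesis .
  qed
  have eq: "scale_kernel m k1 s = indicator {0..t} s + scale_kernel m k2 s" if s: "0 < s" for s
  proof (cases "s \<le> t")
    case True
    have "(\<integral>\<^sup>+y. k1 y * indicator {0..s} y \<partial>lborel) = (\<integral>\<^sup>+y. indicator {0..s} y \<partial>lborel)"
      using True by (intro nn_integral_cong) (auto simp: k1_def split: split_indicator)
    moreover have "(\<integral>\<^sup>+y. k2 y * indicator {0..s} y \<partial>lborel) = (\<integral>\<^sup>+(y::real). 0 \<partial>lborel)"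
      using True by (intro nn_integral_cong) (auto simp: k2_def split: split_indicator)
    moreover have "ennreal (1 / ?n) + ennreal (real (m + 2) / ?n) * (ennreal (1 / s) * ennreal s) = 1"
    proof -
      have "ennreal (1 / s) * ennreal s = 1" using s by (simp flip: ennreal_mult)
      moreover have "ennreal (1 / ?n) + ennreal (real (m + 2) / ?n) = ennreal (1 / ?n + real (m + 2) / ?n)"
        by (intro ennreal_plus[symmetric]) auto
      moreover have "1 / ?n + real (m + 2) / ?n = 1" by (simp flip: add_divide_distrib)
      ultimately show ?thesis by (simp only: mult_1_right ennreal_1)
    qed
    ultimately show ?thesis
      using True s by (simp add: scale_kernel_low_dim[OF m s] k1_def[symmetric]) (simp add: k1_def k2_def)
  next
    case False
    then have ts: "t < s" by simp
    have "(\<integral>\<^sup>+y. k1 y * indicator {0..s} y \<partial>lborel) = (\<integral>\<^sup>+y. indicator {0..t} y \<partial>lborel)"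
      using False by (intro nn_integral_cong) (auto simp: k1_def split: split_indicator)
    then have k1: "scale_kernel m k1 s = ennreal (real (m + 2) / ?n * (1 / s * t))"
      using ts s t by (simp add: scale_kernel_low_dim[OF m s]) (simp add: k1_def ennreal_mult'[symmetric] del: of_nat_add)
    have pos: "0 \<le> t - t ^ (m + 3) * inverse s ^ (m + 2)"
    proof -
      have "t ^ (m + 3) * inverse s ^ (m + 2) = t * (t * inverse s) ^ (m + 2)"
        by (simp add: power_mult_distrib eval_nat_numeral)
      also have "\<dots> \<le> t * 1"
        using t ts s by (intro mult_left_mono power_le_one) (auto simp: field_simps)
      finally show ?thesis by simp
    qed
    have "scale_kernel m k2 s = ennreal (1 / ?n) * ennreal (t ^ (m + 3) * (real (m + 2) * inverse s ^ (m + 3)))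
        + ennreal (real (m + 2) / ?n) * (ennreal (1 / s) * ennreal (t - t ^ (m + 3) * inverse s ^ (m + 2)))"
      using ts s t by (simp only: scale_kernel_low_dim[OF m s] int_k2 less_imp_le \<open>k2 \<in> borel_measurable borel\<close>)
        (simp add: k2_def ennreal_mult del: of_nat_add)
    also have "\<dots> = ennreal (1 / ?n * (t ^ (m + 3) * (real (m + 2) * inverse s ^ (m + 3)))
        + real (m + 2) / ?n * (1 / s * (t - t ^ (m + 3) * inverse s ^ (m + 2))))"
    proof -
      have "ennreal A * ennreal B + ennreal C * (ennreal D * ennreal E) = ennreal (A * B + C * (D * E))"
        if "0 \<le> A" "0 \<le> B" "0 \<le> C" "0 \<le> D" "0 \<le> E" for A B C D E
        using that by (simp add: ennreal_mult)
      from this[OF _ _ _ _ pos] show ?thesis using s t by simp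
    qed
    also have "1 / ?n * (t ^ (m + 3) * (real (m + 2) * inverse s ^ (m + 3)))
        + real (m + 2) / ?n * (1 / s * (t - t ^ (m + 3) * inverse s ^ (m + 2))) = real (m + 2) / ?n * (1 / s * t)"
    proof -
      have "1 / N * (T * (M * (x * Y))) + M / N * (x * (t - T * Y)) = M / N * (x * t)" for N T M x Y :: real
        by (simp add: algebra_simps add_divide_distrib diff_divide_distrib)
      moreover have "inverse s ^ (m + 3) = inverse s * inverse s ^ (m + 2)" "1 / s = inverse s"
        by (simp_all add: eval_nat_numeral inverse_eq_divide)
      ultimately show ?thesis by (simp only:)
    qed
    finally show ?thesis using k1 ts by simp
  qed
  have "ennreal t = (\<integral>\<^sup>+y. k1 y * indicator {0..1} y \<partial>lborel)"
  proof -
    have "(\<integral>\<^sup>+y. k1 y * indicator {0..1} y \<partial>lborel) = (\<integral>\<^sup>+y. indicator {0..t} y \<partial>lborel)"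
      using t by (intro nn_integral_cong) (auto simp: k1_def split: split_indicator)
    then show ?thesis using t by simp
  qed
  also have "\<dots> = (\<integral>\<^sup>+s. ennreal (g s) * scale_kernel m k1 s * indicator {0..1} s \<partial>lborel)"
    using gr_defines_rbs_scale_kernel[OF g rbs, of k1] by simp
  also have "\<dots> = (\<integral>\<^sup>+s. ennreal (indicator {0..1} s * g s) * indicator {0..t} s + ennreal (indicator {0..1} s * g s) * scale_kernel m k2 s \<partial>lborel)"
    using AE_lborel_singleton[of "0::real"]
    by (intro nn_integral_cong_AE) (auto elim!: eventually_mono simp: eq distrib_left split: split_indicator)
  also have "\<dots> = (\<integral>\<^sup>+s. ennreal (indicator {0..1} s * g s) * indicator {0..t} s \<partial>lborel) + (\<integral>\<^sup>+s. ennreal (indicator {0..1} s * g s) * scale_kernel m k2 s \<partial>lborel)"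
  proof -
    have [measurable]: "(\<lambda>s. indicator {0..1} s * g s) \<in> borel_measurable borel"
      using g by (simp add: unit_interval_density_def set_borel_measurable_def)
    have [measurable]: "scale_kernel m k2 \<in> borel_measurable borel"
      unfolding scale_kernel_def[abs_def] by measurable
    show ?thesis by (intro nn_integral_add) measurable
  qed
  also have "(\<integral>\<^sup>+s. ennreal (indicator {0..1} s * g s) * scale_kernel m k2 s \<partial>lborel) = (\<integral>\<^sup>+s. ennreal (g s) * scale_kernel m k2 s * indicator {0..1} s \<partial>lborel)"
    by (intro nn_integral_cong) (auto split: split_indicator)
  also have "\<dots> = (\<integral>\<^sup>+y. k2 y * indicator {0..1} y \<partial>lborel)"
    using gr_defines_rbs_scale_kernel[OF g rbs, of k2] by simp
  also have "\<dots> = ennreal (t - t ^ (m + 3))"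
    using int_k2[of 1] t by simp
  also have "(\<integral>\<^sup>+s. ennreal (indicator {0..1} s * g s) * indicator {0..t} s \<partial>lborel) = (\<integral>\<^sup>+s. ennreal (g s) * indicator {0..t} s \<partial>lborel)"
    using t by (intro nn_integral_cong) (auto split: split_indicator)
  finally have sum: "ennreal t = (\<integral>\<^sup>+s. ennreal (g s) * indicator {0..t} s \<partial>lborel) + ennreal (t - t ^ (m + 3))" .
  have le: "t ^ (m + 3) \<le> t" using t power_decreasing[of 1 "m + 3" t] by simp
  have "ennreal (t ^ (m + 3)) + ennreal (t - t ^ (m + 3)) = ennreal t"
    using t le by (subst ennreal_plus[symmetric]) auto
  then have "ennreal (t - t ^ (m + 3)) + (\<integral>\<^sup>+s. ennreal (g s) * indicator {0..t} s \<partial>lborel)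
      = ennreal (t - t ^ (m + 3)) + ennreal (t ^ (m + 3))"
    using sum by (simp only: add.commute)
  then show ?thesis by (subst (asm) ennreal_add_left_cancel) auto
qed

text \<open>The measures with densities \<open>g\<close> and \<open>p\<close>, cut off outside
  \<open>{0..1}\<close>, have the same distribution function, hence coincide; densities of one
  measure with respect to Lebesgue measure agree almost everywhere.\<close>

lemma density_eq_power:
  assumes g: "unit_interval_density g"
    and cdf: "\<And>t. 0 < t \<Longrightarrow> t \<le> 1 \<Longrightarrow> (\<integral>\<^sup>+s. ennreal (g s) * indicator {0..t} s \<partial>lborel) = ennreal (t ^ Suc j)"
  shows "AE s in lborel. s \<in> {0..1} \<longrightarrow> g s = real (Suc j) * s ^ j"
proof -
  define D where "D d = density lborel (\<lambda>s. ennreal (indicator {0..1} s * d s))" for d :: "real \<Rightarrow> real"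
  have cdf_D: "real_distribution (D d) \<and> cdf (D d) = (\<lambda>x. if x \<le> 0 then 0 else (min x 1) ^ Suc j)"
    if [measurable]: "(\<lambda>s. indicator {0..1} s * d s) \<in> borel_measurable borel"
      and d: "\<And>t. 0 < t \<Longrightarrow> t \<le> 1 \<Longrightarrow> (\<integral>\<^sup>+s. ennreal (d s) * indicator {0..t} s \<partial>lborel) = ennreal (t ^ Suc j)" for d
  proof
    have em: "emeasure (D d) A = (\<integral>\<^sup>+s. ennreal (d s) * indicator ({0..1} \<inter> A) s \<partial>lborel)" if "A \<in> sets borel" for A
      unfolding D_def using that
      by (subst emeasure_density) (auto intro!: nn_integral_cong split: split_indicator)
    have "emeasure (D d) (space (D d)) = 1" using em[of UNIV] d[of 1] by (simp add: D_def)
    then have "prob_space (D d)" by (rule prob_spaceI)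
    then show "real_distribution (D d)"
      by (simp add: real_distribution_def real_distribution_axioms_def D_def)
    show "cdf (D d) = (\<lambda>x. if x \<le> 0 then 0 else (min x 1) ^ Suc j)"
    proof
      fix x
      have "emeasure (D d) {..x} = ennreal (if x \<le> 0 then 0 else (min x 1) ^ Suc j)"
      proof (cases "x \<le> 0")
        case True
        have "(\<integral>\<^sup>+s. ennreal (d s) * indicator ({0..1} \<inter> {..x}) s \<partial>lborel) = (\<integral>\<^sup>+(s::real). 0 \<partial>lborel)"
        proof (rule nn_integral_cong_AE)
          show "AE s in lborel. ennreal (d s) * indicator ({0..1} \<inter> {..x}) s = 0"
            using AE_lborel_singleton[of "0::real"]
            by eventually_elim (use True in \<open>auto split: split_indicator\<close>)
        qed
        then have "emeasure (D d) {..x} = 0" using em[of "{..x}"] by simp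
        then show ?thesis using True by simp
      next
        case False
        have "{0..1} \<inter> {..x} = {0..min x 1}" by auto
        then show ?thesis using False em[of "{..x}"] d[of "min x 1"] by simp
      qed
      then show "cdf (D d) x = (if x \<le> 0 then 0 else (min x 1) ^ Suc j)"
        by (simp add: cdf_def measure_def)
    qed
  qed
  define p where "p s = real (Suc j) * s ^ j" for s :: real
  have mp: "(\<lambda>s. indicator {0..1} s * p s) \<in> borel_measurable borel"
    unfolding p_def by measurable
  have mg: "(\<lambda>s. indicator {0..1} s * g s) \<in> borel_measurable borel"
    using g by (simp add: unit_interval_density_def set_borel_measurable_def)
  have "real_distribution (D g) \<and> cdf (D g) = (\<lambda>x. if x \<le> 0 then 0 else (min x 1) ^ Suc j)"
    using mg cdf by (rule cdf_D)
  moreover have "real_distribution (D p) \<and> cdf (D p) = (\<lambda>x. if x \<le> 0 then 0 else (min x 1) ^ Suc j)"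
    using mp by (rule cdf_D) (subst p_def, subst nn_integral_power_interval, auto)
  ultimately have "D g = D p" by (intro cdf_unique) auto
  then have "AE s in lborel. ennreal (indicator {0..1} s * g s) = ennreal (indicator {0..1} s * p s)"
    unfolding D_def using mg mp by (intro sigma_finite_measure.density_unique[OF sigma_finite_lborel]) auto
  then show ?thesis
  proof eventually_elim
    case (elim s)
    show ?case
    proof
      assume s: "s \<in> {0..1}"
      then have "0 \<le> g s" "0 \<le> p s" using g by (auto simp: unit_interval_density_def p_def)
      then show "g s = real (Suc j) * s ^ j" using elim s by (simp add: p_def del: of_nat_Suc)
    qed
  qed
qed

text \<open>With \<open>n = m + 3\<close>, the atom of \<open>R\<close> contributes the weight
  \<open>y ^ (n - 1)\<close> to \<open>k y\<close>, and its uniform part contributes the integral of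
  \<open>(n - 1) * s ^ (n - 2)\<close> over \<open>{y..1}\<close>, which is
  \<open>1 - y ^ (n - 1)\<close>. The weights add up to 1, so the folded law is uniform.\<close>

lemma gr_rbs_low_dim:
  assumes m: "m < 2" and g: "unit_interval_density g"
    and gp: "AE s in lborel. s \<in> {0..1} \<longrightarrow> g s = real (m + 3) * s ^ (m + 2)"
  shows "gr_defines_rbs (m + 3) g"
  unfolding gr_defines_rbs_iff[OF g]
proof
  fix h :: "real \<Rightarrow> ennreal" assume [measurable]: "h \<in> borel_measurable borel"
  let ?n = "real (m + 3)"
  define k where "k y = h y + h (- y)" for y
  have [measurable]: "k \<in> borel_measurable borel" unfolding k_def[abs_def] by measurable
  define I where "I s = (\<integral>\<^sup>+y. k y * indicator {0..s} y \<partial>lborel)" for s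
  have [measurable]: "I \<in> borel_measurable borel"
    unfolding I_def[abs_def] atLeastAtMost_iff indicator_def by measurable
  have radial: "radial_kernel m h s = ennreal (1 / 2) * scale_kernel m k s" for s
  proof -
    have "(\<integral>\<^sup>+r. h (s * r) * ennreal (facet_density m r) * indicator {-1..1} r \<partial>lborel)
       = (\<integral>\<^sup>+r. k (s * r) * ennreal (facet_density m r) * indicator {0..1} r \<partial>lborel)"
      by (subst nn_integral_fold_interval) (auto simp: facet_density_minus k_def distrib_right)
    moreover have "ennreal (a / (2 * ?n)) = ennreal (1 / 2) * ennreal (a / ?n)" if "0 \<le> a" for a
      using that by (subst ennreal_mult[symmetric]) (simp_all del: of_nat_add)
    ultimately show ?thesis
      by (simp only: radial_kernel_def scale_kernel_def k_def distrib_left mult.assoc zero_le_one of_nat_0_le_iff)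
  qed
  have "(\<integral>\<^sup>+s. ennreal (g s) * radial_kernel m h s * indicator {0..1} s \<partial>lborel)
      = (\<integral>\<^sup>+s. ennreal (1 / 2) * (ennreal (s ^ (m + 2)) * k s * indicator {0..1} s
           + ennreal (real (m + 2) * s ^ (m + 1)) * I s * indicator {0..1} s) \<partial>lborel)"
  proof (rule nn_integral_cong_AE)
    show "AE s in lborel. ennreal (g s) * radial_kernel m h s * indicator {0..1} s
      = ennreal (1 / 2) * (ennreal (s ^ (m + 2)) * k s * indicator {0..1} s
           + ennreal (real (m + 2) * s ^ (m + 1)) * I s * indicator {0..1} s)"
      using gp AE_lborel_singleton[of "0::real"]
    proof eventually_elim
      case (elim s)
      show ?case
      proof (cases "s \<in> {0..1}")
        case True
        then have s: "0 < s" and gs: "g s = ?n * s ^ (m + 2)" using elim by auto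
        have "ennreal (g s) * ennreal (1 / ?n) = ennreal (s ^ (m + 2))"
          unfolding gs using s by (simp add: ennreal_mult[symmetric] del: of_nat_add)
        moreover have "ennreal (g s) * (ennreal (real (m + 2) / ?n) * ennreal (1 / s)) = ennreal (real (m + 2) * s ^ (m + 1))"
        proof -
          have "ennreal (g s) * (ennreal (real (m + 2) / ?n) * ennreal (1 / s)) = ennreal (g s * (real (m + 2) / ?n * (1 / s)))"
          proof -
            have "ennreal A * (ennreal B * ennreal C) = ennreal (A * (B * C))" if "0 \<le> A" "0 \<le> B" for A B C
              using that by (simp add: ennreal_mult')
            then show ?thesis using s gs by simp
          qed
          also have "g s * (real (m + 2) / ?n * (1 / s)) = real (m + 2) * s ^ (m + 1)"
            using s by (simp add: gs power_add power2_eq_square del: of_nat_add)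
          finally show ?thesis .
        qed
        moreover have "ennreal (g s) * radial_kernel m h s
          = ennreal (1 / 2) * ((ennreal (g s) * ennreal (1 / ?n)) * k s + (ennreal (g s) * (ennreal (real (m + 2) / ?n) * ennreal (1 / s))) * I s)"
          unfolding radial scale_kernel_low_dim[OF m s \<open>k \<in> borel_measurable borel\<close>] I_def
          by (simp only: distrib_left mult_ac)
        ultimately show ?thesis using True by simp
      qed simp
    qed
  qed
  also have "\<dots> = ennreal (1 / 2) * ((\<integral>\<^sup>+s. ennreal (s ^ (m + 2)) * k s * indicator {0..1} s \<partial>lborel)
      + (\<integral>\<^sup>+s. ennreal (real (m + 2) * s ^ (m + 1)) * I s * indicator {0..1} s \<partial>lborel))"
    by (subst nn_integral_cmult, measurable) (subst nn_integral_add, auto)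
  also have "(\<integral>\<^sup>+s. ennreal (real (m + 2) * s ^ (m + 1)) * I s * indicator {0..1} s \<partial>lborel)
     = (\<integral>\<^sup>+y. ennreal (1 - y ^ (m + 2)) * k y * indicator {0..1} y \<partial>lborel)"
  proof -
    \<comment> \<open>The condition \<open>y \<le> s\<close> is moved into the integrand, so that
      exchanging the integrals exposes a power integral in \<open>s\<close> for each fixed
      \<open>y\<close>.\<close>
    let ?f = "\<lambda>s y. ennreal (real (m + 2) * s ^ (m + 1)) * indicator {0..1} s * (k y * (if 0 \<le> y \<and> y \<le> s then 1 else 0))"
    have "(\<integral>\<^sup>+s. ennreal (real (m + 2) * s ^ (m + 1)) * I s * indicator {0..1} s \<partial>lborel) = (\<integral>\<^sup>+s. \<integral>\<^sup>+y. ?f s y \<partial>lborel \<partial>lborel)"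
    proof (rule nn_integral_cong)
      fix s :: real
      have "(\<integral>\<^sup>+y. ?f s y \<partial>lborel) = ennreal (real (m + 2) * s ^ (m + 1)) * indicator {0..1} s * (\<integral>\<^sup>+y. k y * (if 0 \<le> y \<and> y \<le> s then 1 else 0) \<partial>lborel)"
        by (intro nn_integral_cmult) measurable
      also have "(\<integral>\<^sup>+y. k y * (if 0 \<le> y \<and> y \<le> s then 1 else 0) \<partial>lborel) = I s"
        unfolding I_def by (intro nn_integral_cong) (auto split: split_indicator)
      finally show "ennreal (real (m + 2) * s ^ (m + 1)) * I s * indicator {0..1} s = (\<integral>\<^sup>+y. ?f s y \<partial>lborel)"
        by (simp add: mult_ac)
    qed
    also have "\<dots> = (\<integral>\<^sup>+y. \<integral>\<^sup>+s. ?f s y \<partial>lborel \<partial>lborel)"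
      by (intro lborel_pair.Fubini') measurable
    also have "\<dots> = (\<integral>\<^sup>+y. ennreal (1 - y ^ (m + 2)) * k y * indicator {0..1} y \<partial>lborel)"
    proof (rule nn_integral_cong)
      fix y :: real
      show "(\<integral>\<^sup>+s. ?f s y \<partial>lborel) = ennreal (1 - y ^ (m + 2)) * k y * indicator {0..1} y"
      proof (cases "y \<in> {0..1}")
        case True
        have "(\<integral>\<^sup>+s. ?f s y \<partial>lborel) = (\<integral>\<^sup>+s. k y * (ennreal (real (Suc (m + 1)) * s ^ (m + 1)) * indicator {y..1} s) \<partial>lborel)"
          using True by (intro nn_integral_cong) (auto split: split_indicator simp: mult.commute)
        also have "\<dots> = k y * ennreal (1 ^ Suc (m + 1) - y ^ Suc (m + 1))"
          using True by (subst nn_integral_cmult) (auto simp: nn_integral_power_interval simp del: of_nat_Suc power_Suc)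
        finally show ?thesis using True by (simp add: mult.commute)
      next
        case False
        then have "?f s y = 0" for s by (auto split: split_indicator)
        then have "(\<integral>\<^sup>+s. ?f s y \<partial>lborel) = 0" by (simp only: nn_integral_const mult_zero_left)
        then show ?thesis using False by simp
      qed
    qed
    finally show ?thesis .
  qed
  also have "(\<integral>\<^sup>+s. ennreal (s ^ (m + 2)) * k s * indicator {0..1} s \<partial>lborel) + \<dots>
      = (\<integral>\<^sup>+y. ennreal (y ^ (m + 2)) * k y * indicator {0..1} y + ennreal (1 - y ^ (m + 2)) * k y * indicator {0..1} y \<partial>lborel)"
    by (intro nn_integral_add[symmetric]) measurable
  also have "\<dots> = (\<integral>\<^sup>+y. k y * indicator {0..1} y \<partial>lborel)"
  proof (rule nn_integral_cong)
    fix y :: real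
    have "ennreal (y ^ (m + 2)) + ennreal (1 - y ^ (m + 2)) = 1" if "y \<in> {0..1}"
      using that power_le_one[of y "m + 2"] by (subst ennreal_plus[symmetric]) auto
    then show "ennreal (y ^ (m + 2)) * k y * indicator {0..1} y + ennreal (1 - y ^ (m + 2)) * k y * indicator {0..1} y = k y * indicator {0..1} y"
      by (cases "y \<in> {0..1}") (simp_all flip: distrib_right)
  qed
  also have "\<dots> = (\<integral>\<^sup>+y. h y * indicator {-1..1} y \<partial>lborel)"
    unfolding k_def by (rule nn_integral_fold_interval[symmetric]) measurable
  finally show "(\<integral>\<^sup>+s. ennreal (g s) * radial_kernel m h s * indicator {0..1} s \<partial>lborel)
      = ennreal (1 / 2) * (\<integral>\<^sup>+y. h y * indicator {-1..1} y \<partial>lborel)" .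
qed

subsection \<open>The classification\<close>

theorem theorem12:
  fixes n :: nat and g :: "real \<Rightarrow> real"
  assumes "3 \<le> n" and "n \<le> 250"
    and "unit_interval_density g"
  shows "gr_defines_rbs n g \<longleftrightarrow>
    (n = 3 \<and> (AE s in lborel. s \<in> {0..1} \<longrightarrow> g s = 3 * s ^ 2)) \<or>
    (n = 4 \<and> (AE s in lborel. s \<in> {0..1} \<longrightarrow> g s = 4 * s ^ 3))"
proof -
  have low: "gr_defines_rbs (m + 3) g \<longleftrightarrow> (AE s in lborel. s \<in> {0..1} \<longrightarrow> g s = real (m + 3) * s ^ (m + 2))"
    if m: "m < 2" for m
  proof
    assume "gr_defines_rbs (m + 3) g"
    then have "AE s in lborel. s \<in> {0..1} \<longrightarrow> g s = real (Suc (m + 2)) * s ^ (m + 2)"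
      using gr_rbs_low_dim_cdf[OF m assms(3)] by (intro density_eq_power[OF assms(3)]) (simp add: eval_nat_numeral)
    then show "AE s in lborel. s \<in> {0..1} \<longrightarrow> g s = real (m + 3) * s ^ (m + 2)"
      by (simp add: eval_nat_numeral)
  qed (rule gr_rbs_low_dim[OF m assms(3)])
  consider "n = 0 + 3" | "n = 1 + 3" | k where "n = Suc (Suc k) + 3"
    using assms(1) by (metis One_nat_def add.commute le_add_diff_inverse not0_implies_Suc)
  then show ?thesis
  proof cases
    case 1
    then show ?thesis using low[of 0] by (simp add: power2_eq_square)
  next
    case 2
    then show ?thesis using low[of 1] by (simp add: eval_nat_numeral)
  next
    case 3
    then show ?thesis using gr_not_rbs_ge_5[OF assms(3)] by simp
  qed
qed

end
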